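(* Let $(X_n)_{n\ge 0}$ be the two-armed bandit algorithm with parameters $p_A,p_B\in[0,1]$ and step sequence $(\gamma_n)_{n\ge1}$ (defined in the context), let $\Gamma_n=\gamma_1+\cdots+\gamma_n$, $\pi=p_A-p_B$, $h(y)=y(1-y)$, and let $X_\infty$ denote the a.s. limit of $X_n$. (a) Almost sure convergence. (i) If $0<p_B<p_A\le 1$ and $x\in(0,1)$, then $(X_n)_{n\ge0}$ is a bounded submartingale under $\mathbb{P}_x$, hence $\mathbb{P}_x$-a.s. converging toward a random variable $X_\infty$. The random variable $X_\infty$ takes values in $\{0,1\}$ and $$\mathbb{P}_x(X_\infty=1)=x+\pi\sum_{n\ge0}\gamma_{n+1}\mathbb{E}_x(h(X_n))>x+\pi\gamma_1x(1-x)>x.$$ (If $p_B=0$ and $p_A>0$, then $X_n$ is nondecreasing and converges toward $1$, $\mathbb{P}_x$-a.s. for $x\in(0,1)$.) (ii) If $0<p_B=p_A\le1$ and $x\in(0,1)$, then $(X_n)_{n\ge0}$ is a bounded martingale, $\mathbb{P}_x$-a.s. converging toward a random variable $X_\infty$. Moreover, if $\sum_{n\ge0}\gamma_{n+1}^2=+\infty$, then $X_\infty$ is $\{0,1\}$-valued with Bernoulli$(x)$ distribution. (If $p_B=p_A=0$, then $X_n=x$ $\mathbb{P}_x$-a.s. for every $n\ge0$.) (iii) If $x\in\{0,1\}$, then $X_n=x$ $\mathbb{P}_x$-a.s. for every $n\ge0$. (b) Convergence to $0$ with positive probability. If $$\sum_{n\ge0}\prod_{k=1}^n(1-p_B\gamma_k)<+\infty,$$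 then $\mathbb{P}_x(X_\infty=0)>0$ for every $x\in[0,1)$. In particular, under this summability condition: (i) if $0<p_B<p_A\le1$, then for every $x\in(0,1)$ the algorithm starting from $x$ is fallible, i.e. $\mathbb{P}_x(X_n\to0)>0$; (ii) if $0<p_B=p_A\le1$ and $\sum_n\gamma_n^2<+\infty$, then for every $x\in(0,1)$ the three probabilities $\mathbb{P}_x(X_\infty=0)$, $\mathbb{P}_x(X_\infty=1)$ and $\mathbb{P}_x(X_\infty\in(0,1))$ are all positive. (c) Convergence to a nonzero value. Assume $0\le p_B\le p_A\le1$ and $$\gamma_n=O\big(\Gamma_ne^{-p_B\Gamma_n}\big)\quad\text{as } n\to\infty.$$ Then $\mathbb{P}_x(X_\infty=0)=0$ for every $x\in(0,1]$. In particular, under this condition on the steps: (i) if $0\le p_B<p_A\le1$, then for every $x\in(0,1]$, $X_\infty=1$ $\mathbb{P}_x$-a.s. (the algorithm is a.s. infallible); (ii) if $0\le p_B=p_A\le1$, then for every $x\in(0,1)$, $X_\infty\in(0,1)$ $\mathbb{P}_x$-a.s.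
   Context: Two-armed bandit algorithm: let $(U_n)_{n\ge1}$ be i.i.d. random variables uniformly distributed on $[0,1]$, and let $(A_n)_{n\ge1},(B_n)_{n\ge1}$ be events such that $(\mathbf 1_{A_n},\mathbf 1_{B_n})_{n\ge1}$ is an i.i.d. sequence, independent of $(U_n)_{n\ge1}$, with $\mathbb{P}(A_1)=p_A$ and $\mathbb{P}(B_1)=p_B$. The steps satisfy $\gamma_n\in(0,1)$ for all $n\ge1$ and $\Gamma_n:=\gamma_1+\cdots+\gamma_n\to+\infty$. The algorithm starting from $x\in[0,1]$ is defined by $X_0=x$ and, for $n\ge0$, $$X_{n+1}=X_n+\gamma_{n+1}\big((1-X_n)\mathbf 1_{\{U_{n+1}\le X_n\}\cap A_{n+1}}-X_n\mathbf 1_{\{U_{n+1}>X_n\}\cap B_{n+1}}\big).$$ $\mathbb{P}_x$ (resp. $\mathbb{E}_x$) denotes probability (resp. expectation) when $X_0=x$. (Sub)martingales are with respect to the filtration $\mathcal F_0$ trivial, $\mathcal F_n=\sigma(U_k,\mathbf 1_{A_k},\mathbf 1_{B_k};\,1\le k\le n)$. The a.s. limit $X_\infty=\lim_nX_n$ always exists, since $(X_n)$ is $[0,1]$-valued and a submartingale or supermartingale according to the sign of $p_A-p_B$. An empty product equals $1$. *)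

theory Defs
  imports "HOL-Probability.Probability" "HOL-Library.Landau_Symbols"
begin

definition submartingale :: "'a measure \<Rightarrow> (nat \<Rightarrow> 'a measure) \<Rightarrow> (nat \<Rightarrow> 'a \<Rightarrow> real) \<Rightarrow> bool" where
  "submartingale M F Y \<longleftrightarrow>
     filtration (space M) F \<and> (\<forall>n. subalgebra M (F n)) \<and>
     (\<forall>n. Y n \<in> borel_measurable (F n)) \<and> (\<forall>n. integrable M (Y n)) \<and>
     (\<forall>n. AE \<omega> in M. Y n \<omega> \<le> real_cond_exp M (F n) (Y (Suc n)) \<omega>)"

definition martingale :: "'a measure \<Rightarrow> (nat \<Rightarrow> 'a measure) \<Rightarrow> (nat \<Rightarrow> 'a \<Rightarrow> real) \<Rightarrow> bool" where
  "martingale M F Y \<longleftrightarrow>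
     filtration (space M) F \<and> (\<forall>n. subalgebra M (F n)) \<and>
     (\<forall>n. Y n \<in> borel_measurable (F n)) \<and> (\<forall>n. integrable M (Y n)) \<and>
     (\<forall>n. AE \<omega> in M. real_cond_exp M (F n) (Y (Suc n)) \<omega> = Y n \<omega>)"

definition cumulative_step :: "(nat \<Rightarrow> real) \<Rightarrow> nat \<Rightarrow> real" where
  "cumulative_step \<gamma> n = (\<Sum>k=1..n. \<gamma> k)"

definition indicator_pair :: "(nat \<Rightarrow> 'a set) \<Rightarrow> (nat \<Rightarrow> 'a set) \<Rightarrow> nat \<Rightarrow> 'a \<Rightarrow> real \<times> real" where
  "indicator_pair A B n \<omega> = (indicator (A n) \<omega>, indicator (B n) \<omega>)"

text \<open>All sequences are indexed from 1; the values of \<open>U\<close>, \<open>A\<close>, \<open>B\<close>, \<open>\<gamma>\<close> at 0 are irrelevant.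
  For a fixed \<open>n\<close>, the events \<open>A n\<close> and \<open>B n\<close> need not be independent of each other.
  Independence of the two sequences is stated for the sigma-algebras they generate, because
  \<^const>\<open>prob_space.indep_var\<close> only relates random variables with values in the same type.\<close>

locale two_armed_bandit = prob_space M for M :: "'a measure" +
  fixes U :: "nat \<Rightarrow> 'a \<Rightarrow> real" and A B :: "nat \<Rightarrow> 'a set"
    and p\<^sub>A p\<^sub>B :: real and \<gamma> :: "nat \<Rightarrow> real"
  assumes U_indep: "indep_vars (\<lambda>_. borel) U {1..}"
    and U_uniform: "\<And>n. n \<ge> 1 \<Longrightarrow> distr M borel (U n) = uniform_measure lborel {0..1}"
    and A_event: "\<And>n. n \<ge> 1 \<Longrightarrow> A n \<in> events"
    and B_event: "\<And>n. n \<ge> 1 \<Longrightarrow> B n \<in> events"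
    and AB_indep: "indep_vars (\<lambda>_. borel) (indicator_pair A B) {1..}"
    and AB_ident: "\<And>n. n \<ge> 1 \<Longrightarrow>
          distr M borel (indicator_pair A B n) = distr M borel (indicator_pair A B 1)"
    and U_AB_indep: "indep_set
          (sets (vimage_algebra (space M) (\<lambda>\<omega>. \<lambda>n\<in>{1..}. U n \<omega>) (\<Pi>\<^sub>M n\<in>{1..}. borel)))
          (sets (vimage_algebra (space M) (\<lambda>\<omega>. \<lambda>n\<in>{1..}. indicator_pair A B n \<omega>)
             (\<Pi>\<^sub>M n\<in>{1..}. borel)))"
    and prob_A: "prob (A 1) = p\<^sub>A"
    and prob_B: "prob (B 1) = p\<^sub>B"
    and step_range: "\<And>n. n \<ge> 1 \<Longrightarrow> 0 < \<gamma> n \<and> \<gamma> n < 1"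
    and step_diverges: "filterlim (cumulative_step \<gamma>) at_top sequentially"

primrec bandit :: "(nat \<Rightarrow> 'a \<Rightarrow> real) \<Rightarrow> (nat \<Rightarrow> 'a set) \<Rightarrow> (nat \<Rightarrow> 'a set) \<Rightarrow> (nat \<Rightarrow> real)
    \<Rightarrow> real \<Rightarrow> nat \<Rightarrow> 'a \<Rightarrow> real" where
  "bandit U A B \<gamma> x 0 = (\<lambda>\<omega>. x)"
| "bandit U A B \<gamma> x (Suc n) = (\<lambda>\<omega>. bandit U A B \<gamma> x n \<omega> + \<gamma> (Suc n) *
     ((1 - bandit U A B \<gamma> x n \<omega>)
          * indicator ({\<omega>'. U (Suc n) \<omega>' \<le> bandit U A B \<gamma> x n \<omega>'} \<inter> A (Suc n)) \<omega>
      - bandit U A B \<gamma> x n \<omega>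
          * indicator ({\<omega>'. U (Suc n) \<omega>' > bandit U A B \<gamma> x n \<omega>'} \<inter> B (Suc n)) \<omega>))"

text \<open>Meaningful wherever the sequence converges, which is almost everywhere.\<close>

definition bandit_limit :: "(nat \<Rightarrow> 'a \<Rightarrow> real) \<Rightarrow> (nat \<Rightarrow> 'a set) \<Rightarrow> (nat \<Rightarrow> 'a set) \<Rightarrow> (nat \<Rightarrow> real)
    \<Rightarrow> real \<Rightarrow> 'a \<Rightarrow> real" where
  "bandit_limit U A B \<gamma> x \<omega> = lim (\<lambda>n. bandit U A B \<gamma> x n \<omega>)"

text \<open>The sigma-algebra generated by an indicator is the one generated by the event itself.\<close>

definition bandit_filtration :: "'a measure \<Rightarrow> (nat \<Rightarrow> 'a \<Rightarrow> real) \<Rightarrow> (nat \<Rightarrow> 'a set) \<Rightarrow> (nat \<Rightarrow> 'a set)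
    \<Rightarrow> nat \<Rightarrow> 'a measure" where
  "bandit_filtration M U A B n =
     sigma (space M) (\<Union>k\<in>{1..n}. {U k -` S \<inter> space M | S. S \<in> sets borel} \<union> {A k, B k})"

end

theory Submission
  imports Defs
begin

text \<open>
  Each one-step expectation is explicit: a test function \<open>\<psi>\<close> of \<open>X\<close> is mapped to
  \<open>\<psi> y + p\<^sub>A y (\<psi> (y + \<gamma> (1 - y)) - \<psi> y) + p\<^sub>B (1 - y) (\<psi> (y - \<gamma> y) - \<psi> y)\<close>, and everything follows from a
  suitable choice of \<open>\<psi>\<close>. The functions \<open>y\<close> and \<open>y\<^sup>2\<close> show that drift and variance are summable, so a
  Kolmogorov maximal inequality gives almost sure convergence; since \<open>\<Sum>\<gamma> E (h X)\<close> (or \<open>\<Sum>\<gamma>\<^sup>2 E (h X)\<close>)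
  converges while the weights diverge, \<open>h\<close> vanishes at the limit.

  For (b), the event that arm \<open>A\<close> is never drawn has positive probability, and on it the mean of \<open>X\<close>
  is at most \<open>x \<Prod>(1 - p\<^sub>B \<gamma>)\<close>.

  For (c), put \<open>R n = const \<cdot> \<Gamma> n e\<^bsup>-p\<^sub>B \<Gamma> n\<^esup>\<close>, which dominates both \<open>\<gamma>\<close> and the tails of \<open>\<Sum>\<gamma>\<^sup>2\<close>. Since
  \<open>e\<^bsup>-p\<^sub>B \<Gamma> n\<^esup> / X n\<close> is essentially a supermartingale losing a multiple of \<open>\<gamma> n / \<Gamma> n\<close> as long as \<open>X < R\<close>,
  and \<open>\<Sum>\<gamma> n / \<Gamma> n\<close> diverges, \<open>X\<close> exceeds \<open>R\<close> infinitely often. Each time it does, the function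
  \<open>R / (R + y)\<close> shows that the conditional probability of converging to 0 is at most 3/4.
\<close>

subsection \<open>Auxiliary inequalities\<close>

text \<open>The probabilistic input is confined to the conditional probabilities of three events
  given the past, stated as integrals against bounded weights \<open>Z\<close>. Since
  \<open>Z\<close> may be the indicator of any past event, stopping arguments become inductions over
  shrinking events or sums over first times. Convergence is derived from the absolute size of the
  drift, so one proof serves either sign of p_A - p_B, and also the mirrored chain. In (c) the
  threshold has to move: on the event that X tends to 0 no fixed positive level is reached
  infinitely often, so the level must match the noise still to come, which the tail of
  \<Sum>\<gamma>^2 measures. A level below that order would not protect the path from being pushed
  to 0; one that is too high would make waiting below it too cheap, because the loss per step is
  \<gamma> times \<theta> / (R + \<gamma>) and must sum to infinity. The growth condition reconciles
  both demands: it bounds the tails of \<Sum>\<gamma>^2 by tail integrals of t exp (- p_B t), and it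
  keeps R + \<gamma> of order \<Gamma> exp (- p_B \<Gamma>), so that the loss is at least of order
  \<gamma> / \<Gamma>.\<close>

lemma (in prob_space) integrable_bounded:
  fixes f :: "'a \<Rightarrow> real"
  assumes "f \<in> borel_measurable M" "\<And>\<omega>. \<omega> \<in> space M \<Longrightarrow> \<bar>f \<omega>\<bar> \<le> c"
  shows "integrable M f"
  using assms by (intro integrable_const_bound[of _ c]) auto

lemma abs_mult_le_left:
  fixes u v w :: real
  assumes "\<bar>u\<bar> \<le> w" "0 \<le> v" "v \<le> 1"
  shows "\<bar>u * v\<bar> \<le> w"
  using assms mult_mono[of "\<bar>u\<bar>" w "\<bar>v\<bar>" 1] by (simp add: abs_mult)

lemma bounded_update:
  fixes y g :: real
  assumes "0 \<le> y" "y \<le> 1" "0 \<le> g" "g \<le> 1" "\<not> (p \<and> q)"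
  shows "0 \<le> y + g * ((1 - y) * of_bool p - y * of_bool q)"
    "y + g * ((1 - y) * of_bool p - y * of_bool q) \<le> 1"
proof -
  have "g * (1 - y) \<le> 1 * (1 - y)" "g * y \<le> 1 * y" "0 \<le> g * (1 - y)" "0 \<le> g * y"
    using assms by (intro mult_right_mono mult_nonneg_nonneg; simp)+
  note bounds = this
  let ?y = "y + g * ((1 - y) * of_bool p - y * of_bool q)"
  have e: "?y = y \<or> ?y = y + g * (1 - y) \<or> ?y = y - g * y"
    using assms(5) by (cases p; cases q) auto
  have range: "0 \<le> z \<and> z \<le> 1" if "z = y \<or> z = y + g * (1 - y) \<or> z = y - g * y" for z
  proof -
    have "y \<le> y + g * (1 - y)" "y + g * (1 - y) \<le> 1" "0 \<le> y - g * y" "y - g * y \<le> y"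
      using bounds by (auto simp: algebra_simps)
    then show ?thesis using that assms(1,2) by fastforce
  qed
  show "0 \<le> ?y" "?y \<le> 1" using range[OF e] by blast+
qed

text \<open>Jensen's inequality at two points: averaging the tangent-line bound at the barycentre
  \<open>?q\<close> cancels the linear terms.\<close>

lemma exp_two_point:
  fixes b u v :: real
  assumes "0 \<le> b" "b \<le> 1"
  shows "exp (b * u + (1 - b) * v) \<le> b * exp u + (1 - b) * exp v"
proof -
  let ?q = "b * u + (1 - b) * v"
  have t: "exp ?q * (1 + (w - ?q)) \<le> exp w" for w
  proof -
    have "exp ?q * (1 + (w - ?q)) \<le> exp ?q * exp (w - ?q)"
      by (intro mult_left_mono exp_ge_add_one_self) simp
    then show ?thesis by (simp only: exp_add[symmetric]) simp
  qed
  have "b * (exp ?q * (1 + (u - ?q))) + (1 - b) * (exp ?q * (1 + (v - ?q))) \<le> b * exp u + (1 - b) * exp v"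
    by (intro add_mono mult_left_mono t) (use assms in auto)
  moreover have "b * (E * (1 + (u - ?q))) + (1 - b) * (E * (1 + (v - ?q))) = E" for E
    by (simp add: algebra_simps)
  ultimately show ?thesis by metis
qed

text \<open>Follows from 1 / (1 - y) = 1 + y / (1 - y) \<le> 1 + y / (1 - x). It turns products of
  factors 1 - y, the chances of escaping a draw, into exponentials of sums.\<close>

lemma exp_le_one_minus:
  fixes x y :: real
  assumes "0 \<le> y" "y \<le> x" "x < 1"
  shows "exp (- (1 / (1 - x) * y)) \<le> 1 - y"
proof -
  have "1 + y / (1 - y) \<le> 1 + 1 / (1 - x) * y"
    using assms by (simp add: frac_le)
  also have "\<dots> \<le> exp (1 / (1 - x) * y)" by (rule exp_ge_add_one_self)
  finally have "1 / (1 - y) \<le> exp (1 / (1 - x) * y)"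
    using assms by (simp add: field_simps)
  then show ?thesis using assms by (simp add: exp_minus field_simps)
qed

text \<open>The right side is the integral of u exp (- b u) over [s, t], because (u / b + 1 / b^2)
  exp (- b u) has derivative - u exp (- b u). The integrand decreases from 1 / b on, so the integral
  is at least the length times the value at t. The proof replaces calculus by the quadratic Taylor
  bound for exp (b (t - s)).\<close>

lemma exp_tail_bound:
  fixes b s t :: real
  assumes b: "0 < b" and s: "1 / b \<le> s" and st: "s \<le> t"
  shows "(t - s) * (t * exp (- b * t)) \<le> (s / b + 1 / b\<^sup>2) * exp (- b * s) - (t / b + 1 / b\<^sup>2) * exp (- b * t)"
proof -
  define d where "d = t - s"
  have d: "0 \<le> d" "t = s + d" using st by (auto simp: d_def)
  have sb: "1 \<le> s * b" "0 \<le> s" using b s by (auto simp: field_simps intro: order_trans[OF _ s])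
  have "t / b + 1 / b\<^sup>2 + d * t + d\<^sup>2 * (s * b - 1) / 2 = (s / b + 1 / b\<^sup>2) * (1 + b * d + (b * d)\<^sup>2 / 2)"
    unfolding d(2) using b by (simp add: field_simps power2_eq_square)
  moreover have "0 \<le> d\<^sup>2 * (s * b - 1) / 2" using sb by simp
  moreover have "(s / b + 1 / b\<^sup>2) * (1 + b * d + (b * d)\<^sup>2 / 2) \<le> (s / b + 1 / b\<^sup>2) * exp (b * d)"
    using b sb d by (intro mult_left_mono exp_lower_Taylor_quadratic) auto
  ultimately have "t / b + 1 / b\<^sup>2 + d * t \<le> (s / b + 1 / b\<^sup>2) * exp (b * d)" by linarith
  then have "(t / b + 1 / b\<^sup>2 + d * t) * exp (- b * t) \<le> (s / b + 1 / b\<^sup>2) * exp (b * d) * exp (- b * t)"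
    by (rule mult_right_mono) simp
  also have "\<dots> = (s / b + 1 / b\<^sup>2) * exp (- b * s)"
    unfolding d(2) by (simp add: mult.assoc exp_add[symmetric] algebra_simps)
  finally show ?thesis unfolding d_def by (simp add: algebra_simps)
qed

text \<open>Abel-Dini. Once the partial sums have more than doubled between m and n, the terms in
  between add up to at least 1/2, since each denominator is at most the last one; this contradicts
  the Cauchy criterion.\<close>

lemma not_summable_div_partial_sum:
  fixes g :: "nat \<Rightarrow> real"
  assumes g: "\<And>n. 0 < g n" and div: "\<not> summable g"
  shows "\<not> summable (\<lambda>n. g n / (\<Sum>k<Suc n. g k))"
proof
  let ?G = "\<lambda>n. \<Sum>k<n. g k"
  assume "summable (\<lambda>n. g n / ?G (Suc n))"
  then obtain N where N: "\<And>m n. N \<le> m \<Longrightarrow> norm (\<Sum>k=m..<n. g k / ?G (Suc k)) < 1 / 2"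
    unfolding summable_Cauchy by (metis half_gt_zero zero_less_one)
  \<comment> \<open>The shift by one makes the sum up to \<open>m\<close> nonempty, hence positive,
    even for N = 0.\<close>
  define m where "m = Suc N"
  have Gm: "0 < ?G m" unfolding m_def using g by (intro sum_pos) auto
  have "\<exists>n. 2 * ?G m < ?G n"
  proof (rule ccontr)
    assume "\<nexists>n. 2 * ?G m < ?G n"
    then have "summable g"
      using g by (intro summableI_nonneg_bounded[of g "2 * ?G m"]) (auto simp: less_imp_le not_less)
    then show False using div by simp
  qed
  then obtain n where n: "2 * ?G m < ?G n" by blast
  have mono: "?G i \<le> ?G j" if "i \<le> j" for i j
    using that g by (intro sum_mono2) (auto simp: less_imp_le)
  have mn: "m \<le> n" using n Gm mono[of n m] by (cases "m \<le> n") auto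
  have "1 / 2 \<le> (?G n - ?G m) / ?G n"
    using n Gm by (simp add: field_simps)
  also have "\<dots> = (\<Sum>k=m..<n. g k / ?G n)"
    using mn by (simp add: sum_diff_nat_ivl lessThan_atLeast0 sum_divide_distrib[symmetric])
  also have "\<dots> \<le> (\<Sum>k=m..<n. g k / ?G (Suc k))"
  proof (rule sum_mono)
    fix k assume k: "k \<in> {m..<n}"
    have "0 < ?G (Suc k)" using g by (intro sum_pos) auto
    moreover have "?G (Suc k) \<le> ?G n" using k by (intro mono) auto
    ultimately show "g k / ?G n \<le> g k / ?G (Suc k)"
      using g[of k] by (intro divide_left_mono mult_pos_pos) auto
  qed
  also have "\<dots> \<le> norm (\<Sum>k=m..<n. g k / ?G (Suc k))" by simp
  also have "\<dots> < 1 / 2" by (rule N) (simp add: m_def)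
  finally show False by simp
qed

subsection \<open>Symmetric two-arm chains\<close>

text \<open>\<open>D n\<close> is the event that the first arm is drawn at step \<open>n + 1\<close>, while \<open>P n\<close> and \<open>Q n\<close> are the events
  that \<open>Y\<close> moves up and down; \<open>g n\<close> is \<open>\<gamma> (n + 1)\<close>. The description is invariant under exchanging
  the arms and replacing \<open>Y\<close> by \<open>1 - Y\<close>, which the thresholds \<open>U \<le> X\<close> and \<open>U > X\<close> are not.\<close>

locale bandit_chain = prob_space M for M :: "'a measure" +
  fixes F :: "nat \<Rightarrow> 'a measure" and Y :: "nat \<Rightarrow> 'a \<Rightarrow> real" and D P Q :: "nat \<Rightarrow> 'a set"
    and a b :: real and g :: "nat \<Rightarrow> real" and x :: real
  assumes F_subalgebra: "\<And>n. subalgebra M (F n)"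
    and F_mono: "\<And>n. sets (F n) \<subseteq> sets (F (Suc n))"
    and Y_adapted: "\<And>n. Y n \<in> borel_measurable (F n)"
    and Y_0: "\<And>\<omega>. Y 0 \<omega> = x"
    and Y_Suc: "\<And>n \<omega>. Y (Suc n) \<omega> =
      Y n \<omega> + g n * ((1 - Y n \<omega>) * indicator (P n) \<omega> - Y n \<omega> * indicator (Q n) \<omega>)"
    and D_sets: "\<And>n. D n \<in> sets (F (Suc n))"
    and P_sets: "\<And>n. P n \<in> sets (F (Suc n))"
    and Q_sets: "\<And>n. Q n \<in> sets (F (Suc n))"
    and P_D: "\<And>n. P n \<subseteq> D n"
    and Q_D: "\<And>n. Q n \<inter> D n = {}"
    and draw: "\<And>n Z c. Z \<in> borel_measurable (F n) \<Longrightarrow> (\<And>\<omega>. \<omega> \<in> space M \<Longrightarrow> \<bar>Z \<omega>\<bar> \<le> c) \<Longrightarrow>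
      (\<integral>\<omega>. Z \<omega> * indicator (D n) \<omega> \<partial>M) = (\<integral>\<omega>. Z \<omega> * Y n \<omega> \<partial>M)"
    and draw_up: "\<And>n Z c. Z \<in> borel_measurable (F n) \<Longrightarrow> (\<And>\<omega>. \<omega> \<in> space M \<Longrightarrow> \<bar>Z \<omega>\<bar> \<le> c) \<Longrightarrow>
      (\<integral>\<omega>. Z \<omega> * indicator (P n) \<omega> \<partial>M) = a * (\<integral>\<omega>. Z \<omega> * Y n \<omega> \<partial>M)"
    and draw_down: "\<And>n Z c. Z \<in> borel_measurable (F n) \<Longrightarrow> (\<And>\<omega>. \<omega> \<in> space M \<Longrightarrow> \<bar>Z \<omega>\<bar> \<le> c) \<Longrightarrow>
      (\<integral>\<omega>. Z \<omega> * indicator (Q n) \<omega> \<partial>M) = b * (\<integral>\<omega>. Z \<omega> * (1 - Y n \<omega>) \<partial>M)"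
    and x_range: "0 \<le> x" "x \<le> 1"
    and a_range: "0 \<le> a" "a \<le> 1"
    and b_range: "0 \<le> b" "b \<le> 1"
    and g_range: "\<And>n. 0 < g n" "\<And>n. g n < 1"
    and g_diverges: "\<not> summable g"
begin

definition h :: "real \<Rightarrow> real" where "h y = y * (1 - y)"

definition gen :: "nat \<Rightarrow> (real \<Rightarrow> real) \<Rightarrow> real \<Rightarrow> real" where
  "gen n \<psi> y = \<psi> y + a * y * (\<psi> (y + g n * (1 - y)) - \<psi> y) + b * (1 - y) * (\<psi> (y - g n * y) - \<psi> y)"

lemma space_F [simp]: "space (F n) = space M"
  using F_subalgebra[of n] by (simp add: subalgebra_def)

lemma F_sub: "sets (F n) \<subseteq> sets M"
  using F_subalgebra[of n] by (simp add: subalgebra_def)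

lemma F_mono_le: "m \<le> n \<Longrightarrow> sets (F m) \<subseteq> sets (F n)"
  by (rule lift_Suc_mono_le[of "\<lambda>n. sets (F n)"]) (use F_mono in auto)

lemma measurable_F_M: "f \<in> measurable (F n) N \<Longrightarrow> f \<in> measurable M N"
  by (rule measurable_from_subalg[OF F_subalgebra])

lemma measurable_F_mono: "m \<le> n \<Longrightarrow> f \<in> measurable (F m) N \<Longrightarrow> f \<in> measurable (F n) N"
  using F_mono_le[of m n] by (auto simp: measurable_def)

lemma Y_measurable [measurable]: "Y n \<in> borel_measurable M"
  by (rule measurable_F_M[OF Y_adapted])

lemma events_M [measurable]: "D n \<in> sets M" "P n \<in> sets M" "Q n \<in> sets M"
  using D_sets P_sets Q_sets F_sub by blast+

lemma g_ge_0 [simp]: "0 \<le> g n" and g_le_1 [simp]: "g n \<le> 1"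
  using g_range[of n] by (auto intro: less_imp_le)

lemma Y_range: "0 \<le> Y n \<omega> \<and> Y n \<omega> \<le> 1"
proof (induction n)
  case 0
  show ?case using x_range by (simp add: Y_0)
next
  case (Suc n)
  have "\<not> (\<omega> \<in> P n \<and> \<omega> \<in> Q n)" using P_D[of n] Q_D[of n] by blast
  then show ?case
    unfolding Y_Suc indicator_def using Suc bounded_update by simp
qed

lemma Y_ge_0 [simp]: "0 \<le> Y n \<omega>" and Y_le_1 [simp]: "Y n \<omega> \<le> 1"
  using Y_range by auto

lemma Y_decay: "(1 - g n) * Y n \<omega> \<le> Y (Suc n) \<omega>"
  using P_D[of n] Q_D[of n] mult_nonneg_nonneg[of "g n" "1 - Y n \<omega>"]
    mult_nonneg_nonneg[of "g n" "Y n \<omega>"]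
  by (cases "\<omega> \<in> P n"; cases "\<omega> \<in> Q n") (auto simp: Y_Suc algebra_simps)

lemma up_range:
  assumes "0 \<le> y" "y \<le> (1::real)"
  shows "y \<le> y + g n * (1 - y)" "y + g n * (1 - y) \<le> 1"
    "(1 - g n) * y \<le> y" "y - g n * y = (1 - g n) * y" "0 \<le> (1 - g n) * y"
proof -
  have "g n * (1 - y) \<le> 1 * (1 - y)" "0 \<le> g n * (1 - y)" "0 \<le> g n * y" "0 \<le> (1 - g n) * y"
    using assms by (intro mult_right_mono mult_nonneg_nonneg; simp)+
  then show "y \<le> y + g n * (1 - y)" "y + g n * (1 - y) \<le> 1"
    "(1 - g n) * y \<le> y" "y - g n * y = (1 - g n) * y" "0 \<le> (1 - g n) * y"
    by (auto simp: algebra_simps)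
qed

text \<open>The cut-off \<open>l\<close> admits test functions that blow up at 0, such as
  \<open>inverse\<close>; \<open>l = 0\<close> covers bounded ones. The 5 is 1 + 2 + 2: one for the
  value and two for each of the two increments.\<close>

lemma gen_bounded:
  assumes \<psi>: "\<And>y. l \<le> y \<Longrightarrow> y \<le> 1 \<Longrightarrow> \<bar>\<psi> y\<bar> \<le> c"
    and y: "0 \<le> y" "y \<le> 1" and l: "l \<le> (1 - g n) * y"
  shows "\<bar>gen n \<psi> y\<bar> \<le> 5 * c"
proof -
  note r = up_range[OF y, of n]
  have b: "\<bar>\<psi> y\<bar> \<le> c" "\<bar>\<psi> (y + g n * (1 - y))\<bar> \<le> c" "\<bar>\<psi> (y - g n * y)\<bar> \<le> c"
    by (rule \<psi>; use r l y in linarith)+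
  have d: "\<bar>\<psi> (y + g n * (1 - y)) - \<psi> y\<bar> \<le> 2 * c" "\<bar>\<psi> (y - g n * y) - \<psi> y\<bar> \<le> 2 * c"
    using b by linarith+
  have "a * y \<le> 1" "b * (1 - y) \<le> 1" "0 \<le> a * y" "0 \<le> b * (1 - y)"
    using a_range b_range y by (auto intro!: mult_le_one)
  then have "\<bar>a * y * (\<psi> (y + g n * (1 - y)) - \<psi> y)\<bar> \<le> 2 * c"
    "\<bar>b * (1 - y) * (\<psi> (y - g n * y) - \<psi> y)\<bar> \<le> 2 * c"
    using abs_mult_le_left[OF d(1), of "a * y"] abs_mult_le_left[OF d(2), of "b * (1 - y)"]
    by (simp_all only: mult.commute simp_thms)
  then show ?thesis unfolding gen_def using b(1) by linarith
qed

lemma h_range: "0 \<le> y \<Longrightarrow> y \<le> 1 \<Longrightarrow> 0 \<le> h y \<and> h y \<le> 1"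
  unfolding h_def by (auto intro!: mult_le_one)

lemma borel_measurable_h [measurable]: "h \<in> borel_measurable borel"
  unfolding h_def by measurable

lemma borel_measurable_gen [measurable]:
  assumes [measurable]: "\<psi> \<in> borel_measurable borel"
  shows "gen n \<psi> \<in> borel_measurable borel"
  unfolding gen_def by measurable

lemma integrable_Y:
  fixes \<psi> :: "real \<Rightarrow> real"
  assumes [measurable]: "\<psi> \<in> borel_measurable borel" and "\<And>y. y \<in> {0..1} \<Longrightarrow> \<bar>\<psi> y\<bar> \<le> c"
  shows "integrable M (\<lambda>\<omega>. \<psi> (Y n \<omega>))"
  by (rule integrable_bounded[of _ c]) (use assms in auto)

lemma integrable_h: "integrable M (\<lambda>\<omega>. h (Y n \<omega>))"
  by (rule integrable_Y[of _ 1]) (use h_range in auto)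

section \<open>One-step expectations against past weights\<close>

lemma step_random:
  assumes f: "f0 \<in> borel_measurable (F n)" "f1 \<in> borel_measurable (F n)" "f2 \<in> borel_measurable (F n)"
    and bd: "\<And>\<omega>. \<omega> \<in> space M \<Longrightarrow> \<bar>f0 \<omega>\<bar> \<le> c" "\<And>\<omega>. \<omega> \<in> space M \<Longrightarrow> \<bar>f1 \<omega>\<bar> \<le> c"
      "\<And>\<omega>. \<omega> \<in> space M \<Longrightarrow> \<bar>f2 \<omega>\<bar> \<le> c"
  shows "(\<integral>\<omega>. f0 \<omega> + f1 \<omega> * indicator (P n) \<omega> + f2 \<omega> * indicator (Q n) \<omega> \<partial>M) =
    (\<integral>\<omega>. f0 \<omega> + a * (f1 \<omega> * Y n \<omega>) + b * (f2 \<omega> * (1 - Y n \<omega>)) \<partial>M)"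
proof -
  have [measurable]: "f0 \<in> borel_measurable M" "f1 \<in> borel_measurable M" "f2 \<in> borel_measurable M"
    using f measurable_F_M by auto
  have c0: "0 \<le> c" using bd(1) not_empty by force
  have i: "integrable M f0" "integrable M f1" "integrable M f2"
    by (rule integrable_bounded[of _ c]; use bd in simp)+
  have i1: "integrable M (\<lambda>\<omega>. f1 \<omega> * Y n \<omega>)" "integrable M (\<lambda>\<omega>. f2 \<omega> * (1 - Y n \<omega>))"
    by (rule integrable_bounded[of _ c], measurable, intro abs_mult_le_left bd; simp)+
  have i2: "integrable M (\<lambda>\<omega>. f1 \<omega> * indicator (P n) \<omega>)" "integrable M (\<lambda>\<omega>. f2 \<omega> * indicator (Q n) \<omega>)"
    using i by (auto intro!: integrable_real_mult_indicator)
  show ?thesis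
    using i i1 i2 draw_up[OF f(2) bd(2)] draw_down[OF f(3) bd(3)] by simp
qed

text \<open>Tested form of the Markov property. \<open>Z\<close> stands for arbitrary information
  from the first \<open>n\<close> steps, so indicators in its place restrict the identity to past
  events; \<open>l\<close> keeps the test function bounded on the values reachable in one
  step.\<close>

lemma step:
  assumes Z: "Z \<in> borel_measurable (F n)" "\<And>\<omega>. \<omega> \<in> space M \<Longrightarrow> \<bar>Z \<omega>\<bar> \<le> k"
    and \<psi>: "\<psi> \<in> borel_measurable borel" "\<And>y. l \<le> y \<Longrightarrow> y \<le> 1 \<Longrightarrow> \<bar>\<psi> y\<bar> \<le> c"
    and l: "\<And>\<omega>. \<omega> \<in> space M \<Longrightarrow> l \<le> (1 - g n) * Y n \<omega>"
  shows "(\<integral>\<omega>. Z \<omega> * \<psi> (Y (Suc n) \<omega>) \<partial>M) = (\<integral>\<omega>. Z \<omega> * gen n \<psi> (Y n \<omega>) \<partial>M)"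
proof -
  note [measurable] = Z(1) \<psi>(1) Y_adapted[of n]
  let ?up = "\<lambda>y. y + g n * (1 - y)" and ?dn = "\<lambda>y. y - g n * y"
  have k0: "0 \<le> k" using Z(2) not_empty by force
  have c: "\<bar>\<psi> (Y n \<omega>)\<bar> \<le> c" "\<bar>\<psi> (?up (Y n \<omega>))\<bar> \<le> c" "\<bar>\<psi> (?dn (Y n \<omega>))\<bar> \<le> c" if "\<omega> \<in> space M" for \<omega>
  proof -
    note r = l[OF that] up_range[OF Y_ge_0[of n \<omega>] Y_le_1, of n] Y_le_1[of n \<omega>]
    show "\<bar>\<psi> (Y n \<omega>)\<bar> \<le> c" "\<bar>\<psi> (?up (Y n \<omega>))\<bar> \<le> c" "\<bar>\<psi> (?dn (Y n \<omega>))\<bar> \<le> c"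
      by (rule \<psi>(2); use r in linarith)+
  qed
  then have c0: "0 \<le> c" using not_empty by force
  have kc: "\<bar>Z \<omega> * (\<psi> u - \<psi> v)\<bar> \<le> 2 * (k * c)" "\<bar>Z \<omega> * \<psi> u\<bar> \<le> 2 * (k * c)"
    if "\<omega> \<in> space M" "\<bar>\<psi> u\<bar> \<le> c" "\<bar>\<psi> v\<bar> \<le> c" for \<omega> u v
  proof -
    have "\<bar>Z \<omega> * (\<psi> u - \<psi> v)\<bar> \<le> k * (2 * c)" "\<bar>Z \<omega> * \<psi> u\<bar> \<le> k * c"
      unfolding abs_mult using that Z(2)[of \<omega>] k0 by (intro mult_mono; linarith)+
    then show "\<bar>Z \<omega> * (\<psi> u - \<psi> v)\<bar> \<le> 2 * (k * c)" "\<bar>Z \<omega> * \<psi> u\<bar> \<le> 2 * (k * c)"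
      using mult_nonneg_nonneg[OF k0 c0] by auto
  qed
  have "(\<integral>\<omega>. Z \<omega> * \<psi> (Y (Suc n) \<omega>) \<partial>M) =
     (\<integral>\<omega>. Z \<omega> * \<psi> (Y n \<omega>) + Z \<omega> * (\<psi> (?up (Y n \<omega>)) - \<psi> (Y n \<omega>)) * indicator (P n) \<omega>
        + Z \<omega> * (\<psi> (?dn (Y n \<omega>)) - \<psi> (Y n \<omega>)) * indicator (Q n) \<omega> \<partial>M)"
  proof (rule Bochner_Integration.integral_cong[OF refl])
    fix \<omega>
    show "Z \<omega> * \<psi> (Y (Suc n) \<omega>) = Z \<omega> * \<psi> (Y n \<omega>) + Z \<omega> * (\<psi> (?up (Y n \<omega>)) - \<psi> (Y n \<omega>)) * indicator (P n) \<omega>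
        + Z \<omega> * (\<psi> (?dn (Y n \<omega>)) - \<psi> (Y n \<omega>)) * indicator (Q n) \<omega>"
      using P_D[of n] Q_D[of n]
      by (cases "\<omega> \<in> P n"; cases "\<omega> \<in> Q n") (auto simp: Y_Suc algebra_simps)
  qed
  also have "\<dots> = (\<integral>\<omega>. Z \<omega> * \<psi> (Y n \<omega>) + a * (Z \<omega> * (\<psi> (?up (Y n \<omega>)) - \<psi> (Y n \<omega>)) * Y n \<omega>)
        + b * (Z \<omega> * (\<psi> (?dn (Y n \<omega>)) - \<psi> (Y n \<omega>)) * (1 - Y n \<omega>)) \<partial>M)"
    by (rule step_random[where c = "2 * (k * c)"]) (use kc c in \<open>measurable; blast\<close>)+
  also have "\<dots> = (\<integral>\<omega>. Z \<omega> * gen n \<psi> (Y n \<omega>) \<partial>M)"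
    unfolding gen_def by (simp add: algebra_simps)
  finally show ?thesis .
qed

text \<open>Outside \<open>D n\<close> no upward move is possible: given the past, moving down has
  weight b (1 - Y n) and staying has weight (1 - b) (1 - Y n). The indicator of the complement is
  expanded into 1 minus that of \<open>D n\<close>, so that \<open>draw\<close> and
  \<open>draw_down\<close> apply.\<close>

lemma step_no_draw:
  assumes Z: "Z \<in> borel_measurable (F n)" "\<And>\<omega>. \<omega> \<in> space M \<Longrightarrow> \<bar>Z \<omega>\<bar> \<le> k"
    and \<psi>: "\<psi> \<in> borel_measurable borel" "\<And>y. 0 \<le> y \<Longrightarrow> y \<le> 1 \<Longrightarrow> \<bar>\<psi> y\<bar> \<le> c"
  shows "(\<integral>\<omega>. Z \<omega> * indicator (space M - D n) \<omega> * \<psi> (Y (Suc n) \<omega>) \<partial>M) =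
    (\<integral>\<omega>. Z \<omega> * ((1 - Y n \<omega>) * (b * \<psi> (Y n \<omega> - g n * Y n \<omega>) + (1 - b) * \<psi> (Y n \<omega>))) \<partial>M)"
proof -
  note [measurable] = Z(1) \<psi>(1) Y_adapted[of n]
  let ?dn = "\<lambda>y. y - g n * y"
  have [measurable]: "Z \<in> borel_measurable M" by (rule measurable_F_M[OF Z(1)])
  have k0: "0 \<le> k" using Z(2) not_empty by force
  have c: "\<bar>\<psi> (Y n \<omega>)\<bar> \<le> c" "\<bar>\<psi> (?dn (Y n \<omega>))\<bar> \<le> c" for \<omega>
  proof -
    note r = up_range[OF Y_ge_0[of n \<omega>] Y_le_1, of n] Y_ge_0[of n \<omega>] Y_le_1[of n \<omega>]
    show "\<bar>\<psi> (Y n \<omega>)\<bar> \<le> c" "\<bar>\<psi> (?dn (Y n \<omega>))\<bar> \<le> c"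
      by (rule \<psi>(2); use r in linarith)+
  qed
  have c0: "0 \<le> c" using \<psi>(2)[of 0] by auto
  have kc: "\<bar>Z \<omega> * \<psi> u\<bar> \<le> 2 * (k * c)" "\<bar>Z \<omega> * (\<psi> u - \<psi> v)\<bar> \<le> 2 * (k * c)"
    if "\<omega> \<in> space M" "\<bar>\<psi> u\<bar> \<le> c" "\<bar>\<psi> v\<bar> \<le> c" for \<omega> u v
  proof -
    have "\<bar>Z \<omega> * (\<psi> u - \<psi> v)\<bar> \<le> k * (2 * c)" "\<bar>Z \<omega> * \<psi> u\<bar> \<le> k * c"
      unfolding abs_mult using that Z(2)[of \<omega>] k0 by (intro mult_mono; linarith)+
    then show "\<bar>Z \<omega> * (\<psi> u - \<psi> v)\<bar> \<le> 2 * (k * c)" "\<bar>Z \<omega> * \<psi> u\<bar> \<le> 2 * (k * c)"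
      using mult_nonneg_nonneg[OF k0 c0] by auto
  qed
  have i: "integrable M (\<lambda>\<omega>. Z \<omega> * \<psi> (Y n \<omega>))"
    "integrable M (\<lambda>\<omega>. Z \<omega> * (\<psi> (?dn (Y n \<omega>)) - \<psi> (Y n \<omega>)))"
    by (rule integrable_bounded[of _ "2 * (k * c)"], measurable, erule kc; rule c)+
  have i1: "integrable M (\<lambda>\<omega>. Z \<omega> * \<psi> (Y n \<omega>) * indicator (D n) \<omega>)"
    "integrable M (\<lambda>\<omega>. Z \<omega> * (\<psi> (?dn (Y n \<omega>)) - \<psi> (Y n \<omega>)) * indicator (Q n) \<omega>)"
    using i by (auto intro!: integrable_real_mult_indicator simp del: mult.assoc)
  have i2: "integrable M (\<lambda>\<omega>. Z \<omega> * \<psi> (Y n \<omega>) * Y n \<omega>)"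
    "integrable M (\<lambda>\<omega>. Z \<omega> * (\<psi> (?dn (Y n \<omega>)) - \<psi> (Y n \<omega>)) * (1 - Y n \<omega>))"
    by (rule integrable_bounded[of _ "2 * (k * c)"], measurable, rule abs_mult_le_left, erule kc; (rule c | simp))+
  have "(\<integral>\<omega>. Z \<omega> * indicator (space M - D n) \<omega> * \<psi> (Y (Suc n) \<omega>) \<partial>M) =
     (\<integral>\<omega>. Z \<omega> * \<psi> (Y n \<omega>) - Z \<omega> * \<psi> (Y n \<omega>) * indicator (D n) \<omega>
        + Z \<omega> * (\<psi> (?dn (Y n \<omega>)) - \<psi> (Y n \<omega>)) * indicator (Q n) \<omega> \<partial>M)"
  proof (rule Bochner_Integration.integral_cong[OF refl])
    fix \<omega> assume "\<omega> \<in> space M"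
    then show "Z \<omega> * indicator (space M - D n) \<omega> * \<psi> (Y (Suc n) \<omega>) =
        Z \<omega> * \<psi> (Y n \<omega>) - Z \<omega> * \<psi> (Y n \<omega>) * indicator (D n) \<omega>
        + Z \<omega> * (\<psi> (?dn (Y n \<omega>)) - \<psi> (Y n \<omega>)) * indicator (Q n) \<omega>"
      using P_D[of n] Q_D[of n]
      by (cases "\<omega> \<in> D n"; cases "\<omega> \<in> P n"; cases "\<omega> \<in> Q n") (auto simp: Y_Suc algebra_simps)
  qed
  also have "\<dots> = (\<integral>\<omega>. Z \<omega> * \<psi> (Y n \<omega>) \<partial>M) - (\<integral>\<omega>. Z \<omega> * \<psi> (Y n \<omega>) * Y n \<omega> \<partial>M)
        + b * (\<integral>\<omega>. Z \<omega> * (\<psi> (?dn (Y n \<omega>)) - \<psi> (Y n \<omega>)) * (1 - Y n \<omega>) \<partial>M)"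
  proof -
    have "(\<integral>\<omega>. Z \<omega> * \<psi> (Y n \<omega>) * indicator (D n) \<omega> \<partial>M) = (\<integral>\<omega>. Z \<omega> * \<psi> (Y n \<omega>) * Y n \<omega> \<partial>M)"
      by (rule draw[where c = "2 * (k * c)"]) (use kc c in \<open>measurable; blast\<close>)+
    moreover have "(\<integral>\<omega>. Z \<omega> * (\<psi> (?dn (Y n \<omega>)) - \<psi> (Y n \<omega>)) * indicator (Q n) \<omega> \<partial>M) =
        b * (\<integral>\<omega>. Z \<omega> * (\<psi> (?dn (Y n \<omega>)) - \<psi> (Y n \<omega>)) * (1 - Y n \<omega>) \<partial>M)"
      by (rule draw_down[where c = "2 * (k * c)"]) (use kc c in \<open>measurable; blast\<close>)+
    ultimately show ?thesis using i i1 by (simp del: mult.assoc)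
  qed
  also have "\<dots> = (\<integral>\<omega>. Z \<omega> * \<psi> (Y n \<omega>) - Z \<omega> * \<psi> (Y n \<omega>) * Y n \<omega>
     + b * (Z \<omega> * (\<psi> (?dn (Y n \<omega>)) - \<psi> (Y n \<omega>)) * (1 - Y n \<omega>)) \<partial>M)"
    using i i2 by (simp del: mult.assoc)
  also have "\<dots> = (\<integral>\<omega>. Z \<omega> * ((1 - Y n \<omega>) * (b * \<psi> (Y n \<omega> - g n * Y n \<omega>) + (1 - b) * \<psi> (Y n \<omega>))) \<partial>M)"
    by (simp add: algebra_simps)
  finally show ?thesis .
qed

text \<open>Statements about the limit 1 become statements about the limit 0 of the mirrored chain,
  with \<open>a\<close> and \<open>b\<close> exchanged. The law of the complement of
  \<open>D n\<close>, which now plays the part of \<open>D n\<close>, is \<open>step_no_draw\<close>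
  for a constant test function.\<close>

lemma swap: "bandit_chain M F (\<lambda>n \<omega>. 1 - Y n \<omega>) (\<lambda>n. space M - D n) Q P b a g (1 - x)"
proof -
  have Qs: "Q n \<subseteq> space M - D n" for n
    using sets.sets_into_space[OF events_M(3)] Q_D[of n] by blast
  have PD: "P n \<inter> (space M - D n) = {}" for n
    using P_D[of n] by blast
  have ad: "(\<lambda>\<omega>. 1 - Y n \<omega>) \<in> borel_measurable (F n)" for n
    using Y_adapted[of n] by measurable
  have Ds: "space M - D n \<in> sets (F (Suc n))" for n
    using sets.compl_sets[OF D_sets[of n]] by simp
  have dr: "(\<integral>\<omega>. Z \<omega> * indicator (space M - D n) \<omega> \<partial>M) = (\<integral>\<omega>. Z \<omega> * (1 - Y n \<omega>) \<partial>M)"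
    if Z: "Z \<in> borel_measurable (F n)" "\<And>\<omega>. \<omega> \<in> space M \<Longrightarrow> \<bar>Z \<omega>\<bar> \<le> c" for Z n c
    using step_no_draw[OF Z, of "\<lambda>_. 1" 1] by simp
  show ?thesis
  proof unfold_locales
    fix n Z and c :: real
    assume Z: "Z \<in> borel_measurable (F n)" "\<And>\<omega>. \<omega> \<in> space M \<Longrightarrow> \<bar>Z \<omega>\<bar> \<le> c"
    show "(\<integral>\<omega>. Z \<omega> * indicator (P n) \<omega> \<partial>M) = a * (\<integral>\<omega>. Z \<omega> * (1 - (1 - Y n \<omega>)) \<partial>M)"
      using draw_up[OF Z] by simp
    show "(\<integral>\<omega>. Z \<omega> * indicator (Q n) \<omega> \<partial>M) = b * (\<integral>\<omega>. Z \<omega> * (1 - Y n \<omega>) \<partial>M)"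
      by (rule draw_down[OF Z])
    show "(\<integral>\<omega>. Z \<omega> * indicator (space M - D n) \<omega> \<partial>M) = (\<integral>\<omega>. Z \<omega> * (1 - Y n \<omega>) \<partial>M)"
      by (rule dr[OF Z])
  qed (use F_subalgebra F_mono ad Ds P_sets Q_sets Qs PD x_range a_range b_range g_range g_diverges
      in \<open>auto simp: Y_0 Y_Suc algebra_simps\<close>)
qed

subsection \<open>Almost sure convergence\<close>

text \<open>Conditional mean of the squared increment, a y (g (1 - y))^2 + b (1 - y) (g y)^2, from
  which h y factors out. The square of the mean increment is not subtracted.\<close>

definition variance_rate :: "nat \<Rightarrow> real \<Rightarrow> real" where
  "variance_rate n y = (g n)\<^sup>2 * h y * (a * (1 - y) + b * y)"

definition Yinf :: "'a \<Rightarrow> real" where "Yinf \<omega> = lim (\<lambda>n. Y n \<omega>)"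

lemma Yinf_measurable [measurable]: "Yinf \<in> borel_measurable M"
  unfolding Yinf_def by (rule borel_measurable_lim_metric) simp

lemma gen_id: "gen n (\<lambda>y. y) y = y + (a - b) * g n * h y"
  unfolding gen_def h_def by algebra

lemma gen_square: "gen n (\<lambda>y. y\<^sup>2) y = y\<^sup>2 + 2 * (a - b) * g n * h y * y + variance_rate n y"
  unfolding gen_def h_def variance_rate_def by algebra

lemma borel_measurable_variance_rate [measurable]: "variance_rate n \<in> borel_measurable borel"
  unfolding variance_rate_def by measurable

lemma ab_mix_range:
  assumes "0 \<le> y" "y \<le> 1"
  shows "0 \<le> a * (1 - y) + b * y" "a * (1 - y) + b * y \<le> 1"
proof -
  have "a * (1 - y) \<le> 1 * (1 - y)" "b * y \<le> 1 * y" "0 \<le> a * (1 - y)" "0 \<le> b * y"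
    using assms a_range b_range by (intro mult_right_mono mult_nonneg_nonneg; simp)+
  then show "0 \<le> a * (1 - y) + b * y" "a * (1 - y) + b * y \<le> 1" by auto
qed

lemma variance_rate_range:
  assumes "0 \<le> y" "y \<le> 1"
  shows "0 \<le> variance_rate n y" "variance_rate n y \<le> 1"
  unfolding variance_rate_def using ab_mix_range[OF assms] h_range[OF assms]
  by (auto intro!: mult_nonneg_nonneg mult_le_one power_le_one)

lemma integrable_variance_rate: "integrable M (\<lambda>\<omega>. variance_rate n (Y n \<omega>))"
  by (rule integrable_Y[of _ 1]) (use variance_rate_range in \<open>auto simp: abs_le_iff\<close>)

lemma abs_drift:
  assumes "0 \<le> y" "y \<le> 1"
  shows "\<bar>2 * (a - b) * g n * h y\<bar> = 2 * (\<bar>a - b\<bar> * (g n * h y))"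
proof -
  have "\<bar>g n\<bar> = g n" "\<bar>h y\<bar> = h y" using h_range[OF assms] by simp_all
  then show ?thesis by (simp only: abs_mult mult.assoc abs_numeral)
qed

lemma mean_step:
  "(\<integral>\<omega>. Y (Suc n) \<omega> \<partial>M) = (\<integral>\<omega>. Y n \<omega> \<partial>M) + (a - b) * (g n * (\<integral>\<omega>. h (Y n \<omega>) \<partial>M))"
proof -
  have "(\<integral>\<omega>. 1 * Y (Suc n) \<omega> \<partial>M) = (\<integral>\<omega>. 1 * gen n (\<lambda>y. y) (Y n \<omega>) \<partial>M)"
    by (rule step[where l = 0 and k = 1 and c = 1]) auto
  then show ?thesis
    unfolding gen_id using integrable_h integrable_Y[of "\<lambda>y. y" 1] by simp
qed

lemma mean_sum:
  "(\<integral>\<omega>. Y n \<omega> \<partial>M) = x + (a - b) * (\<Sum>k<n. g k * (\<integral>\<omega>. h (Y k \<omega>) \<partial>M))"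
  by (induction n) (simp_all add: Y_0 prob_space mean_step algebra_simps)

lemma mean_range: "0 \<le> (\<integral>\<omega>. Y n \<omega> \<partial>M)" "(\<integral>\<omega>. Y n \<omega> \<partial>M) \<le> 1"
proof -
  show "0 \<le> (\<integral>\<omega>. Y n \<omega> \<partial>M)" by simp
  have "(\<integral>\<omega>. Y n \<omega> \<partial>M) \<le> (\<integral>\<omega>. 1 \<partial>M)"
    by (rule integral_mono) (use integrable_Y[of "\<lambda>y. y" 1] in auto)
  then show "(\<integral>\<omega>. Y n \<omega> \<partial>M) \<le> 1" by (simp add: prob_space)
qed

text \<open>The square is expanded around \<open>Y m\<close>, and \<open>step\<close> is applied
  twice: to y^2 with weight \<open>Z\<close>, and to y with weight \<open>Z * Y m\<close>, which is
  still known at time n.\<close>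

lemma square_step:
  assumes Z: "Z \<in> borel_measurable (F n)" "\<And>\<omega>. \<omega> \<in> space M \<Longrightarrow> 0 \<le> Z \<omega> \<and> Z \<omega> \<le> 1"
    and mn: "m \<le> n"
  shows "(\<integral>\<omega>. Z \<omega> * (Y (Suc n) \<omega> - Y m \<omega>)\<^sup>2 \<partial>M) =
    (\<integral>\<omega>. Z \<omega> * ((Y n \<omega> - Y m \<omega>)\<^sup>2 + 2 * (a - b) * g n * h (Y n \<omega>) * (Y n \<omega> - Y m \<omega>)
        + variance_rate n (Y n \<omega>)) \<partial>M)"
proof -
  note [measurable] = Z(1) Y_adapted[of n] measurable_F_mono[OF mn Y_adapted]
  have ZM [measurable]: "Z \<in> borel_measurable M" by (rule measurable_F_M[OF Z(1)])
  have bd: "\<bar>Z \<omega> * u\<bar> \<le> c" if "\<omega> \<in> space M" "\<bar>u\<bar> \<le> c" for \<omega> u and c :: real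
    using abs_mult_le_left[of u c "Z \<omega>"] Z(2)[OF that(1)] that by (simp add: mult.commute)
  have bY: "\<bar>Z \<omega> * Y m \<omega> * u\<bar> \<le> c" if "\<omega> \<in> space M" "\<bar>u\<bar> \<le> c" for \<omega> u and c :: real
    using bd[OF that(1), of "u * Y m \<omega>" c] abs_mult_le_left[of u c "Y m \<omega>"] that
    by (simp add: mult_ac)
  have sq: "\<bar>Y n \<omega>\<bar> \<le> 1" "\<bar>(Y n \<omega>)\<^sup>2\<bar> \<le> 1" for n \<omega>
    by (auto simp: abs_le_iff intro: power_le_one)
  have hb: "0 \<le> h (Y n \<omega>) \<and> h (Y n \<omega>) \<le> 1" for \<omega> using h_range by simp
  have gb: "\<bar>2 * (a - b) * g n * h (Y n \<omega>)\<bar> \<le> 2" for \<omega>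
  proof -
    have "0 \<le> g n * h (Y n \<omega>)" "g n * h (Y n \<omega>) \<le> 1" using hb[of \<omega>] by (auto intro!: mult_le_one)
    moreover have "\<bar>a - b\<bar> \<le> 1" using a_range b_range by linarith
    ultimately have "\<bar>a - b\<bar> * (g n * h (Y n \<omega>)) \<le> 1" by (intro mult_le_one[of "\<bar>a - b\<bar>"])
    then show ?thesis using abs_drift[of "Y n \<omega>" n] by simp
  qed
  have vb: "\<bar>variance_rate n (Y n \<omega>)\<bar> \<le> 1" for \<omega>
    using variance_rate_range[of "Y n \<omega>" n] by simp
  have e1: "(\<integral>\<omega>. Z \<omega> * (Y (Suc n) \<omega>)\<^sup>2 \<partial>M) = (\<integral>\<omega>. Z \<omega> * gen n (\<lambda>y. y\<^sup>2) (Y n \<omega>) \<partial>M)"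
    using Z by (intro step[where l = 0 and k = 1 and c = 1]) (auto simp: abs_le_iff intro: power_le_one)
  have e2: "(\<integral>\<omega>. (Z \<omega> * Y m \<omega>) * Y (Suc n) \<omega> \<partial>M) = (\<integral>\<omega>. (Z \<omega> * Y m \<omega>) * gen n (\<lambda>y. y) (Y n \<omega>) \<partial>M)"
    by (intro step[where l = 0 and k = 1 and c = 1]) (use bd sq in auto)
  have i: "integrable M (\<lambda>\<omega>. Z \<omega> * (Y k \<omega>)\<^sup>2)" for k
    by (rule integrable_bounded[of _ 1]) (use bd sq in auto)
  have i2: "integrable M (\<lambda>\<omega>. Z \<omega> * Y m \<omega> * Y k \<omega>)" for k
    by (rule integrable_bounded[of _ 1]) (use bY sq in auto)
  have i3: "integrable M (\<lambda>\<omega>. Z \<omega> * Y m \<omega> * (2 * (a - b) * g n * h (Y n \<omega>)))"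
    by (rule integrable_bounded[of _ 2]) (use bY[OF _ gb] in auto)
  have i4: "integrable M (\<lambda>\<omega>. Z \<omega> * gen n (\<lambda>y. y\<^sup>2) (Y n \<omega>))"
    "integrable M (\<lambda>\<omega>. Z \<omega> * Y m \<omega> * gen n (\<lambda>y. y) (Y n \<omega>))"
  proof -
    have "\<bar>gen n (\<lambda>y. y\<^sup>2) (Y n \<omega>)\<bar> \<le> 4" for \<omega>
      unfolding gen_square using abs_mult_le_left[OF gb[of \<omega>], of "Y n \<omega>"] vb[of \<omega>] sq(2)[of n \<omega>]
        Y_ge_0[of n \<omega>] Y_le_1[of n \<omega>] by linarith
    then show "integrable M (\<lambda>\<omega>. Z \<omega> * gen n (\<lambda>y. y\<^sup>2) (Y n \<omega>))"
      by (intro integrable_bounded[of _ 4]) (use bd in auto)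
    have "\<bar>gen n (\<lambda>y. y) (Y n \<omega>)\<bar> \<le> 4" for \<omega>
      unfolding gen_id using gb[of \<omega>] sq(1)[of n \<omega>] by linarith
    then show "integrable M (\<lambda>\<omega>. Z \<omega> * Y m \<omega> * gen n (\<lambda>y. y) (Y n \<omega>))"
      by (intro integrable_bounded[of _ 4]) (use bY in auto)
  qed
  have "(\<integral>\<omega>. Z \<omega> * (Y (Suc n) \<omega> - Y m \<omega>)\<^sup>2 \<partial>M) =
    (\<integral>\<omega>. Z \<omega> * (Y (Suc n) \<omega>)\<^sup>2 - 2 * (Z \<omega> * Y m \<omega> * Y (Suc n) \<omega>) + Z \<omega> * (Y m \<omega>)\<^sup>2 \<partial>M)"
    by (rule Bochner_Integration.integral_cong[OF refl]) (simp add: power2_eq_square algebra_simps)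
  also have "\<dots> = (\<integral>\<omega>. Z \<omega> * gen n (\<lambda>y. y\<^sup>2) (Y n \<omega>) \<partial>M)
      - 2 * (\<integral>\<omega>. Z \<omega> * Y m \<omega> * gen n (\<lambda>y. y) (Y n \<omega>) \<partial>M) + (\<integral>\<omega>. Z \<omega> * (Y m \<omega>)\<^sup>2 \<partial>M)"
    using i i2 e1 e2 by simp
  also have "\<dots> = (\<integral>\<omega>. Z \<omega> * gen n (\<lambda>y. y\<^sup>2) (Y n \<omega>)
      - 2 * (Z \<omega> * Y m \<omega> * gen n (\<lambda>y. y) (Y n \<omega>)) + Z \<omega> * (Y m \<omega>)\<^sup>2 \<partial>M)"
    using i i4 by simp
  also have "\<dots> = (\<integral>\<omega>. Z \<omega> * ((Y n \<omega> - Y m \<omega>)\<^sup>2 + 2 * (a - b) * g n * h (Y n \<omega>) * (Y n \<omega> - Y m \<omega>)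
        + variance_rate n (Y n \<omega>)) \<partial>M)"
    unfolding gen_square gen_id
    by (rule Bochner_Integration.integral_cong[OF refl]) (simp add: power2_eq_square algebra_simps)
  finally show ?thesis .
qed

text \<open>A bound on what one step can add to the mean of Z (Y n - Y m)^2, uniform in m \<le> n
  and in past weights Z with values in [0, 1]: twice the absolute drift, as |Y n - Y m| \<le> 1,
  plus the squared increment.\<close>

definition cost :: "nat \<Rightarrow> real" where
  "cost n = 2 * (\<bar>a - b\<bar> * (g n * (\<integral>\<omega>. h (Y n \<omega>) \<partial>M))) + (\<integral>\<omega>. variance_rate n (Y n \<omega>) \<partial>M)"

lemma integral_h_nonneg: "0 \<le> (\<integral>\<omega>. h (Y n \<omega>) \<partial>M)"
  by (rule integral_nonneg_AE) (use h_range in auto)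

lemma integral_variance_nonneg: "0 \<le> (\<integral>\<omega>. variance_rate n (Y n \<omega>) \<partial>M)"
  by (rule integral_nonneg_AE) (use variance_rate_range in auto)

text \<open>The drift has the constant sign of a - b, so the partial sums of its absolute values
  telescope to the distance between the mean of Y n and \<open>x\<close>, both in [0, 1].\<close>

lemma drift_summable: "summable (\<lambda>n. \<bar>a - b\<bar> * (g n * (\<integral>\<omega>. h (Y n \<omega>) \<partial>M)))"
proof (rule summableI_nonneg_bounded)
  show "0 \<le> \<bar>a - b\<bar> * (g n * (\<integral>\<omega>. h (Y n \<omega>) \<partial>M))" for n
    using integral_h_nonneg by simp
  fix n
  have s: "0 \<le> (\<Sum>k<n. g k * (\<integral>\<omega>. h (Y k \<omega>) \<partial>M))"
    using integral_h_nonneg by (intro sum_nonneg) simp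
  have "(\<Sum>k<n. \<bar>a - b\<bar> * (g k * (\<integral>\<omega>. h (Y k \<omega>) \<partial>M))) = \<bar>(\<integral>\<omega>. Y n \<omega> \<partial>M) - x\<bar>"
  proof -
    have "(\<Sum>k<n. \<bar>a - b\<bar> * (g k * (\<integral>\<omega>. h (Y k \<omega>) \<partial>M))) =
        \<bar>a - b\<bar> * (\<Sum>k<n. g k * (\<integral>\<omega>. h (Y k \<omega>) \<partial>M))"
      by (simp add: sum_distrib_left)
    also have "\<dots> = \<bar>(a - b) * (\<Sum>k<n. g k * (\<integral>\<omega>. h (Y k \<omega>) \<partial>M))\<bar>"
      using s by (simp only: abs_mult abs_of_nonneg[OF s])
    finally show ?thesis by (simp only: mean_sum add_diff_cancel_left')
  qed
  also have "\<dots> \<le> 1" unfolding abs_le_iff using mean_range[of n] x_range by linarith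
  finally show "(\<Sum>k<n. \<bar>a - b\<bar> * (g k * (\<integral>\<omega>. h (Y k \<omega>) \<partial>M))) \<le> 1" .
qed

text \<open>Prepares a telescoping sum: second moments stay in [0, 1], and the squared increment
  differs from their increase only by a drift term, whose factor h y * y is at most h y.\<close>

lemma variance_step:
  "(\<integral>\<omega>. variance_rate n (Y n \<omega>) \<partial>M) \<le>
    (\<integral>\<omega>. (Y (Suc n) \<omega>)\<^sup>2 \<partial>M) - (\<integral>\<omega>. (Y n \<omega>)\<^sup>2 \<partial>M) + 2 * (\<bar>a - b\<bar> * (g n * (\<integral>\<omega>. h (Y n \<omega>) \<partial>M)))"
proof -
  have hY: "0 \<le> h (Y n \<omega>) * Y n \<omega> \<and> h (Y n \<omega>) * Y n \<omega> \<le> h (Y n \<omega>)" for \<omega>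
    using h_range[of "Y n \<omega>"] by (auto intro: mult_left_le)
  have ihY: "integrable M (\<lambda>\<omega>. h (Y n \<omega>) * Y n \<omega>)"
  proof (rule integrable_bounded[of _ 1])
    show "\<bar>h (Y n \<omega>) * Y n \<omega>\<bar> \<le> 1" for \<omega>
      using hY[of \<omega>] h_range[of "Y n \<omega>"] by simp
  qed simp
  have isq: "integrable M (\<lambda>\<omega>. (Y n \<omega>)\<^sup>2)"
    using integrable_Y[of "\<lambda>y. y\<^sup>2" 1 n] by (auto simp: power_le_one)
  have "(\<integral>\<omega>. 1 * (Y (Suc n) \<omega>)\<^sup>2 \<partial>M) = (\<integral>\<omega>. 1 * gen n (\<lambda>y. y\<^sup>2) (Y n \<omega>) \<partial>M)"
    by (intro step[where l = 0 and k = 1 and c = 1]) (auto simp: power_le_one)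
  also have "\<dots> = (\<integral>\<omega>. (Y n \<omega>)\<^sup>2 + 2 * (a - b) * g n * (h (Y n \<omega>) * Y n \<omega>) + variance_rate n (Y n \<omega>) \<partial>M)"
    by (simp add: gen_square mult_ac)
  also have "\<dots> = (\<integral>\<omega>. (Y n \<omega>)\<^sup>2 \<partial>M) + 2 * (a - b) * g n * (\<integral>\<omega>. h (Y n \<omega>) * Y n \<omega> \<partial>M)
      + (\<integral>\<omega>. variance_rate n (Y n \<omega>) \<partial>M)"
    using ihY isq integrable_variance_rate by simp
  finally have e: "(\<integral>\<omega>. variance_rate n (Y n \<omega>) \<partial>M) = (\<integral>\<omega>. (Y (Suc n) \<omega>)\<^sup>2 \<partial>M) - (\<integral>\<omega>. (Y n \<omega>)\<^sup>2 \<partial>M)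
      - 2 * (a - b) * g n * (\<integral>\<omega>. h (Y n \<omega>) * Y n \<omega> \<partial>M)" by simp
  have l: "0 \<le> (\<integral>\<omega>. h (Y n \<omega>) * Y n \<omega> \<partial>M)" "(\<integral>\<omega>. h (Y n \<omega>) * Y n \<omega> \<partial>M) \<le> (\<integral>\<omega>. h (Y n \<omega>) \<partial>M)"
    using hY by (auto intro!: integral_nonneg_AE integral_mono ihY integrable_h)
  have "- (2 * (a - b) * g n * (\<integral>\<omega>. h (Y n \<omega>) * Y n \<omega> \<partial>M)) \<le>
      2 * (\<bar>a - b\<bar> * (g n * (\<integral>\<omega>. h (Y n \<omega>) * Y n \<omega> \<partial>M)))"
  proof -
    have "- (a - b) * (g n * (\<integral>\<omega>. h (Y n \<omega>) * Y n \<omega> \<partial>M)) \<le> \<bar>a - b\<bar> * (g n * (\<integral>\<omega>. h (Y n \<omega>) * Y n \<omega> \<partial>M))"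
      using l(1) by (intro mult_right_mono) auto
    then show ?thesis by (simp add: algebra_simps)
  qed
  also have "\<dots> \<le> 2 * (\<bar>a - b\<bar> * (g n * (\<integral>\<omega>. h (Y n \<omega>) \<partial>M)))"
    using l(2) by (intro mult_left_mono) auto
  finally show ?thesis using e by linarith
qed

lemma variance_summable: "summable (\<lambda>n. \<integral>\<omega>. variance_rate n (Y n \<omega>) \<partial>M)"
proof (rule summableI_nonneg_bounded)
  let ?d = "\<lambda>n. \<bar>a - b\<bar> * (g n * (\<integral>\<omega>. h (Y n \<omega>) \<partial>M))"
  fix n
  have "(\<Sum>k<n. \<integral>\<omega>. variance_rate k (Y k \<omega>) \<partial>M) \<le>
      (\<Sum>k<n. (\<integral>\<omega>. (Y (Suc k) \<omega>)\<^sup>2 \<partial>M) - (\<integral>\<omega>. (Y k \<omega>)\<^sup>2 \<partial>M) + 2 * ?d k)"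
    by (intro sum_mono variance_step)
  also have "\<dots> = (\<Sum>k<n. (\<integral>\<omega>. (Y (Suc k) \<omega>)\<^sup>2 \<partial>M) - (\<integral>\<omega>. (Y k \<omega>)\<^sup>2 \<partial>M)) + 2 * (\<Sum>k<n. ?d k)"
    by (simp add: sum.distrib sum_distrib_left)
  also have "\<dots> = (\<integral>\<omega>. (Y n \<omega>)\<^sup>2 \<partial>M) - (\<integral>\<omega>. (Y 0 \<omega>)\<^sup>2 \<partial>M) + 2 * (\<Sum>k<n. ?d k)"
    using sum_lessThan_telescope[of "\<lambda>k. \<integral>\<omega>. (Y k \<omega>)\<^sup>2 \<partial>M" n] by simp
  also have "\<dots> \<le> 1 - 0 + 2 * suminf ?d"
  proof -
    have "(\<integral>\<omega>. (Y n \<omega>)\<^sup>2 \<partial>M) \<le> (\<integral>\<omega>. 1 \<partial>M)"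
      using integrable_Y[of "\<lambda>y. y\<^sup>2" 1 n] by (intro integral_mono) (auto simp: power_le_one)
    then have "(\<integral>\<omega>. (Y n \<omega>)\<^sup>2 \<partial>M) \<le> 1" by (simp add: prob_space)
    moreover have "0 \<le> (\<integral>\<omega>. (Y 0 \<omega>)\<^sup>2 \<partial>M)" by simp
    moreover have "(\<Sum>k<n. ?d k) \<le> suminf ?d"
      by (rule sum_le_suminf[OF drift_summable]) (use integral_h_nonneg in auto)
    ultimately show ?thesis by linarith
  qed
  finally show "(\<Sum>k<n. \<integral>\<omega>. variance_rate k (Y k \<omega>) \<partial>M) \<le> 1 - 0 + 2 * suminf ?d" .
qed (rule integral_variance_nonneg)

lemma cost_summable: "summable cost"
  unfolding cost_def by (intro summable_add summable_mult drift_summable variance_summable)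

lemma cost_nonneg: "0 \<le> cost n"
  unfolding cost_def using integral_h_nonneg integral_variance_nonneg by simp

lemma square_step_le:
  assumes Z: "Z \<in> borel_measurable (F n)" "\<And>\<omega>. \<omega> \<in> space M \<Longrightarrow> 0 \<le> Z \<omega> \<and> Z \<omega> \<le> 1"
    and mn: "m \<le> n"
  shows "(\<integral>\<omega>. Z \<omega> * (Y (Suc n) \<omega> - Y m \<omega>)\<^sup>2 \<partial>M) \<le> (\<integral>\<omega>. Z \<omega> * (Y n \<omega> - Y m \<omega>)\<^sup>2 \<partial>M) + cost n"
proof -
  have ZM [measurable]: "Z \<in> borel_measurable M" by (rule measurable_F_M[OF Z(1)])
  have d: "\<bar>Y n \<omega> - Y m \<omega>\<bar> \<le> 1" for \<omega>
    using Y_range[of n \<omega>] Y_range[of m \<omega>] by linarith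
  have i: "integrable M (\<lambda>\<omega>. Z \<omega> * (Y n \<omega> - Y m \<omega>)\<^sup>2)"
    using Z(2) d by (intro integrable_bounded[of _ 1]) (auto simp: abs_mult abs_square_le_1 intro!: mult_le_one)
  let ?u = "\<lambda>\<omega>. 2 * (a - b) * g n * h (Y n \<omega>) * (Y n \<omega> - Y m \<omega>) + variance_rate n (Y n \<omega>)"
  let ?v = "\<lambda>\<omega>. 2 * (\<bar>a - b\<bar> * (g n * h (Y n \<omega>))) + variance_rate n (Y n \<omega>)"
  have iv: "integrable M ?v"
    using integrable_h integrable_variance_rate by auto
  have uv: "\<bar>?u \<omega>\<bar> \<le> ?v \<omega>" for \<omega>
  proof -
    have "\<bar>2 * (a - b) * g n * h (Y n \<omega>) * (Y n \<omega> - Y m \<omega>)\<bar> \<le> \<bar>2 * (a - b) * g n * h (Y n \<omega>)\<bar> * 1"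
      unfolding abs_mult[of _ "Y n \<omega> - Y m \<omega>"] by (rule mult_left_mono[OF d]) simp
    also have "\<dots> = 2 * (\<bar>a - b\<bar> * (g n * h (Y n \<omega>)))"
      using abs_drift[of "Y n \<omega>" n] by simp
    finally show ?thesis using variance_rate_range(1)[of "Y n \<omega>" n] by simp
  qed
  have zu: "\<bar>Z \<omega> * ?u \<omega>\<bar> \<le> ?v \<omega>" if "\<omega> \<in> space M" for \<omega>
    using abs_mult_le_left[OF uv[of \<omega>], of "Z \<omega>"] Z(2)[OF that] by (simp add: mult.commute)
  have iu: "integrable M (\<lambda>\<omega>. Z \<omega> * ?u \<omega>)"
    by (rule Bochner_Integration.integrable_bound[OF iv]) (use zu in \<open>auto intro!: AE_I2 order_trans[OF _ abs_ge_self]\<close>)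
  have "(\<integral>\<omega>. Z \<omega> * (Y (Suc n) \<omega> - Y m \<omega>)\<^sup>2 \<partial>M) = (\<integral>\<omega>. Z \<omega> * (Y n \<omega> - Y m \<omega>)\<^sup>2 + Z \<omega> * ?u \<omega> \<partial>M)"
    by (subst square_step[OF Z mn], assumption, rule Bochner_Integration.integral_cong[OF refl])
      (simp add: algebra_simps)
  also have "\<dots> = (\<integral>\<omega>. Z \<omega> * (Y n \<omega> - Y m \<omega>)\<^sup>2 \<partial>M) + (\<integral>\<omega>. Z \<omega> * ?u \<omega> \<partial>M)"
    using i iu by simp
  finally have e: "(\<integral>\<omega>. Z \<omega> * (Y (Suc n) \<omega> - Y m \<omega>)\<^sup>2 \<partial>M) =
    (\<integral>\<omega>. Z \<omega> * (Y n \<omega> - Y m \<omega>)\<^sup>2 \<partial>M) + (\<integral>\<omega>. Z \<omega> * ?u \<omega> \<partial>M)" .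
  have "(\<integral>\<omega>. Z \<omega> * ?u \<omega> \<partial>M) \<le> (\<integral>\<omega>. ?v \<omega> \<partial>M)"
    by (rule integral_mono[OF iu iv]) (use zu in \<open>auto simp: abs_le_iff\<close>)
  also have "\<dots> = cost n"
    unfolding cost_def using integrable_h integrable_variance_rate by simp
  finally show ?thesis using e by linarith
qed

section \<open>A maximal inequality and convergence of the paths\<close>

definition near :: "real \<Rightarrow> nat \<Rightarrow> nat \<Rightarrow> 'a set" where
  "near e m k = {\<omega> \<in> space M. \<forall>j\<in>{m..k}. \<bar>Y j \<omega> - Y m \<omega>\<bar> < e}"

lemma near_sets_F: "m \<le> k \<Longrightarrow> near e m k \<in> sets (F k)"
proof -
  have "{\<omega> \<in> space (F k). \<bar>Y j \<omega> - Y m \<omega>\<bar> < e} \<in> sets (F k)" if "j \<in> {m..k}" for j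
  proof -
    have [measurable]: "Y j \<in> borel_measurable (F k)" "Y m \<in> borel_measurable (F k)"
      using that by (auto intro: measurable_F_mono[OF _ Y_adapted])
    show ?thesis by measurable
  qed
  then have "{\<omega> \<in> space (F k). \<forall>j\<in>{m..k}. \<bar>Y j \<omega> - Y m \<omega>\<bar> < e} \<in> sets (F k)"
    by (intro sets.sets_Collect_finite_All) auto
  then show ?thesis by (simp add: near_def)
qed

lemma near_sets [measurable]: "near e m k \<in> sets M"
  unfolding near_def by measurable

lemma near_antimono: "near e m (Suc k) \<subseteq> near e m k"
  unfolding near_def by auto

text \<open>Kolmogorov's inequality in additive form. Mass that leaves the band at some step is
  moved from the second-moment term to the first term at the price e^2 per unit, and only the
  surviving mass evolves further. As \<open>near e m k\<close> is a past event, it can serve as the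
  weight \<open>Z\<close> in place of a stopped process.\<close>

lemma maximal_inequality_aux:
  assumes "m \<le> k" "e > 0"
  shows "e\<^sup>2 * (1 - prob (near e m k)) + (\<integral>\<omega>. indicator (near e m k) \<omega> * (Y k \<omega> - Y m \<omega>)\<^sup>2 \<partial>M)
    \<le> (\<Sum>j=m..<k. cost j)"
  using assms(1)
proof (induction k rule: dec_induct)
  case base
  have "near e m m = space M" using assms(2) by (auto simp: near_def)
  then show ?case by (simp add: prob_space)
next
  case (step k)
  have i: "integrable M (\<lambda>\<omega>. indicator S \<omega> * (Y j \<omega> - Y m \<omega>)\<^sup>2)" if [measurable]: "S \<in> sets M" for S j
  proof -
    have "\<bar>Y j \<omega> - Y m \<omega>\<bar> \<le> 1" for \<omega> using Y_range[of j \<omega>] Y_range[of m \<omega>] by linarith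
    then show ?thesis
      by (intro integrable_bounded[of _ 1]) (auto simp: indicator_def abs_square_le_1)
  qed
  have ii: "integrable M (\<lambda>\<omega>. e\<^sup>2 * (indicator (near e m k) \<omega> - indicator (near e m (Suc k)) \<omega>) :: real)"
    by (rule integrable_bounded[of _ "e\<^sup>2"]) (auto simp: indicator_def)
  have "e\<^sup>2 * (prob (near e m k) - prob (near e m (Suc k)))
      + (\<integral>\<omega>. indicator (near e m (Suc k)) \<omega> * (Y (Suc k) \<omega> - Y m \<omega>)\<^sup>2 \<partial>M)
    = (\<integral>\<omega>. e\<^sup>2 * (indicator (near e m k) \<omega> - indicator (near e m (Suc k)) \<omega>)
        + indicator (near e m (Suc k)) \<omega> * (Y (Suc k) \<omega> - Y m \<omega>)\<^sup>2 \<partial>M)"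
  proof -
    have "integrable M (\<lambda>\<omega>. indicator (near e m j) \<omega> :: real)" for j
      by (rule integrable_bounded[of _ 1]) (auto simp: indicator_def)
    then show ?thesis
      by (subst Bochner_Integration.integral_add[OF ii i[OF near_sets]]) simp
  qed
  \<comment> \<open>On the paths leaving the band at time \<open>Suc k\<close> the displacement is
    at least \<open>e\<close>, so its square pays for the first summand.\<close>
  also have "\<dots> \<le> (\<integral>\<omega>. indicator (near e m k) \<omega> * (Y (Suc k) \<omega> - Y m \<omega>)\<^sup>2 \<partial>M)"
  proof (rule integral_mono)
    fix \<omega> assume w: "\<omega> \<in> space M"
    have "e\<^sup>2 \<le> (Y (Suc k) \<omega> - Y m \<omega>)\<^sup>2" if "\<omega> \<in> near e m k" "\<omega> \<notin> near e m (Suc k)"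
    proof -
      have "e \<le> \<bar>Y (Suc k) \<omega> - Y m \<omega>\<bar>"
        using that by (force simp: near_def not_less le_Suc_eq)
      then show ?thesis using assms(2) power_mono[of e "\<bar>Y (Suc k) \<omega> - Y m \<omega>\<bar>" 2] by simp
    qed
    then show "e\<^sup>2 * (indicator (near e m k) \<omega> - indicator (near e m (Suc k)) \<omega>)
        + indicator (near e m (Suc k)) \<omega> * (Y (Suc k) \<omega> - Y m \<omega>)\<^sup>2
      \<le> indicator (near e m k) \<omega> * (Y (Suc k) \<omega> - Y m \<omega>)\<^sup>2"
      using near_antimono[of e m k] by (auto simp: indicator_def)
  qed (rule Bochner_Integration.integrable_add[OF ii i[OF near_sets]], rule i[OF near_sets])
  also have "\<dots> \<le> (\<integral>\<omega>. indicator (near e m k) \<omega> * (Y k \<omega> - Y m \<omega>)\<^sup>2 \<partial>M) + cost k"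
    using near_sets_F[OF step(1)] by (intro square_step_le step(1)) (auto simp: indicator_def)
  finally show ?case using step by (simp add: algebra_simps)
qed

lemma maximal_inequality:
  assumes "e > 0"
  shows "1 - (suminf cost - (\<Sum>j<m. cost j)) / e\<^sup>2 \<le> prob {\<omega> \<in> space M. \<forall>j\<ge>m. \<bar>Y j \<omega> - Y m \<omega>\<bar> < e}"
proof -
  have "(\<Inter>k. near e m (m + k)) = {\<omega> \<in> space M. \<forall>j\<ge>m. \<bar>Y j \<omega> - Y m \<omega>\<bar> < e}"
  proof (intro subset_antisym subsetI)
    fix \<omega> assume w: "\<omega> \<in> (\<Inter>k. near e m (m + k))"
    have "\<bar>Y j \<omega> - Y m \<omega>\<bar> < e" if "j \<ge> m" for j
      using w[THEN InterD, OF rangeI[of _ "j - m"]] that by (simp add: near_def)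
    then show "\<omega> \<in> {\<omega> \<in> space M. \<forall>j\<ge>m. \<bar>Y j \<omega> - Y m \<omega>\<bar> < e}"
      using w by (auto simp: near_def)
  qed (auto simp: near_def)
  moreover have "(\<lambda>k. prob (near e m (m + k))) \<longlonglongrightarrow> prob (\<Inter>k. near e m (m + k))"
    using near_antimono by (intro finite_Lim_measure_decseq decseq_SucI) auto
  moreover have "1 - (suminf cost - (\<Sum>j<m. cost j)) / e\<^sup>2 \<le> prob (near e m (m + k))" for k
  proof -
    have "0 \<le> (\<integral>\<omega>. indicator (near e m (m+k)) \<omega> * (Y (m+k) \<omega> - Y m \<omega>)\<^sup>2 \<partial>M)"
      by (rule integral_nonneg_AE) auto
    then have "e\<^sup>2 * (1 - prob (near e m (m + k))) \<le> (\<Sum>j=m..<m+k. cost j)"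
      using maximal_inequality_aux[of m "m + k" e] assms by linarith
    also have "\<dots> = (\<Sum>j<m+k. cost j) - (\<Sum>j<m. cost j)"
      by (simp add: sum_diff_nat_ivl lessThan_atLeast0)
    also have "(\<Sum>j<m+k. cost j) \<le> suminf cost"
      by (rule sum_le_suminf[OF cost_summable]) (auto simp: cost_nonneg)
    finally have "e\<^sup>2 * (1 - prob (near e m (m + k))) \<le> suminf cost - (\<Sum>j<m. cost j)" by simp
    then have "1 - prob (near e m (m + k)) \<le> (suminf cost - (\<Sum>j<m. cost j)) / e\<^sup>2"
      using assms by (simp add: pos_le_divide_eq mult.commute)
    then show ?thesis by simp
  qed
  ultimately show ?thesis by (metis (no_types, lifting) LIMSEQ_le_const)
qed

lemma AE_eventually_near:
  assumes "e > 0"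
  shows "AE \<omega> in M. \<exists>m. \<forall>j\<ge>m. \<bar>Y j \<omega> - Y m \<omega>\<bar> < e"
proof -
  let ?S = "\<lambda>m. {\<omega> \<in> space M. \<forall>j\<ge>m. \<bar>Y j \<omega> - Y m \<omega>\<bar> < e}"
  let ?T = "{\<omega> \<in> space M. \<exists>m. \<forall>j\<ge>m. \<bar>Y j \<omega> - Y m \<omega>\<bar> < e}"
  \<comment> \<open>The tail of the costs vanishes as \<open>m\<close> grows, and \<open>?T\<close>
    contains every \<open>?S m\<close>; so the probability of \<open>?T\<close> is bounded below by
    a sequence tending to 1.\<close>
  have "(\<lambda>m. 1 - (suminf cost - (\<Sum>j<m. cost j)) / e\<^sup>2) \<longlonglongrightarrow> 1 - (suminf cost - suminf cost) / e\<^sup>2"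
    by (intro tendsto_intros summable_LIMSEQ[OF cost_summable]) (use assms in auto)
  moreover have "1 - (suminf cost - (\<Sum>j<m. cost j)) / e\<^sup>2 \<le> prob ?T" for m
  proof -
    have "prob (?S m) \<le> prob ?T"
      by (rule finite_measure_mono) auto
    then show ?thesis using maximal_inequality[OF assms, of m] by linarith
  qed
  ultimately have "1 \<le> prob ?T"
    by (auto intro: LIMSEQ_le_const2)
  then have "prob ?T = 1" by (simp add: antisym)
  then show ?thesis by (subst (asm) prob_Collect_eq_1) auto
qed

lemma converges: "AE \<omega> in M. (\<lambda>n. Y n \<omega>) \<longlonglongrightarrow> Yinf \<omega>"
proof -
  have "AE \<omega> in M. \<forall>i::nat. \<exists>m. \<forall>j\<ge>m. \<bar>Y j \<omega> - Y m \<omega>\<bar> < 1 / Suc i"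
    by (subst AE_all_countable) (intro allI AE_eventually_near, simp)
  then show ?thesis
  proof eventually_elim
    case (elim \<omega>)
    have "Cauchy (\<lambda>n. Y n \<omega>)"
    proof (rule CauchyI')
      fix e :: real assume "0 < e"
      then obtain i :: nat where i: "1 / Suc i < e / 2"
        using reals_Archimedean[of "e / 2"] by (auto simp: inverse_eq_divide)
      obtain m where m: "\<forall>j\<ge>m. \<bar>Y j \<omega> - Y m \<omega>\<bar> < 1 / Suc i" using elim by blast
      have "\<bar>Y j \<omega> - Y k \<omega>\<bar> < e" if "j \<ge> m" "k > j" for j k
      proof -
        have "\<bar>Y j \<omega> - Y m \<omega>\<bar> < e / 2" "\<bar>Y k \<omega> - Y m \<omega>\<bar> < e / 2"
          using m[rule_format, of j] m[rule_format, of k] that i by linarith+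
        then show ?thesis by linarith
      qed
      then show "\<exists>m. \<forall>j\<ge>m. \<forall>k>j. dist (Y j \<omega>) (Y k \<omega>) < e" by (auto simp: dist_real_def)
    qed
    then show ?case
      unfolding Yinf_def by (simp add: Cauchy_convergent_iff convergent_LIMSEQ_iff)
  qed
qed

lemma Yinf_range: "AE \<omega> in M. 0 \<le> Yinf \<omega> \<and> Yinf \<omega> \<le> 1"
  using converges
  by eventually_elim (auto intro: LIMSEQ_le_const LIMSEQ_le_const2)

section \<open>Passage to the limit and the values of the limit\<close>

lemma limit_integral:
  fixes k c :: real
  assumes [measurable]: "Z \<in> borel_measurable M" and Z: "\<And>\<omega>. \<omega> \<in> space M \<Longrightarrow> \<bar>Z \<omega>\<bar> \<le> k"
    and [measurable]: "\<psi> \<in> borel_measurable borel" and \<psi>: "continuous_on {0..1} \<psi>"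
    and c: "\<And>y. y \<in> {0..1} \<Longrightarrow> \<bar>\<psi> y\<bar> \<le> c"
  shows "(\<lambda>n. \<integral>\<omega>. Z \<omega> * \<psi> (Y n \<omega>) \<partial>M) \<longlonglongrightarrow> (\<integral>\<omega>. Z \<omega> * \<psi> (Yinf \<omega>) \<partial>M)"
proof (rule integral_dominated_convergence[where w = "\<lambda>_. k * c"])
  show "AE \<omega> in M. (\<lambda>n. Z \<omega> * \<psi> (Y n \<omega>)) \<longlonglongrightarrow> Z \<omega> * \<psi> (Yinf \<omega>)"
    using converges Yinf_range
  proof eventually_elim
    case (elim \<omega>)
    have "(\<lambda>n. \<psi> (Y n \<omega>)) \<longlonglongrightarrow> \<psi> (Yinf \<omega>)"
      by (rule continuous_on_tendsto_compose[OF \<psi> elim(1)]) (use elim in auto)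
    then show ?case by (intro tendsto_intros)
  qed
  have k0: "0 \<le> k" using Z not_empty by force
  show "AE \<omega> in M. norm (Z \<omega> * \<psi> (Y n \<omega>)) \<le> k * c" for n
    using Z c k0 by (auto simp: abs_mult intro!: mult_mono)
qed auto

lemma integral_h_tendsto: "(\<lambda>n. \<integral>\<omega>. h (Y n \<omega>) \<partial>M) \<longlonglongrightarrow> (\<integral>\<omega>. h (Yinf \<omega>) \<partial>M)"
proof -
  have "(\<lambda>n. \<integral>\<omega>. 1 * h (Y n \<omega>) \<partial>M) \<longlonglongrightarrow> (\<integral>\<omega>. 1 * h (Yinf \<omega>) \<partial>M)"
    by (rule limit_integral[of _ 1 _ 1])
      (use h_range in \<open>auto simp: h_def intro!: continuous_intros\<close>)
  then show ?thesis by simp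
qed

lemma mean_tendsto: "(\<lambda>n. \<integral>\<omega>. Y n \<omega> \<partial>M) \<longlonglongrightarrow> (\<integral>\<omega>. Yinf \<omega> \<partial>M)"
proof -
  have "(\<lambda>n. \<integral>\<omega>. 1 * (\<lambda>y. y) (Y n \<omega>) \<partial>M) \<longlonglongrightarrow> (\<integral>\<omega>. 1 * (\<lambda>y. y) (Yinf \<omega>) \<partial>M)"
    by (rule limit_integral[of _ 1 _ 1]) (auto intro!: continuous_intros)
  then show ?thesis by simp
qed

lemma h_Yinf_nonneg: "AE \<omega> in M. 0 \<le> h (Yinf \<omega>)"
  using Yinf_range by eventually_elim (use h_range in auto)

lemma integrable_h_Yinf: "integrable M (\<lambda>\<omega>. h (Yinf \<omega>))"
proof (rule integrable_const_bound[of _ 1])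
  show "AE \<omega> in M. norm (h (Yinf \<omega>)) \<le> 1"
    using Yinf_range by eventually_elim (use h_range in auto)
qed simp

lemma Yinf_binary_iff: "(\<integral>\<omega>. h (Yinf \<omega>) \<partial>M) = 0 \<longleftrightarrow> (AE \<omega> in M. Yinf \<omega> \<in> {0, 1})"
  using integral_nonneg_eq_0_iff_AE[OF integrable_h_Yinf h_Yinf_nonneg]
  by (simp add: h_def disj_commute)

text \<open>Applied with two divergent weights: g in the biased case, where the drift is summable,
  and g^2 in the fair case, where the variance is. The mean of h (Y n) converges to that of h Yinf;
  if this limit were positive, \<open>w\<close> would eventually be bounded by a multiple of a
  summable sequence.\<close>

lemma Yinf_binary:
  assumes w: "\<And>n. 0 \<le> w n" "\<not> summable w" and s: "summable (\<lambda>n. w n * (\<integral>\<omega>. h (Y n \<omega>) \<partial>M))"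
  shows "AE \<omega> in M. Yinf \<omega> \<in> {0, 1}"
proof -
  let ?L = "\<integral>\<omega>. h (Yinf \<omega>) \<partial>M"
  have "0 \<le> ?L" using h_Yinf_nonneg by (rule integral_nonneg_AE)
  moreover have "\<not> 0 < ?L"
  proof
    assume L: "0 < ?L"
    then have "\<forall>\<^sub>F n in sequentially. ?L / 2 < (\<integral>\<omega>. h (Y n \<omega>) \<partial>M)"
      using integral_h_tendsto by (intro order_tendstoD) auto
    then have "\<forall>\<^sub>F n in sequentially. norm (w n) \<le> 2 / ?L * (w n * (\<integral>\<omega>. h (Y n \<omega>) \<partial>M))"
    proof eventually_elim
      case (elim n)
      then have "w n * (?L / 2) \<le> w n * (\<integral>\<omega>. h (Y n \<omega>) \<partial>M)"
        using w(1)[of n] by (intro mult_left_mono) auto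
      then show ?case using L w(1)[of n] by (simp add: field_simps)
    qed
    then have "summable w"
      by (rule summable_comparison_test_ev) (intro summable_mult s)
    then show False using w(2) by simp
  qed
  ultimately show ?thesis using Yinf_binary_iff by simp
qed

lemma prob_Yinf_eq_1:
  assumes "AE \<omega> in M. Yinf \<omega> \<in> {0, 1}"
  shows "prob {\<omega> \<in> space M. Yinf \<omega> = 1} = (\<integral>\<omega>. Yinf \<omega> \<partial>M)"
proof -
  have "(\<integral>\<omega>. Yinf \<omega> \<partial>M) = (\<integral>\<omega>. indicator {\<omega> \<in> space M. Yinf \<omega> = 1} \<omega> \<partial>M)"
  proof (rule integral_cong_AE)
    show "AE \<omega> in M. Yinf \<omega> = indicator {\<omega> \<in> space M. Yinf \<omega> = 1} \<omega>"
      using assms AE_space by eventually_elim auto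
  qed auto
  then show ?thesis by simp
qed

section \<open>Biased, degenerate and fair chains\<close>

lemma biased_summable:
  assumes "a \<noteq> b"
  shows "summable (\<lambda>n. g n * (\<integral>\<omega>. h (Y n \<omega>) \<partial>M))"
  using drift_summable assms by (simp add: summable_cmult_iff)

lemma biased_binary:
  assumes "a \<noteq> b"
  shows "AE \<omega> in M. Yinf \<omega> \<in> {0, 1}"
  by (rule Yinf_binary[of g]) (use g_diverges biased_summable assms in auto)

lemma biased_prob:
  assumes "a \<noteq> b"
  shows "prob {\<omega> \<in> space M. Yinf \<omega> = 1} = x + (a - b) * (\<Sum>n. g n * (\<integral>\<omega>. h (Y n \<omega>) \<partial>M))"
proof -
  have "(\<lambda>n. x + (a - b) * (\<Sum>k<n. g k * (\<integral>\<omega>. h (Y k \<omega>) \<partial>M))) \<longlonglongrightarrow>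
      x + (a - b) * (\<Sum>n. g n * (\<integral>\<omega>. h (Y n \<omega>) \<partial>M))"
    by (intro tendsto_intros summable_LIMSEQ biased_summable assms)
  then have "(\<integral>\<omega>. Yinf \<omega> \<partial>M) = x + (a - b) * (\<Sum>n. g n * (\<integral>\<omega>. h (Y n \<omega>) \<partial>M))"
    using LIMSEQ_unique[OF mean_tendsto] by (simp add: mean_sum)
  then show ?thesis using prob_Yinf_eq_1 biased_binary assms by simp
qed

lemma Y_pos:
  assumes "0 < x"
  shows "x * (\<Prod>k<n. 1 - g k) \<le> Y n \<omega>" "0 < x * (\<Prod>k<n. 1 - g k)" "0 < Y n \<omega>"
proof -
  show l: "x * (\<Prod>k<n. 1 - g k) \<le> Y n \<omega>"
  proof (induction n)
    case (Suc n)
    have "(1 - g n) * (x * (\<Prod>k<n. 1 - g k)) \<le> (1 - g n) * Y n \<omega>"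
      by (rule mult_left_mono[OF Suc]) simp
    then show ?case using Y_decay[of n \<omega>] by (simp add: mult_ac)
  qed (simp add: Y_0)
  show p: "0 < x * (\<Prod>k<n. 1 - g k)"
    using assms g_range by (intro mult_pos_pos prod_pos) simp_all
  show "0 < Y n \<omega>" using l p by linarith
qed

lemma Y_less_1:
  assumes "x < 1"
  shows "Y n \<omega> < 1"
proof -
  interpret sw: bandit_chain M F "\<lambda>n \<omega>. 1 - Y n \<omega>" "\<lambda>n. space M - D n" Q P b a g "1 - x"
    by (rule swap)
  show ?thesis using sw.Y_pos(3)[of n \<omega>] assms by simp
qed

text \<open>The term of index 0 is already \<open>g 0 * h x\<close>; strictness comes from the next
  one, which is positive because a chain started inside (0, 1) never reaches an endpoint.\<close>

lemma biased_increase: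
  assumes "b < a" "0 < x" "x < 1"
  shows "g 0 * h x < (\<Sum>n. g n * (\<integral>\<omega>. h (Y n \<omega>) \<partial>M))"
proof -
  have "0 < (\<integral>\<omega>. h (Y 1 \<omega>) \<partial>M)"
  proof -
    have "0 < h (Y 1 \<omega>)" for \<omega>
      unfolding h_def using Y_pos(3)[OF assms(2)] Y_less_1[OF assms(3)] by (intro mult_pos_pos) auto
    then have "AE \<omega> in M. 0 \<le> h (Y 1 \<omega>)" "\<not> (AE \<omega> in M. h (Y 1 \<omega>) = 0)"
      by (auto simp: less_imp_le less_imp_neq[symmetric] AE_False)
    then show ?thesis
      using integral_nonneg_eq_0_iff_AE[OF integrable_h, of 1] integral_h_nonneg[of 1] by auto
  qed
  then have "g 0 * h x < (\<Sum>k<2. g k * (\<integral>\<omega>. h (Y k \<omega>) \<partial>M))"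
    using g_range(1)[of 1] by (simp add: numeral_2_eq_2 Y_0 prob_space)
  also have "\<dots> \<le> (\<Sum>n. g n * (\<integral>\<omega>. h (Y n \<omega>) \<partial>M))"
    using assms integral_h_nonneg by (intro sum_le_suminf biased_summable) auto
  finally show ?thesis .
qed

lemma Q_null:
  assumes "\<And>n. b * (\<integral>\<omega>. (1 - Y n \<omega>) \<partial>M) = 0"
  shows "AE \<omega> in M. \<forall>n. \<omega> \<notin> Q n"
proof -
  have "prob (Q n) = 0" for n
    using draw_down[of "\<lambda>_. 1" n 1] assms[of n] by simp
  then have "AE \<omega> in M. \<omega> \<notin> Q n" for n
    by (intro AE_not_in) (auto simp: null_sets_def emeasure_eq_measure)
  then show ?thesis by (simp add: AE_all_countable)
qed

lemma no_down_incseq: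
  assumes "b = 0"
  shows "AE \<omega> in M. incseq (\<lambda>n. Y n \<omega>)"
proof -
  have "AE \<omega> in M. \<forall>n. \<omega> \<notin> Q n" by (rule Q_null) (use assms in simp)
  then show ?thesis
    by eventually_elim (auto intro!: incseq_SucI mult_nonneg_nonneg simp: Y_Suc)
qed

text \<open>With b = 0 < a the chain is biased, so its limit is 0 or 1, and monotone paths keep it
  at or above x > 0.\<close>

lemma no_down_limit:
  assumes "b = 0" "0 < a" "0 < x"
  shows "AE \<omega> in M. incseq (\<lambda>n. Y n \<omega>) \<and> (\<lambda>n. Y n \<omega>) \<longlonglongrightarrow> 1"
proof -
  have "AE \<omega> in M. Yinf \<omega> \<in> {0, 1}" using biased_binary assms by simp
  with no_down_incseq[OF assms(1)] converges show ?thesis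
  proof eventually_elim
    case (elim \<omega>)
    have "x \<le> Yinf \<omega>"
      using incseq_le[OF elim(1,2), of 0] by (simp add: Y_0)
    then show ?case using elim assms by auto
  qed
qed

text \<open>At an endpoint one of the two moves has probability 0 and the other leaves the value
  where it is; for a = b = 0 neither move occurs.\<close>

lemma frozen:
  assumes "x = 0 \<or> x = 1 \<or> a = 0 \<and> b = 0"
  shows "AE \<omega> in M. \<forall>n. Y n \<omega> = x"
proof -
  have "AE \<omega> in M. Y n \<omega> = x" for n
  proof (induction n)
    case (Suc n)
    have E: "(\<integral>\<omega>. Y n \<omega> \<partial>M) = x" "(\<integral>\<omega>. (1 - Y n \<omega>) \<partial>M) = 1 - x"
    proof -
      have "(\<integral>\<omega>. Y n \<omega> \<partial>M) = (\<integral>\<omega>. x \<partial>M)"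
        by (rule integral_cong_AE) (use Suc in auto)
      then show "(\<integral>\<omega>. Y n \<omega> \<partial>M) = x" by (simp add: prob_space)
      then show "(\<integral>\<omega>. (1 - Y n \<omega>) \<partial>M) = 1 - x"
        using integrable_Y[of "\<lambda>y. y" 1 n] by (simp add: prob_space)
    qed
    have "prob (P n) = 0" if "a * x = 0"
      using draw_up[of "\<lambda>_. 1" n 1] that E by simp
    then have P: "AE \<omega> in M. \<omega> \<notin> P n" if "a * x = 0"
      using that by (intro AE_not_in) (auto simp: null_sets_def emeasure_eq_measure)
    have "prob (Q n) = 0" if "b * (1 - x) = 0"
      using draw_down[of "\<lambda>_. 1" n 1] that E by simp
    then have Q: "AE \<omega> in M. \<omega> \<notin> Q n" if "b * (1 - x) = 0"
      using that by (intro AE_not_in) (auto simp: null_sets_def emeasure_eq_measure)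
    have "AE \<omega> in M. \<omega> \<notin> P n \<or> x = 1" using P assms by (cases "x = 1") auto
    moreover have "AE \<omega> in M. \<omega> \<notin> Q n \<or> x = 0" using Q assms by (cases "x = 0") auto
    ultimately show ?case using Suc by eventually_elim (auto simp: Y_Suc)
  qed (simp add: Y_0)
  then show ?thesis by (simp add: AE_all_countable)
qed

lemma fair_mean:
  assumes "a = b"
  shows "(\<integral>\<omega>. Yinf \<omega> \<partial>M) = x"
  using LIMSEQ_unique[OF mean_tendsto] assms by (simp add: mean_sum)

lemma fair_binary:
  assumes "a = b" "0 < a" "\<not> summable (\<lambda>n. (g n)\<^sup>2)"
  shows "AE \<omega> in M. Yinf \<omega> \<in> {0, 1}"
proof (rule Yinf_binary[of "\<lambda>n. (g n)\<^sup>2"])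
  have "variance_rate n y = a * ((g n)\<^sup>2 * h y)" for n y
    unfolding variance_rate_def unfolding assms(1)[symmetric] by algebra
  then have "(\<integral>\<omega>. variance_rate n (Y n \<omega>) \<partial>M) = a * ((g n)\<^sup>2 * (\<integral>\<omega>. h (Y n \<omega>) \<partial>M))" for n
    by simp
  then show "summable (\<lambda>n. (g n)\<^sup>2 * (\<integral>\<omega>. h (Y n \<omega>) \<partial>M))"
    using variance_summable assms(2) by (simp add: summable_cmult_iff)
qed (use assms in auto)

lemma fair_distribution:
  assumes "a = b" "AE \<omega> in M. Yinf \<omega> \<in> {0, 1}"
  shows "distr M borel Yinf = distr (measure_pmf (bernoulli_pmf x)) borel of_bool"
proof (rule measure_eqI)
  fix S :: "real set" assume "S \<in> sets (distr M borel Yinf)"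
  then have S [measurable]: "S \<in> sets borel" by simp
  let ?I = "\<lambda>v. {\<omega> \<in> space M. Yinf \<omega> = v}"
  have p1: "prob (?I 1) = x" using prob_Yinf_eq_1 fair_mean assms by simp
  have "prob (?I 0) = prob (space M - ?I 1)"
    by (rule finite_measure_eq_AE) (use assms(2) AE_space in \<open>eventually_elim, auto\<close>, measurable)
  then have p0: "prob (?I 0) = 1 - x" using p1 by (simp add: prob_compl)
  have "prob (Yinf -` S \<inter> space M) =
      prob ((if 0 \<in> S then ?I 0 else {}) \<union> (if 1 \<in> S then ?I 1 else {}))"
  proof (rule finite_measure_eq_AE)
    show "AE \<omega> in M. (\<omega> \<in> Yinf -` S \<inter> space M) =
        (\<omega> \<in> (if 0 \<in> S then ?I 0 else {}) \<union> (if 1 \<in> S then ?I 1 else {}))"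
      using assms(2) AE_space by eventually_elim auto
  qed auto
  also have "\<dots> = (1 - x) * indicator S 0 + x * indicator S 1"
  proof -
    have "?I 0 \<inter> ?I 1 = {}" by auto
    then have "prob (?I 0 \<union> ?I 1) = prob (?I 0) + prob (?I 1)"
      by (intro finite_measure_Union) auto
    then show ?thesis by (auto simp: p0 p1 indicator_def)
  qed
  finally have "emeasure (distr M borel Yinf) S = ennreal ((1 - x) * indicator S 0 + x * indicator S 1)"
    by (simp add: emeasure_distr emeasure_eq_measure)
  moreover have "emeasure (distr (measure_pmf (bernoulli_pmf x)) borel of_bool) S =
      ennreal ((1 - x) * indicator S 0 + x * indicator S 1)"
  proof -
    have "emeasure (distr (measure_pmf (bernoulli_pmf x)) borel of_bool) S =
       emeasure (measure_pmf (bernoulli_pmf x)) (of_bool -` S)"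
      by (simp add: emeasure_distr)
    also have "\<dots> = (\<Sum>v\<in>UNIV. ennreal (pmf (bernoulli_pmf x) v) * indicator (of_bool -` S) v)"
      by (subst nn_integral_indicator[symmetric], simp, subst nn_integral_measure_pmf,
          simp add: nn_integral_count_space_finite UNIV_bool)
    also have "\<dots> = ennreal ((1 - x) * indicator S 0 + x * indicator S 1)"
      using x_range by (auto simp: UNIV_bool indicator_def ennreal_plus[symmetric] simp del: ennreal_plus)
    finally show ?thesis .
  qed
  ultimately show "emeasure (distr M borel Yinf) S = emeasure (distr (measure_pmf (bernoulli_pmf x)) borel of_bool) S"
    by simp
qed simp

text \<open>In the fair case h is an eigenfunction of the one-step operator, with eigenvalue 1 - a
  (g n)^2, so the mean of h (Y n) is an explicit product. Summability of g^2 makes the infinite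
  product nonzero, which forces mass into (0, 1).\<close>

lemma fair_interior:
  assumes "a = b" "summable (\<lambda>n. (g n)\<^sup>2)" "0 < x" "x < 1"
  shows "0 < prob {\<omega> \<in> space M. Yinf \<omega> \<in> {0<..<1}}"
proof -
  have gen: "gen n h y = (1 - a * (g n)\<^sup>2) * h y" for n y
    unfolding gen_def h_def unfolding assms(1)[symmetric] by algebra
  have "(\<integral>\<omega>. h (Y (Suc n) \<omega>) \<partial>M) = (1 - a * (g n)\<^sup>2) * (\<integral>\<omega>. h (Y n \<omega>) \<partial>M)" for n
  proof -
    have "(\<integral>\<omega>. 1 * h (Y (Suc n) \<omega>) \<partial>M) = (\<integral>\<omega>. 1 * gen n h (Y n \<omega>) \<partial>M)"
      by (rule step[where l = 0 and k = 1 and c = 1]) (use h_range in auto)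
    then show ?thesis by (simp add: gen)
  qed
  then have hn: "(\<integral>\<omega>. h (Y n \<omega>) \<partial>M) = h x * (\<Prod>k<n. 1 - a * (g k)\<^sup>2)" for n
    by (induction n) (simp_all add: Y_0 prob_space)
  have "(g n)\<^sup>2 < 1" for n using g_range[of n] by (simp add: power_less_one_iff)
  then have pos: "0 < 1 - a * (g n)\<^sup>2" for n
    using a_range mult_right_mono[of a 1 "(g n)\<^sup>2"] by (smt (verit) zero_le_power2)
  have "summable (\<lambda>n. norm (- (a * (g n)\<^sup>2)))"
    using assms(2) a_range by (simp add: summable_mult)
  then have "abs_convergent_prod (\<lambda>n. 1 + - (a * (g n)\<^sup>2))"
    by (intro summable_imp_abs_convergent_prod) simp
  then have "convergent_prod (\<lambda>n. 1 - a * (g n)\<^sup>2)"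
    using abs_convergent_prod_imp_convergent_prod by fastforce
  then have "prodinf (\<lambda>n. 1 - a * (g n)\<^sup>2) \<noteq> 0"
    and "(\<lambda>n. \<Prod>k\<le>n. 1 - a * (g k)\<^sup>2) \<longlonglongrightarrow> prodinf (\<lambda>n. 1 - a * (g n)\<^sup>2)"
    using less_imp_neq[OF pos, symmetric] by (auto intro!: convergent_prod_LIMSEQ dest: prodinf_nonzero)
  moreover from this(2) have "(\<lambda>n. \<Prod>k<Suc n. 1 - a * (g k)\<^sup>2) \<longlonglongrightarrow> prodinf (\<lambda>n. 1 - a * (g n)\<^sup>2)"
    by (simp add: lessThan_Suc_atMost)
  then have "(\<lambda>n. h x * (\<Prod>k<n. 1 - a * (g k)\<^sup>2)) \<longlonglongrightarrow> h x * prodinf (\<lambda>n. 1 - a * (g n)\<^sup>2)"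
    by (intro tendsto_intros) (rule LIMSEQ_imp_Suc)
  then have "(\<integral>\<omega>. h (Yinf \<omega>) \<partial>M) = h x * prodinf (\<lambda>n. 1 - a * (g n)\<^sup>2)"
    using LIMSEQ_unique[OF integral_h_tendsto] by (simp add: hn)
  ultimately have "(\<integral>\<omega>. h (Yinf \<omega>) \<partial>M) \<noteq> 0"
    using assms by (simp add: h_def)
  then have nb: "\<not> (AE \<omega> in M. Yinf \<omega> \<in> {0, 1})" by (simp add: Yinf_binary_iff)
  have "prob {\<omega> \<in> space M. Yinf \<omega> \<in> {0<..<1}} \<noteq> 0"
  proof
    assume "prob {\<omega> \<in> space M. Yinf \<omega> \<in> {0<..<1}} = 0"
    then have "AE \<omega> in M. \<omega> \<notin> {\<omega> \<in> space M. Yinf \<omega> \<in> {0<..<1}}"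
      by (intro AE_not_in) (auto simp: null_sets_def emeasure_eq_measure)
    then have "AE \<omega> in M. Yinf \<omega> \<in> {0, 1}"
      using Yinf_range AE_space by eventually_elim auto
    then show False using nb by simp
  qed
  then show ?thesis by (simp add: zero_less_measure_iff)
qed

subsection \<open>Convergence to 0 with positive probability\<close>

definition shrink :: "nat \<Rightarrow> real" where "shrink n = (\<Prod>k<n. 1 - b * g k)"

definition no_draw :: "nat \<Rightarrow> 'a set" where "no_draw n = {\<omega> \<in> space M. \<forall>k<n. \<omega> \<notin> D k}"

lemma bg_less_1: "b * g n < 1"
  using mult_right_mono[OF b_range(2) g_ge_0[of n]] g_range[of n] by linarith

lemma bg_nonneg: "0 \<le> b * g n"
  using b_range by simp

lemma shrink_pos: "0 < shrink n"
  unfolding shrink_def using bg_less_1 by (intro prod_pos) simp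

lemma no_draw_F: "no_draw n \<in> sets (F n)"
proof (induction n)
  case 0
  have "no_draw 0 = space (F 0)" by (simp add: no_draw_def)
  then show ?case by (simp only: sets.top)
next
  case (Suc n)
  have "no_draw (Suc n) = no_draw n - D n" by (auto simp: no_draw_def less_Suc_eq)
  then show ?case using Suc D_sets[of n] F_mono[of n] by (auto intro: sets.Diff)
qed

lemma no_draw_sets [measurable]: "no_draw n \<in> sets M"
  using no_draw_F F_sub by blast

lemma indicator_no_draw_Suc:
  "\<omega> \<in> space M \<Longrightarrow> indicator (no_draw (Suc n)) \<omega> =
    (indicator (no_draw n) \<omega> * indicator (space M - D n) \<omega> :: real)"
  by (auto simp: no_draw_def indicator_def less_Suc_eq)

lemma no_draw_Y_le: "\<omega> \<in> no_draw n \<Longrightarrow> Y n \<omega> \<le> x"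
proof (induction n)
  case (Suc n)
  then have "\<omega> \<in> no_draw n" "\<omega> \<notin> P n"
    using P_D[of n] by (auto simp: no_draw_def)
  moreover from this(2) have "Y (Suc n) \<omega> = Y n \<omega> - g n * Y n \<omega> * indicator (Q n) \<omega>"
    by (simp add: Y_Suc)
  moreover have "0 \<le> g n * Y n \<omega> * indicator (Q n) \<omega>" by simp
  ultimately show ?case using Suc.IH by linarith
qed (simp add: Y_0)

lemma no_draw_step:
  assumes [measurable]: "\<psi> \<in> borel_measurable borel" and "\<And>y. 0 \<le> y \<Longrightarrow> y \<le> 1 \<Longrightarrow> \<bar>\<psi> y\<bar> \<le> c"
  shows "(\<integral>\<omega>. indicator (no_draw (Suc n)) \<omega> * \<psi> (Y (Suc n) \<omega>) \<partial>M) =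
    (\<integral>\<omega>. indicator (no_draw n) \<omega> *
      ((1 - Y n \<omega>) * (b * \<psi> (Y n \<omega> - g n * Y n \<omega>) + (1 - b) * \<psi> (Y n \<omega>))) \<partial>M)"
proof -
  have "(\<integral>\<omega>. indicator (no_draw (Suc n)) \<omega> * \<psi> (Y (Suc n) \<omega>) \<partial>M) =
     (\<integral>\<omega>. indicator (no_draw n) \<omega> * indicator (space M - D n) \<omega> * \<psi> (Y (Suc n) \<omega>) \<partial>M)"
    by (rule Bochner_Integration.integral_cong[OF refl]) (simp add: indicator_no_draw_Suc)
  also have "\<dots> = (\<integral>\<omega>. indicator (no_draw n) \<omega> *
      ((1 - Y n \<omega>) * (b * \<psi> (Y n \<omega> - g n * Y n \<omega>) + (1 - b) * \<psi> (Y n \<omega>))) \<partial>M)"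
    using no_draw_F[of n] assms
    by (intro step_no_draw[where k = 1 and c = c]) (auto simp: indicator_def)
  finally show ?thesis .
qed

text \<open>The quotient is the sum over k of the products of 1 - b g j for n \<le> j < n + k: the
  expected sum of all values, from time n on, of a chain that starts at 1 at time n and plays only
  the second arm. Splitting off the term k = 0 gives the recursion.\<close>

lemma shrink_tail:
  assumes "summable shrink"
  shows "(\<Sum>k. shrink (n + k)) / shrink n = 1 + (1 - b * g n) * ((\<Sum>k. shrink (Suc n + k)) / shrink (Suc n))"
proof -
  have s: "summable (\<lambda>k. shrink (n + k))"
    using summable_ignore_initial_segment[OF assms, of n] by (simp add: add.commute)
  have e: "(\<Sum>k. shrink (n + k)) = shrink n + (\<Sum>k. shrink (Suc n + k))"
    using suminf_split_head[OF s] by simp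
  have "shrink (Suc n) = (1 - b * g n) * shrink n" by (simp add: shrink_def)
  moreover have "(t + T) / t = 1 + q * (T / (q * t))" if "0 < t" "0 < q" for t T q :: real
    using that by (simp add: field_simps)
  ultimately show ?thesis unfolding e using shrink_pos[of n] bg_less_1[of n] by simp
qed

text \<open>With \<open>S n = 1 + (1 - b * g n) * S (n + 1)\<close> and \<open>exp (- c * y) \<le> 1 - y\<close> on \<open>[0, x]\<close>, the
  function \<open>exp (- c * y * S n)\<close> makes a submartingale on the event that the first arm is never drawn.\<close>

lemma never_drawn_pos:
  assumes sm: "summable shrink" and x: "x < 1"
  shows "0 < prob (\<Inter>n. no_draw n)"
proof -
  define S where "S n = (\<Sum>k. shrink (n + k)) / shrink n" for n
  define c where "c = 1 / (1 - x)"
  define \<psi> where "\<psi> n y = exp (- (c * y * S n))" for n y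
  have c: "0 \<le> c" using x by (simp add: c_def)
  have S_Suc: "S n = 1 + (1 - b * g n) * S (Suc n)" for n
    unfolding S_def by (rule shrink_tail[OF sm])
  have S: "0 \<le> S n" for n
    unfolding S_def using shrink_pos summable_ignore_initial_segment[OF sm, of n]
    by (intro divide_nonneg_nonneg suminf_nonneg) (simp_all add: add.commute less_imp_le)
  have \<psi>1: "\<bar>\<psi> n y\<bar> \<le> 1" if "0 \<le> y" for n y
    using that c S[of n] by (simp add: \<psi>_def)
  have \<psi>m [measurable]: "\<psi> n \<in> borel_measurable borel" for n unfolding \<psi>_def by measurable
  let ?v = "\<lambda>n. \<integral>\<omega>. indicator (no_draw n) \<omega> * \<psi> n (Y n \<omega>) \<partial>M"
  have int: "integrable M (\<lambda>\<omega>. indicator (no_draw n) \<omega> * \<psi> n (Y n \<omega>))" for n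
    using \<psi>1 by (intro integrable_bounded[of _ 1]) (auto simp: indicator_def)
  have mono: "?v n \<le> ?v (Suc n)" for n
  proof -
    \<comment> \<open>The factor exp (- c y) pays for escaping the draw at this step. By the
      recursion for \<open>S\<close>, the rest of the exponent is the mean, with weights b and 1 -
      b, of the exponents after a downward move and after no move, so convexity of exp applies.
      Restricting to y \<le> x is harmless, as a path cannot rise without a draw.\<close>
    have pt: "\<psi> n y \<le> (1 - y) * (b * \<psi> (Suc n) (y - g n * y) + (1 - b) * \<psi> (Suc n) y)"
      if "0 \<le> y" "y \<le> x" for y
    proof -
      have "\<psi> n y = exp (- (c * y)) * exp (- (c * y * S (Suc n) * (1 - b * g n)))"
        unfolding \<psi>_def S_Suc[of n] by (simp add: exp_add[symmetric] algebra_simps)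
      also have "\<dots> \<le> (1 - y) * exp (- (c * y * S (Suc n) * (1 - b * g n)))"
        using exp_le_one_minus[of y x] that x by (intro mult_right_mono) (simp_all add: c_def)
      also have "\<dots> = (1 - y) * exp (b * (- (c * (y - g n * y) * S (Suc n))) + (1 - b) * (- (c * y * S (Suc n))))"
        by (simp add: algebra_simps)
      also have "\<dots> \<le> (1 - y) * (b * \<psi> (Suc n) (y - g n * y) + (1 - b) * \<psi> (Suc n) y)"
        unfolding \<psi>_def using that x b_range by (intro mult_left_mono exp_two_point) auto
      finally show ?thesis .
    qed
    have "?v n \<le> (\<integral>\<omega>. indicator (no_draw n) \<omega> *
       ((1 - Y n \<omega>) * (b * \<psi> (Suc n) (Y n \<omega> - g n * Y n \<omega>) + (1 - b) * \<psi> (Suc n) (Y n \<omega>))) \<partial>M)"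
    proof (rule integral_mono[OF int])
      show "integrable M (\<lambda>\<omega>. indicator (no_draw n) \<omega> *
       ((1 - Y n \<omega>) * (b * \<psi> (Suc n) (Y n \<omega> - g n * Y n \<omega>) + (1 - b) * \<psi> (Suc n) (Y n \<omega>))))"
      proof (rule integrable_bounded[of _ 1])
        fix \<omega>
        have d: "0 \<le> Y n \<omega> - g n * Y n \<omega>" using up_range(4,5)[of "Y n \<omega>" n] by simp
        have "\<bar>b * \<psi> (Suc n) (Y n \<omega> - g n * Y n \<omega>) + (1 - b) * \<psi> (Suc n) (Y n \<omega>)\<bar> \<le> b * 1 + (1 - b) * 1"
          using \<psi>1[OF d, of "Suc n"] \<psi>1[of "Y n \<omega>" "Suc n"] b_range
          by (intro order_trans[OF abs_triangle_ineq] add_mono) (auto simp: abs_mult intro!: mult_left_le)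
        then show "\<bar>indicator (no_draw n) \<omega> *
           ((1 - Y n \<omega>) * (b * \<psi> (Suc n) (Y n \<omega> - g n * Y n \<omega>) + (1 - b) * \<psi> (Suc n) (Y n \<omega>)))\<bar> \<le> 1"
          by (auto simp: indicator_def abs_mult intro!: mult_le_one)
      qed measurable
    qed (use pt no_draw_Y_le in \<open>auto simp: indicator_def\<close>)
    also have "\<dots> = ?v (Suc n)"
      by (rule no_draw_step[symmetric]) (use \<psi>1 in auto)
    finally show ?thesis .
  qed
  have v0n: "?v 0 \<le> ?v n" for n
    by (rule lift_Suc_mono_le[of ?v, OF mono]) simp
  have v0: "?v 0 = exp (- (c * x * S 0))"
  proof -
    have "?v 0 = (\<integral>\<omega>. exp (- (c * x * S 0)) \<partial>M)"
      by (rule Bochner_Integration.integral_cong) (simp_all add: no_draw_def \<psi>_def Y_0)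
    then show ?thesis by (simp add: prob_space)
  qed
  have vn: "?v n \<le> prob (no_draw n)" for n
  proof -
    have "?v n \<le> (\<integral>\<omega>. indicator (no_draw n) \<omega> \<partial>M)"
    proof (rule integral_mono[OF int])
      show "integrable M (\<lambda>\<omega>. indicator (no_draw n) \<omega> :: real)"
        by (rule integrable_bounded[of _ 1]) (auto simp: indicator_def)
    qed (use \<psi>1 in \<open>auto simp: indicator_def abs_le_iff\<close>)
    then show ?thesis by simp
  qed
  have "exp (- (c * x * S 0)) \<le> prob (no_draw n)" for n
    using v0n[of n] v0 vn[of n] by linarith
  moreover have "(\<lambda>n. prob (no_draw n)) \<longlonglongrightarrow> prob (\<Inter>n. no_draw n)"
    by (intro finite_Lim_measure_decseq decseq_SucI) (auto simp: no_draw_def)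
  ultimately have "exp (- (c * x * S 0)) \<le> prob (\<Inter>n. no_draw n)"
    by (intro LIMSEQ_le_const) auto
  then show ?thesis by (rule less_le_trans[OF exp_gt_zero])
qed

text \<open>Given the past, not drawing the first arm has weight 1 - Y n, here bounded by 1; the
  value then shrinks on average by the factor 1 - b g n.\<close>

lemma no_draw_mean: "(\<integral>\<omega>. indicator (no_draw n) \<omega> * Y n \<omega> \<partial>M) \<le> x * shrink n"
proof (induction n)
  case 0
  have "(\<integral>\<omega>. indicator (no_draw 0) \<omega> * Y 0 \<omega> \<partial>M) = (\<integral>\<omega>. x \<partial>M)"
    by (rule Bochner_Integration.integral_cong) (simp_all add: no_draw_def Y_0)
  then show ?case by (simp add: shrink_def prob_space)
next
  case (Suc n)
  have b: "0 \<le> 1 - b * g n" "1 - b * g n \<le> 1" using bg_less_1[of n] bg_nonneg[of n] by auto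
  have "(\<integral>\<omega>. indicator (no_draw (Suc n)) \<omega> * Y (Suc n) \<omega> \<partial>M) =
    (\<integral>\<omega>. indicator (no_draw n) \<omega> *
      ((1 - Y n \<omega>) * (b * (Y n \<omega> - g n * Y n \<omega>) + (1 - b) * Y n \<omega>)) \<partial>M)"
    by (rule no_draw_step[of "\<lambda>y. y" 1]) auto
  also have "\<dots> = (\<integral>\<omega>. (1 - b * g n) * (indicator (no_draw n) \<omega> * (Y n \<omega> * (1 - Y n \<omega>))) \<partial>M)"
    by (rule Bochner_Integration.integral_cong[OF refl]) (simp add: algebra_simps)
  also have "\<dots> \<le> (\<integral>\<omega>. (1 - b * g n) * (indicator (no_draw n) \<omega> * Y n \<omega>) \<partial>M)"
    using b by (intro integral_mono mult_left_mono integrable_bounded[of _ 1])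
      (auto simp: indicator_def abs_mult intro!: mult_le_one mult_left_le)
  also have "\<dots> = (1 - b * g n) * (\<integral>\<omega>. indicator (no_draw n) \<omega> * Y n \<omega> \<partial>M)" by simp
  also have "\<dots> \<le> (1 - b * g n) * (x * shrink n)" by (rule mult_left_mono[OF Suc b(1)])
  finally show ?case by (simp add: shrink_def mult_ac)
qed

lemma prob_Yinf_0_pos:
  assumes sm: "summable (\<lambda>n. \<Prod>k<n. 1 - b * g k)" and x: "x < 1"
  shows "0 < prob {\<omega> \<in> space M. Yinf \<omega> = 0}"
proof -
  have sm': "summable shrink" using sm by (simp add: shrink_def[abs_def])
  define G where "G = (\<Inter>n. no_draw n)"
  have G [measurable]: "G \<in> sets M" unfolding G_def by measurable
  have ig: "integrable M (\<lambda>\<omega>. indicator G \<omega> * Yinf \<omega>)"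
  proof (rule integrable_const_bound[of _ 1])
    show "AE \<omega> in M. norm (indicator G \<omega> * Yinf \<omega>) \<le> 1"
      using Yinf_range by eventually_elim (auto simp: indicator_def)
  qed simp
  have nn: "AE \<omega> in M. 0 \<le> indicator G \<omega> * Yinf \<omega>"
    using Yinf_range by eventually_elim (auto simp: indicator_def)
  have "(\<lambda>n. \<integral>\<omega>. indicator G \<omega> * (\<lambda>y. y) (Y n \<omega>) \<partial>M) \<longlonglongrightarrow> (\<integral>\<omega>. indicator G \<omega> * (\<lambda>y. y) (Yinf \<omega>) \<partial>M)"
    by (rule limit_integral[of _ 1 _ 1]) (auto simp: indicator_def intro!: continuous_intros)
  moreover have "(\<integral>\<omega>. indicator G \<omega> * Y n \<omega> \<partial>M) \<le> x * shrink n" for n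
  proof -
    have "(\<integral>\<omega>. indicator G \<omega> * Y n \<omega> \<partial>M) \<le> (\<integral>\<omega>. indicator (no_draw n) \<omega> * Y n \<omega> \<partial>M)"
      by (intro integral_mono integrable_bounded[of _ 1]) (auto simp: indicator_def G_def)
    then show ?thesis using no_draw_mean[of n] by linarith
  qed
  moreover have "(\<lambda>n. x * shrink n) \<longlonglongrightarrow> x * 0"
    by (intro tendsto_intros summable_LIMSEQ_zero sm')
  ultimately have "(\<integral>\<omega>. indicator G \<omega> * Yinf \<omega> \<partial>M) \<le> 0"
    using LIMSEQ_le[of _ "\<integral>\<omega>. indicator G \<omega> * Yinf \<omega> \<partial>M"] by fastforce
  then have "(\<integral>\<omega>. indicator G \<omega> * Yinf \<omega> \<partial>M) = 0"
    using integral_nonneg_AE[OF nn] by simp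
  then have "AE \<omega> in M. indicator G \<omega> * Yinf \<omega> = 0"
    using integral_nonneg_eq_0_iff_AE[OF ig nn] by simp
  then have "prob G \<le> prob {\<omega> \<in> space M. Yinf \<omega> = 0}"
    by (intro finite_measure_mono_AE) (auto simp: indicator_def)
  then show ?thesis using never_drawn_pos[OF sm' x] by (simp add: G_def)
qed

subsection \<open>Convergence to a nonzero value\<close>

definition below :: "(nat \<Rightarrow> real) \<Rightarrow> nat \<Rightarrow> nat \<Rightarrow> 'a set" where
  "below R m n = {\<omega> \<in> space M. \<forall>k\<in>{m..n}. Y k \<omega> < R k}"

lemma below_F: "m \<le> n \<Longrightarrow> below R m n \<in> sets (F n)"
proof -
  have "{\<omega> \<in> space (F n). Y k \<omega> < R k} \<in> sets (F n)" if "k \<in> {m..n}" for k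
  proof -
    have [measurable]: "Y k \<in> borel_measurable (F n)"
      using that by (auto intro: measurable_F_mono[OF _ Y_adapted])
    show ?thesis by measurable
  qed
  then have "{\<omega> \<in> space (F n). \<forall>k\<in>{m..n}. Y k \<omega> < R k} \<in> sets (F n)"
    by (intro sets.sets_Collect_finite_All) auto
  then show ?thesis by (simp add: below_def)
qed

lemma below_sets [measurable]: "below R m n \<in> sets M"
  unfolding below_def by measurable

text \<open>An upward move, which has weight a y, lowers y (1 / y) by g (1 - y) / (y + g (1 - y));
  enlarging this denominator to y + g leaves a usable gain. A downward move multiplies 1 / y by 1 /
  (1 - g), which is why the growth rate is b g / (1 - g) instead of b g.\<close>

lemma gen_inverse_le:
  assumes y: "0 < y" "y \<le> 1"
  shows "gen n inverse y \<le> (1 + b * g n / (1 - g n)) / y - a * g n * (1 - y) / (y + g n)"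
proof -
  have g: "0 < g n" "g n < 1" by (rule g_range)+
  have p: "0 < y + g n * (1 - y)" "y + g n * (1 - y) \<le> y + g n"
    using y g by (auto intro: add_pos_nonneg simp: mult_left_le)
  have "y * (inverse (y + g n * (1 - y)) - inverse y) = - (g n * (1 - y) / (y + g n * (1 - y)))"
  proof -
    have "y * (inverse (y + d) - inverse y) = - (d / (y + d))" if "0 < y + d" for d
    proof -
      have "y * (inverse (y + d) - inverse y) = y * inverse (y + d) - 1"
        using y by (simp add: right_diff_distrib)
      also have "\<dots> = - (d / (y + d))" using that by (simp add: field_simps)
      finally show ?thesis .
    qed
    then show ?thesis using p(1) by blast
  qed
  also have "\<dots> \<le> - (g n * (1 - y) / (y + g n))"
    using y g p by (simp add: frac_le)
  finally have 1: "a * (y * (inverse (y + g n * (1 - y)) - inverse y)) \<le> a * (- (g n * (1 - y) / (y + g n)))"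
    using a_range by (intro mult_left_mono) auto
  have "inverse (y - g n * y) - inverse y = inverse y * (g n / (1 - g n))"
  proof -
    have "y - g n * y = y * (1 - g n)" by algebra
    then show ?thesis using y g by (simp add: field_simps)
  qed
  moreover have "(1 - y) * (inverse y * (g n / (1 - g n))) \<le> 1 * (inverse y * (g n / (1 - g n)))"
    using y g by (intro mult_right_mono) auto
  ultimately have 2: "b * ((1 - y) * (inverse (y - g n * y) - inverse y)) \<le> b * (inverse y * (g n / (1 - g n)))"
    using b_range by (intro mult_left_mono) auto
  have "gen n inverse y = inverse y + a * (y * (inverse (y + g n * (1 - y)) - inverse y))
      + b * ((1 - y) * (inverse (y - g n * y) - inverse y))"
    unfolding gen_def by simp
  also have "\<dots> \<le> inverse y + a * (- (g n * (1 - y) / (y + g n))) + b * (inverse y * (g n / (1 - g n)))"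
    using 1 2 by linarith
  also have "\<dots> = (1 + b * g n / (1 - g n)) / y - a * g n * (1 - y) / (y + g n)"
    using y g by (simp add: divide_inverse algebra_simps)
  finally show ?thesis .
qed

text \<open>The weight \<open>\<theta>\<close> compensates the growth of the mean of \<open>1 / Y n\<close> caused by downward moves,
  so that \<open>\<theta> n / Y n\<close> becomes a supermartingale; staying below \<open>R\<close> forever would use up
  a divergent amount of it.\<close>

lemma not_below_forever:
  assumes a: "0 < a" and x: "0 < x" and mn: "\<And>n. m \<le> n \<Longrightarrow> R n \<le> 1 / 2"
    and \<theta>: "\<And>n. \<theta> n = exp (- b * (\<Sum>k<n. g k / (1 - g k)))"
    and \<delta>: "0 < \<delta>" and bd: "\<And>n. m \<le> n \<Longrightarrow> \<delta> / (\<Sum>k<Suc n. g k) \<le> \<theta> (Suc n) / (R n + g n)"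
  shows "prob {\<omega> \<in> space M. \<forall>k\<ge>m. Y k \<omega> < R k} = 0"
proof -
  let ?T = "{\<omega> \<in> space M. \<forall>k\<ge>m. Y k \<omega> < R k}"
  let ?q = "prob ?T"
  \<comment> \<open>A deterministic positive lower bound at each time: it keeps the inverse of
    \<open>Y n\<close> bounded, hence integrable, and supplies the cut-off \<open>l\<close> of
    \<open>step\<close>.\<close>
  define lo where "lo n = x * (\<Prod>k<n. 1 - g k)" for n
  have lo: "0 < lo n" "lo n \<le> Y n \<omega>" and Ypos: "0 < Y n \<omega>" for n \<omega>
    unfolding lo_def using Y_pos[OF x] by auto
  have \<theta>pos: "0 < \<theta> n" for n by (simp add: \<theta>)
  have \<theta>Suc: "\<theta> (Suc n) * (1 + b * g n / (1 - g n)) \<le> \<theta> n" for n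
  proof -
    have "\<theta> (Suc n) * (1 + b * g n / (1 - g n)) \<le> \<theta> (Suc n) * exp (b * g n / (1 - g n))"
      using \<theta>pos[of "Suc n"] by (intro mult_left_mono exp_ge_add_one_self) auto
    also have "\<dots> = \<theta> n" by (simp add: \<theta> exp_add[symmetric] algebra_simps)
    finally show ?thesis .
  qed
  let ?v = "\<lambda>n. \<integral>\<omega>. indicator (below R m n) \<omega> * (\<theta> n * inverse (Y n \<omega>)) \<partial>M"
  have invb: "\<bar>\<theta> n * inverse (Y k \<omega>)\<bar> \<le> \<theta> n / lo k" for k n \<omega>
    using \<theta>pos[of n] lo[of k] Ypos[of k \<omega>] by (simp add: abs_mult divide_inverse le_imp_inverse_le)
  have int: "integrable M (\<lambda>\<omega>. indicator (below R m n) \<omega> * (\<theta> k * inverse (Y j \<omega>)))" for n k j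
    using invb[of k j] less_imp_le[OF divide_pos_pos[OF \<theta>pos lo(1)], of k j]
    by (intro integrable_bounded[of _ "\<theta> k / lo j"]) (auto simp: indicator_def)
  have step1: "?v (Suc n) + a * \<delta> * ?q / 2 * (g n / (\<Sum>k<Suc n. g k)) \<le> ?v n" if n: "m \<le> n" for n
  proof -
    have [measurable]: "below R m n \<in> sets (F n)" by (rule below_F[OF n])
    let ?d = "a * \<delta> / 2 * (g n / (\<Sum>k<Suc n. g k))"
    have Gpos: "0 < (\<Sum>k<Suc n. g k)" using g_range by (intro sum_pos) auto
    have binv: "\<bar>inverse y\<bar> \<le> inverse (lo (Suc n))" if "lo (Suc n) \<le> y" for y
      using that lo(1)[of "Suc n"] by (simp add: le_imp_inverse_le)
    have lo_Suc: "lo (Suc n) \<le> (1 - g n) * Y n \<omega>" for \<omega>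
      using mult_left_mono[OF lo(2)[of n \<omega>], of "1 - g n"] by (simp add: lo_def mult_ac)
    have ind: "integrable M (\<lambda>\<omega>. indicator (below R m n) \<omega> :: real)"
      by (rule integrable_bounded[of _ 1]) (auto simp: indicator_def)
    have d0: "0 \<le> ?d" using a \<delta> Gpos by simp
    \<comment> \<open>Replacing the event up to \<open>Suc n\<close> by the one up to
      \<open>n\<close> only enlarges the integral of a nonnegative function, and it makes the weight
      measurable with respect to \<open>F n\<close>.\<close>
    have "?v (Suc n) \<le> (\<integral>\<omega>. indicator (below R m n) \<omega> * (\<theta> (Suc n) * inverse (Y (Suc n) \<omega>)) \<partial>M)"
      using \<theta>pos Ypos by (intro integral_mono int) (auto simp: indicator_def below_def less_imp_le)
    also have "\<dots> = (\<integral>\<omega>. (\<theta> (Suc n) * indicator (below R m n) \<omega>) * inverse (Y (Suc n) \<omega>) \<partial>M)"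
      by (simp add: mult_ac)
    also have "\<dots> = (\<integral>\<omega>. (\<theta> (Suc n) * indicator (below R m n) \<omega>) * gen n inverse (Y n \<omega>) \<partial>M)"
      by (rule step[where k = "\<theta> (Suc n)", OF _ _ _ binv lo_Suc])
        (use \<theta>pos[of "Suc n"] in \<open>auto simp: indicator_def\<close>)
    also have "\<dots> \<le> (\<integral>\<omega>. indicator (below R m n) \<omega> * (\<theta> n * inverse (Y n \<omega>)) - ?d * indicator (below R m n) \<omega> \<partial>M)"
    proof (rule integral_mono)
      show "integrable M (\<lambda>\<omega>. indicator (below R m n) \<omega> * (\<theta> n * inverse (Y n \<omega>)) - ?d * indicator (below R m n) \<omega>)"
        by (intro Bochner_Integration.integrable_diff int integrable_mult_right ind)
      show "integrable M (\<lambda>\<omega>. (\<theta> (Suc n) * indicator (below R m n) \<omega>) * gen n inverse (Y n \<omega>))"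
      proof (rule integrable_bounded)
        fix \<omega>
        have "\<bar>gen n inverse (Y n \<omega>)\<bar> \<le> 5 * inverse (lo (Suc n))"
          by (rule gen_bounded[OF binv Y_ge_0 Y_le_1 lo_Suc])
        then show "\<bar>(\<theta> (Suc n) * indicator (below R m n) \<omega>) * gen n inverse (Y n \<omega>)\<bar> \<le> \<theta> (Suc n) * (5 * inverse (lo (Suc n)))"
          using \<theta>pos[of "Suc n"] lo(1)[of "Suc n"] by (auto simp: abs_mult indicator_def intro!: mult_left_mono)
      qed measurable
      fix \<omega> assume "\<omega> \<in> space M"
      show "(\<theta> (Suc n) * indicator (below R m n) \<omega>) * gen n inverse (Y n \<omega>)
        \<le> indicator (below R m n) \<omega> * (\<theta> n * inverse (Y n \<omega>)) - ?d * indicator (below R m n) \<omega>"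
      proof (cases "\<omega> \<in> below R m n")
        case True
        let ?y = "Y n \<omega>"
        have y: "?y < R n" using True n by (auto simp: below_def)
        have pos: "0 < ?y + g n" "0 < R n + g n" using Ypos[of n \<omega>] g_range(1)[of n] y by linarith+
        have "\<theta> (Suc n) * gen n inverse ?y \<le>
           \<theta> (Suc n) * ((1 + b * g n / (1 - g n)) / ?y - a * g n * (1 - ?y) / (?y + g n))"
          using \<theta>pos[of "Suc n"] by (intro mult_left_mono gen_inverse_le Ypos) auto
        also have "\<dots> = \<theta> (Suc n) * (1 + b * g n / (1 - g n)) / ?y - (a * g n) * ((1 - ?y) * (\<theta> (Suc n) / (?y + g n)))"
          by (simp add: algebra_simps)
        also have "\<dots> \<le> \<theta> n / ?y - (a * g n) * (1 / 2 * (\<delta> / (\<Sum>k<Suc n. g k)))"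
        proof (rule diff_mono)
          show "\<theta> (Suc n) * (1 + b * g n / (1 - g n)) / ?y \<le> \<theta> n / ?y"
            using \<theta>Suc Ypos[of n \<omega>] by (intro divide_right_mono) auto
          \<comment> \<open>Below the threshold 1 - \<open>?y\<close> is at least 1/2, and
            \<open>?y + g n\<close> is less than \<open>R n + g n\<close>, to which the bound
            \<open>bd\<close> refers.\<close>
          have "\<delta> / (\<Sum>k<Suc n. g k) \<le> \<theta> (Suc n) / (R n + g n)" by (rule bd[OF n])
          also have "\<dots> \<le> \<theta> (Suc n) / (?y + g n)"
            using \<theta>pos[of "Suc n"] y pos by (intro divide_left_mono mult_pos_pos) auto
          finally show "(a * g n) * (1 / 2 * (\<delta> / (\<Sum>k<Suc n. g k))) \<le> (a * g n) * ((1 - ?y) * (\<theta> (Suc n) / (?y + g n)))"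
            using a y mn[OF n] \<delta> Gpos by (intro mult_left_mono mult_mono) auto
        qed
        finally show ?thesis using True by (simp add: field_simps)
      qed simp
    qed
    also have "\<dots> = ?v n - ?d * prob (below R m n)"
      by (subst Bochner_Integration.integral_diff[OF int integrable_mult_right[OF ind]]) simp
    \<comment> \<open>Staying below forever is contained in every \<open>below R m n\<close>, so
      each step loses at least a fixed multiple of
      \<open>g n / (\<Sum>k<Suc n. g k)\<close>.\<close>
    also have "\<dots> \<le> ?v n - ?d * ?q"
      using d0 by (intro diff_left_mono mult_left_mono finite_measure_mono) (auto simp: below_def)
    finally show ?thesis by (simp add: mult_ac)
  qed
  have sumb: "a * \<delta> * ?q / 2 * (\<Sum>k=m..<m+n. g k / (\<Sum>i<Suc k. g i)) \<le> ?v m - ?v (m + n)" for n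
  proof (induction n)
    case (Suc n)
    then show ?case using step1[of "m + n"] by (simp add: distrib_left del: sum.lessThan_Suc)
  qed simp
  have v0: "0 \<le> ?v n" for n
    using \<theta>pos Ypos by (intro integral_nonneg_AE AE_I2) (simp add: less_imp_le)
  show "?q = 0"
  proof (rule ccontr)
    assume "?q \<noteq> 0"
    then have q: "0 < a * \<delta> * ?q / 2" using a \<delta> by (simp add: zero_less_measure_iff)
    have "summable (\<lambda>n. g (n + m) / (\<Sum>i<Suc (n + m). g i))"
    proof (rule summableI_nonneg_bounded)
      show "0 \<le> g (n + m) / (\<Sum>i<Suc (n + m). g i)" for n
        by (intro divide_nonneg_nonneg sum_nonneg) auto
      fix n
      have "(\<Sum>k=m..<m+n. g k / (\<Sum>i<Suc k. g i)) = (\<Sum>k<n. g (k + m) / (\<Sum>i<Suc (k + m). g i))"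
        using sum.shift_bounds_nat_ivl[of "\<lambda>k. g k / (\<Sum>i<Suc k. g i)" 0 m n]
        by (simp add: lessThan_atLeast0 add.commute)
      then have "a * \<delta> * ?q / 2 * (\<Sum>k<n. g (k + m) / (\<Sum>i<Suc (k + m). g i)) \<le> ?v m"
        using sumb[of n] v0[of "m + n"] by simp
      then show "(\<Sum>k<n. g (k + m) / (\<Sum>i<Suc (k + m). g i)) \<le> ?v m / (a * \<delta> * ?q / 2)"
        using q by (subst pos_le_divide_eq) (simp_all add: mult.commute)
    qed
    then have "summable (\<lambda>n. g n / (\<Sum>i<Suc n. g i))"
      by (subst (asm) summable_iff_shift)
    then show False using not_summable_div_partial_sum[OF g_range(1) g_diverges] by simp
  qed
qed

text \<open>The function y \<mapsto> R / (R + y) decreases and b \<le> a makes the drift point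
  upwards, so to first order its mean cannot grow. What remains is the discrepancy between the
  denominators \<open>q\<close> and \<open>p\<close> after a downward and an upward move: p - q = g
  contributes a second factor g, and both denominators are at least R.\<close>

lemma gen_ratio_le:
  assumes ba: "b \<le> a" and R: "0 < R" and y: "0 \<le> y" "y \<le> 1"
  shows "gen k (\<lambda>y. R / (R + y)) y \<le> R / (R + y) + (g k)\<^sup>2 / R"
proof -
  define s p q where "s = R + y" and "p = R + (y + g k * (1 - y))" and "q = R + (y - g k * y)"
  have pq: "R \<le> p" "R \<le> q" "p - q = g k" "0 < s" "y \<le> s"
    using up_range[OF y, of k] R y unfolding p_def q_def s_def by (auto simp: algebra_simps)
  then have pos: "0 < p" "0 < q" using R by linarith+
  have "R / p - R / s = - (R * g k * (1 - y) / (s * p))"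
    "R / q - R / s = R * g k * y / (s * q)"
  proof -
    have "R / p - R / s = R * (s - p) / (s * p)" "R / q - R / s = R * (s - q) / (s * q)"
      using pos pq by (simp_all add: diff_frac_eq algebra_simps)
    moreover have "s - p = - (g k * (1 - y))" "s - q = g k * y"
      by (simp_all add: s_def p_def q_def)
    ultimately show "R / p - R / s = - (R * g k * (1 - y) / (s * p))"
      "R / q - R / s = R * g k * y / (s * q)" by simp_all
  qed
  then have "gen k (\<lambda>y. R / (R + y)) y = R / s + a * y * (- (R * g k * (1 - y) / (s * p)))
      + b * (1 - y) * (R * g k * y / (s * q))"
    unfolding gen_def s_def p_def q_def by metis
  also have "\<dots> = R / s + (R * g k * (1 - y) * (y / s)) * (b / q - a / p)"
    by (simp add: divide_inverse algebra_simps)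
  also have "\<dots> \<le> R / s + (R * g k * (1 - y) * (y / s)) * (b / q - b / p)"
  proof -
    have "b / p \<le> a / p" using ba pos by (simp add: divide_right_mono)
    then show ?thesis using R y pq by (intro add_left_mono mult_left_mono) auto
  qed
  also have "b / q - b / p = b * g k / (p * q)"
    using pos pq(3) by (simp add: diff_frac_eq right_diff_distrib[symmetric] mult.commute)
  also have "(R * g k * (1 - y) * (y / s)) * (b * g k / (p * q)) =
      (R * (g k)\<^sup>2) * (((1 - y) * (y / s) * b) / (p * q))"
    by (simp add: power2_eq_square)
  also have "\<dots> \<le> (R * (g k)\<^sup>2) * (1 / (R * R))"
  proof (intro mult_left_mono frac_le mult_mono)
    show "(1 - y) * (y / s) * b \<le> 1"
      using y pq b_range R by (intro mult_le_one mult_nonneg_nonneg) auto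
  qed (use pq R pos in auto)
  also have "\<dots> = (g k)\<^sup>2 / R" using R by (simp add: power2_eq_square)
  finally show ?thesis by (simp add: s_def)
qed

text \<open>R / (R + y) is 1 at y = 0 and at most 1/2 for y \<ge> R. Under the weight
  \<open>Z\<close> it thus starts at most at 1/2, and it gains at most 1 / R times a tail of squared
  steps, that is 1/4. In the limit it dominates the indicator of 0, hence 1/2 + 1/4 = 3/4.\<close>

lemma prob_0_above_threshold:
  fixes Z :: "'a \<Rightarrow> real"
  assumes ba: "b \<le> a" and R: "0 < R"
    and Z: "Z \<in> borel_measurable (F n)" "\<And>\<omega>. \<omega> \<in> space M \<Longrightarrow> 0 \<le> Z \<omega> \<and> Z \<omega> \<le> 1"
    and ZR: "\<And>\<omega>. \<omega> \<in> space M \<Longrightarrow> Z \<omega> \<noteq> 0 \<Longrightarrow> R \<le> Y n \<omega>"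
    and tail: "\<And>k. (\<Sum>j=n..<n+k. (g j)\<^sup>2) \<le> R / 4"
  shows "(\<integral>\<omega>. Z \<omega> * indicator {0} (Yinf \<omega>) \<partial>M) \<le> 3 / 4 * (\<integral>\<omega>. Z \<omega> \<partial>M)"
proof -
  let ?u = "\<lambda>y. R / (R + y)"
  have ZM [measurable]: "Z \<in> borel_measurable M" by (rule measurable_F_M[OF Z(1)])
  have iZ: "integrable M Z" using Z by (intro integrable_bounded[of _ 1]) auto
  have EZ: "0 \<le> (\<integral>\<omega>. Z \<omega> \<partial>M)" using Z by (intro integral_nonneg_AE) auto
  have u: "0 \<le> ?u y" "?u y \<le> 1" if "0 \<le> y" for y using that R by auto
  have ub: "\<bar>?u y\<bar> \<le> 1" if "0 \<le> y" for y
    using u[OF that] by (simp only: abs_of_nonneg)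
  have Zu: "\<bar>Z \<omega> * v\<bar> \<le> 1" if "\<omega> \<in> space M" "0 \<le> v" "v \<le> 1" for \<omega> v
    using Z(2)[OF that(1)] that by (auto simp: abs_mult intro!: mult_le_one)
  have iu: "integrable M (\<lambda>\<omega>. Z \<omega> * ?u (Y k \<omega>))" for k
  proof (rule integrable_bounded[of _ 1])
    show "\<bar>Z \<omega> * ?u (Y k \<omega>)\<bar> \<le> 1" if "\<omega> \<in> space M" for \<omega>
      by (rule Zu[OF that u[OF Y_ge_0]])
  qed measurable
  have one: "(\<integral>\<omega>. Z \<omega> * ?u (Y (Suc k) \<omega>) \<partial>M) \<le> (\<integral>\<omega>. Z \<omega> * ?u (Y k \<omega>) \<partial>M) + (g k)\<^sup>2 / R * (\<integral>\<omega>. Z \<omega> \<partial>M)"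
    if k: "n \<le> k" for k
  proof -
    have "(\<integral>\<omega>. Z \<omega> * ?u (Y (Suc k) \<omega>) \<partial>M) = (\<integral>\<omega>. Z \<omega> * gen k ?u (Y k \<omega>) \<partial>M)"
    proof (rule step[where k = 1 and l = 0 and c = 1])
      show "\<bar>?u y\<bar> \<le> 1" if "0 \<le> y" for y by (rule ub[OF that])
    qed (use measurable_F_mono[OF k Z(1)] Z(2) in auto)
    also have "\<dots> \<le> (\<integral>\<omega>. Z \<omega> * ?u (Y k \<omega>) + (g k)\<^sup>2 / R * Z \<omega> \<partial>M)"
    proof (rule integral_mono)
      show "integrable M (\<lambda>\<omega>. Z \<omega> * ?u (Y k \<omega>) + (g k)\<^sup>2 / R * Z \<omega>)"
        using iu iZ by simp
      show "Z \<omega> * gen k ?u (Y k \<omega>) \<le> Z \<omega> * ?u (Y k \<omega>) + (g k)\<^sup>2 / R * Z \<omega>" if "\<omega> \<in> space M" for \<omega>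
        using mult_left_mono[OF gen_ratio_le[OF ba R Y_ge_0 Y_le_1], of "Z \<omega>" k k \<omega>] Z(2)[OF that]
        by (simp add: algebra_simps)
      show "integrable M (\<lambda>\<omega>. Z \<omega> * gen k ?u (Y k \<omega>))"
      proof (rule integrable_bounded[of _ 5])
        fix \<omega> assume w: "\<omega> \<in> space M"
        have "\<bar>gen k ?u (Y k \<omega>)\<bar> \<le> 5 * 1"
          by (rule gen_bounded[of 0]) (use ub up_range(5)[OF Y_ge_0 Y_le_1] in auto)
        then show "\<bar>Z \<omega> * gen k ?u (Y k \<omega>)\<bar> \<le> 5"
          using abs_mult_le_left[of "gen k ?u (Y k \<omega>)" 5 "Z \<omega>"] Z(2)[OF w] by (simp add: mult.commute)
      qed measurable
    qed
    also have "\<dots> = (\<integral>\<omega>. Z \<omega> * ?u (Y k \<omega>) \<partial>M) + (g k)\<^sup>2 / R * (\<integral>\<omega>. Z \<omega> \<partial>M)"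
      using iu iZ by simp
    finally show ?thesis .
  qed
  have sum: "(\<integral>\<omega>. Z \<omega> * ?u (Y (n + k) \<omega>) \<partial>M) \<le>
      (\<integral>\<omega>. Z \<omega> * ?u (Y n \<omega>) \<partial>M) + (\<Sum>j=n..<n+k. (g j)\<^sup>2) / R * (\<integral>\<omega>. Z \<omega> \<partial>M)" for k
  proof (induction k)
    case (Suc k)
    then show ?case using one[of "n + k"] by (simp add: add_divide_distrib distrib_right)
  qed simp
  have "(\<integral>\<omega>. Z \<omega> * ?u (Y n \<omega>) \<partial>M) \<le> (\<integral>\<omega>. 1 / 2 * Z \<omega> \<partial>M)"
  proof (rule integral_mono[OF iu])
    fix \<omega> assume w: "\<omega> \<in> space M"
    show "Z \<omega> * ?u (Y n \<omega>) \<le> 1 / 2 * Z \<omega>"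
    proof (cases "Z \<omega> = 0")
      case False
      then have "?u (Y n \<omega>) \<le> 1 / 2" using ZR[OF w] R by (simp add: field_simps)
      then show ?thesis using mult_left_mono[of "?u (Y n \<omega>)" "1 / 2" "Z \<omega>"] Z(2)[OF w] by simp
    qed simp
  qed (use iZ in simp)
  then have half: "(\<integral>\<omega>. Z \<omega> * ?u (Y n \<omega>) \<partial>M) \<le> 1 / 2 * (\<integral>\<omega>. Z \<omega> \<partial>M)" by simp
  have "(\<integral>\<omega>. Z \<omega> * ?u (Y (n + k) \<omega>) \<partial>M) \<le> 3 / 4 * (\<integral>\<omega>. Z \<omega> \<partial>M)" for k
  proof -
    have "(\<Sum>j=n..<n+k. (g j)\<^sup>2) / R \<le> 1 / 4" using tail[of k] R by (simp add: field_simps)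
    then have "(\<Sum>j=n..<n+k. (g j)\<^sup>2) / R * (\<integral>\<omega>. Z \<omega> \<partial>M) \<le> 1 / 4 * (\<integral>\<omega>. Z \<omega> \<partial>M)"
      by (rule mult_right_mono[OF _ EZ])
    then show ?thesis using sum[of k] half by linarith
  qed
  moreover have "(\<lambda>k. \<integral>\<omega>. Z \<omega> * ?u (Y (n + k) \<omega>) \<partial>M) \<longlonglongrightarrow> (\<integral>\<omega>. Z \<omega> * ?u (Yinf \<omega>) \<partial>M)"
  proof -
    have "(\<lambda>k. \<integral>\<omega>. Z \<omega> * ?u (Y k \<omega>) \<partial>M) \<longlonglongrightarrow> (\<integral>\<omega>. Z \<omega> * ?u (Yinf \<omega>) \<partial>M)"
    proof (rule limit_integral[of _ 1 _ 1])
      show "continuous_on {0..1} ?u" by (intro continuous_intros) (use R in auto)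
      show "\<bar>?u y\<bar> \<le> 1" if "y \<in> {0..1}" for y by (rule ub) (use that in simp)
    qed (use Z in auto)
    then show ?thesis using LIMSEQ_ignore_initial_segment[of _ _ n] by (simp add: add.commute)
  qed
  ultimately have "(\<integral>\<omega>. Z \<omega> * ?u (Yinf \<omega>) \<partial>M) \<le> 3 / 4 * (\<integral>\<omega>. Z \<omega> \<partial>M)"
    by (intro LIMSEQ_le_const2[of "\<lambda>k. \<integral>\<omega>. Z \<omega> * ?u (Y (n + k) \<omega>) \<partial>M"]) auto
  moreover have "(\<integral>\<omega>. Z \<omega> * indicator {0} (Yinf \<omega>) \<partial>M) \<le> (\<integral>\<omega>. Z \<omega> * ?u (Yinf \<omega>) \<partial>M)"
  proof (rule integral_mono_AE)
    show "integrable M (\<lambda>\<omega>. Z \<omega> * indicator {0} (Yinf \<omega>))"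
      using Zu by (intro integrable_bounded[of _ 1]) (auto simp: indicator_def)
    show "integrable M (\<lambda>\<omega>. Z \<omega> * ?u (Yinf \<omega>))"
    proof (rule integrable_const_bound[of _ 1])
      show "AE \<omega> in M. norm (Z \<omega> * ?u (Yinf \<omega>)) \<le> 1"
        using Yinf_range AE_space
      proof eventually_elim
        case (elim \<omega>)
        then show ?case using Zu[of \<omega> "?u (Yinf \<omega>)"] u[of "Yinf \<omega>"] by simp
      qed
    qed measurable
    show "AE \<omega> in M. Z \<omega> * indicator {0} (Yinf \<omega>) \<le> Z \<omega> * ?u (Yinf \<omega>)"
      using Yinf_range AE_space
    proof eventually_elim
      case (elim \<omega>)
      have "indicator {0} (Yinf \<omega>) \<le> ?u (Yinf \<omega>)"
        using elim R u[of "Yinf \<omega>"] by (auto simp: indicator_def)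
      then show ?case using Z(2) elim by (intro mult_left_mono) auto
    qed
  qed
  ultimately show ?thesis by linarith
qed

text \<open>Decomposing according to the first time at which the process is above the threshold.\<close>

lemma prob_0_after_hitting:
  fixes Z :: "'a \<Rightarrow> real"
  assumes ba: "b \<le> a" and R: "\<And>n. 0 < R n"
    and Z: "Z \<in> borel_measurable (F m)" "\<And>\<omega>. \<omega> \<in> space M \<Longrightarrow> 0 \<le> Z \<omega> \<and> Z \<omega> \<le> 1"
    and tail: "\<And>n k. m \<le> n \<Longrightarrow> (\<Sum>j=n..<n+k. (g j)\<^sup>2) \<le> R n / 4"
    and hit: "prob {\<omega> \<in> space M. \<forall>k\<ge>m. Y k \<omega> < R k} = 0"
  shows "(\<integral>\<omega>. Z \<omega> * indicator {0} (Yinf \<omega>) \<partial>M) \<le> 3 / 4 * (\<integral>\<omega>. Z \<omega> \<partial>M)"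
proof -
  let ?B = "\<lambda>k. below R m (m + k)"
  let ?E = "\<lambda>\<omega>. indicator {0} (Yinf \<omega>) :: real"
  have [measurable]: "Z \<in> borel_measurable M" by (rule measurable_F_M[OF Z(1)])
  have ZF: "Z \<in> borel_measurable (F (m + k))" for k by (rule measurable_F_mono[OF _ Z(1)]) simp
  have BF: "?B k \<in> sets (F (m + k))" for k by (rule below_F) simp
  have BFS: "?B k \<in> sets (F (m + Suc k))" for k using BF[of k] F_mono[of "m + k"] by auto
  have Bsub: "?B (Suc k) \<subseteq> ?B k" for k by (auto simp: below_def)
  have i: "integrable M (\<lambda>\<omega>. Z \<omega> * w \<omega>)"
    if [measurable]: "w \<in> borel_measurable M" and "\<And>\<omega>. \<omega> \<in> space M \<Longrightarrow> 0 \<le> w \<omega> \<and> w \<omega> \<le> 1" for w :: "'a \<Rightarrow> real"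
    using that(2) Z(2) by (intro integrable_bounded[of _ 1]) (auto simp: abs_mult intro!: mult_le_one)
  have ib: "integrable M (\<lambda>\<omega>. indicator (?B k) \<omega> :: real)" for k
    by (rule integrable_bounded[of _ 1]) (auto simp: indicator_def)
  have iE: "integrable M (\<lambda>\<omega>. Z \<omega> * ?E \<omega>)" by (rule i) (auto simp: indicator_def)
  have iBE: "integrable M (\<lambda>\<omega>. Z \<omega> * ((1 - indicator (?B k) \<omega>) * ?E \<omega>))" for k
    by (rule i) (auto simp: indicator_def)
  have claim: "(\<integral>\<omega>. Z \<omega> * ((1 - indicator (?B k) \<omega>) * ?E \<omega>) \<partial>M) \<le> 3 / 4 * (\<integral>\<omega>. Z \<omega> * (1 - indicator (?B k) \<omega>) \<partial>M)" for k
  proof (induction k)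
    case 0
    have "(\<integral>\<omega>. (Z \<omega> * (1 - indicator (?B 0) \<omega>)) * ?E \<omega> \<partial>M) \<le> 3 / 4 * (\<integral>\<omega>. Z \<omega> * (1 - indicator (?B 0) \<omega>) \<partial>M)"
    proof (rule prob_0_above_threshold[OF ba R[of m]])
      show "(\<lambda>\<omega>. Z \<omega> * (1 - indicator (?B 0) \<omega>)) \<in> borel_measurable (F m)"
      proof -
        have [measurable]: "below R m m \<in> sets (F m)" using BF[of 0] by simp
        show ?thesis unfolding add_0_right using Z(1) by measurable
      qed
    qed (use Z(2) tail in \<open>auto simp: below_def indicator_def not_less split: if_splits\<close>)
    then show ?case by (simp add: mult.assoc)
  next
    case (Suc k)
    \<comment> \<open>\<open>?w\<close> marks the paths for which \<open>m + Suc k\<close> is the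
      first time from \<open>m\<close> on at which Y is at or above R.\<close>
    let ?w = "\<lambda>\<omega>. indicator (?B k) \<omega> - indicator (?B (Suc k)) \<omega> :: real"
    have w: "0 \<le> ?w \<omega> \<and> ?w \<omega> \<le> 1" for \<omega> using Bsub[of k] by (auto simp: indicator_def)
    have "(\<integral>\<omega>. (Z \<omega> * ?w \<omega>) * ?E \<omega> \<partial>M) \<le> 3 / 4 * (\<integral>\<omega>. Z \<omega> * ?w \<omega> \<partial>M)"
    proof (rule prob_0_above_threshold[OF ba R[of "m + Suc k"]])
      show "(\<lambda>\<omega>. Z \<omega> * ?w \<omega>) \<in> borel_measurable (F (m + Suc k))"
        using ZF[of "Suc k"] BF[of "Suc k"] BFS[of k] by measurable
      show "0 \<le> Z \<omega> * ?w \<omega> \<and> Z \<omega> * ?w \<omega> \<le> 1" if "\<omega> \<in> space M" for \<omega>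
        using w[of \<omega>] Z(2)[OF that] by (auto intro!: mult_le_one mult_nonneg_nonneg)
      show "R (m + Suc k) \<le> Y (m + Suc k) \<omega>" if "\<omega> \<in> space M" "Z \<omega> * ?w \<omega> \<noteq> 0" for \<omega>
      proof -
        have "\<omega> \<in> ?B k \<and> \<omega> \<notin> ?B (Suc k)"
          using that(2) Bsub[of k] by (cases "\<omega> \<in> ?B k"; cases "\<omega> \<in> ?B (Suc k)") auto
        then show ?thesis by (force simp: below_def not_less le_Suc_eq)
      qed
      show "(\<Sum>j=m + Suc k..<m + Suc k + i. (g j)\<^sup>2) \<le> R (m + Suc k) / 4" for i
        by (rule tail) simp
    qed
    then have s: "(\<integral>\<omega>. Z \<omega> * (?w \<omega> * ?E \<omega>) \<partial>M) \<le> 3 / 4 * (\<integral>\<omega>. Z \<omega> * ?w \<omega> \<partial>M)"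
      by (simp add: mult.assoc)
    have "(\<integral>\<omega>. Z \<omega> * ((1 - indicator (?B (Suc k)) \<omega>) * ?E \<omega>) \<partial>M) =
       (\<integral>\<omega>. Z \<omega> * ((1 - indicator (?B k) \<omega>) * ?E \<omega>) + Z \<omega> * (?w \<omega> * ?E \<omega>) \<partial>M)"
      by (rule Bochner_Integration.integral_cong[OF refl]) (simp add: algebra_simps)
    also have "\<dots> = (\<integral>\<omega>. Z \<omega> * ((1 - indicator (?B k) \<omega>) * ?E \<omega>) \<partial>M) + (\<integral>\<omega>. Z \<omega> * (?w \<omega> * ?E \<omega>) \<partial>M)"
      using w by (intro Bochner_Integration.integral_add i) (auto intro!: mult_le_one simp: indicator_def)
    also have "\<dots> \<le> 3 / 4 * (\<integral>\<omega>. Z \<omega> * (1 - indicator (?B k) \<omega>) \<partial>M) + 3 / 4 * (\<integral>\<omega>. Z \<omega> * ?w \<omega> \<partial>M)"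
      by (rule add_mono[OF Suc s])
    also have "\<dots> = 3 / 4 * (\<integral>\<omega>. Z \<omega> * (1 - indicator (?B k) \<omega>) + Z \<omega> * ?w \<omega> \<partial>M)"
      using w by (subst Bochner_Integration.integral_add) (auto intro!: i simp: indicator_def)
    also have "(\<integral>\<omega>. Z \<omega> * (1 - indicator (?B k) \<omega>) + Z \<omega> * ?w \<omega> \<partial>M) = (\<integral>\<omega>. Z \<omega> * (1 - indicator (?B (Suc k)) \<omega>) \<partial>M)"
      by (rule Bochner_Integration.integral_cong[OF refl]) (simp add: algebra_simps)
    finally show ?case .
  qed
  \<comment> \<open>Paths that have not yet reached the threshold contribute at most their
    probability, which tends to 0 by \<open>hit\<close>.\<close>
  have "(\<integral>\<omega>. Z \<omega> * ?E \<omega> \<partial>M) \<le> 3 / 4 * (\<integral>\<omega>. Z \<omega> \<partial>M) + prob (?B k)" for k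
  proof -
    have "(\<integral>\<omega>. Z \<omega> * ?E \<omega> \<partial>M) \<le> (\<integral>\<omega>. Z \<omega> * ((1 - indicator (?B k) \<omega>) * ?E \<omega>) + indicator (?B k) \<omega> \<partial>M)"
      using Z(2) by (intro integral_mono Bochner_Integration.integrable_add iE iBE ib) (auto simp: indicator_def)
    also have "\<dots> = (\<integral>\<omega>. Z \<omega> * ((1 - indicator (?B k) \<omega>) * ?E \<omega>) \<partial>M) + prob (?B k)"
      by (subst Bochner_Integration.integral_add[OF iBE ib]) simp
    also have "\<dots> \<le> 3 / 4 * (\<integral>\<omega>. Z \<omega> * (1 - indicator (?B k) \<omega>) \<partial>M) + prob (?B k)"
      using claim[of k] by simp
    also have "(\<integral>\<omega>. Z \<omega> * (1 - indicator (?B k) \<omega>) \<partial>M) \<le> (\<integral>\<omega>. Z \<omega> * 1 \<partial>M)"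
      using Z(2) by (intro integral_mono i) (auto simp: indicator_def)
    finally show ?thesis by simp
  qed
  moreover have "(\<lambda>k. 3 / 4 * (\<integral>\<omega>. Z \<omega> \<partial>M) + prob (?B k)) \<longlonglongrightarrow> 3 / 4 * (\<integral>\<omega>. Z \<omega> \<partial>M) + 0"
  proof -
    have "(\<lambda>k. prob (?B k)) \<longlonglongrightarrow> prob (\<Inter>k. ?B k)"
      using Bsub by (intro finite_Lim_measure_decseq decseq_SucI) auto
    moreover have "prob (\<Inter>k. ?B k) \<le> prob {\<omega> \<in> space M. \<forall>k\<ge>m. Y k \<omega> < R k}"
    proof (rule finite_measure_mono)
      show "(\<Inter>k. ?B k) \<subseteq> {\<omega> \<in> space M. \<forall>k\<ge>m. Y k \<omega> < R k}"
      proof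
        fix \<omega> assume w: "\<omega> \<in> (\<Inter>k. ?B k)"
        have "Y k \<omega> < R k" if "m \<le> k" for k
          using w[THEN InterD, OF rangeI[of _ "k - m"]] that by (simp add: below_def)
        then show "\<omega> \<in> {\<omega> \<in> space M. \<forall>k\<ge>m. Y k \<omega> < R k}"
          using w by (auto simp: below_def)
      qed
    qed measurable
    ultimately have "(\<lambda>k. prob (?B k)) \<longlonglongrightarrow> 0"
      using hit measure_nonneg[of M "\<Inter>k. ?B k"] by simp
    then show ?thesis by (intro tendsto_add tendsto_const)
  qed
  ultimately show ?thesis
    using LIMSEQ_le_const[of _ "3 / 4 * (\<integral>\<omega>. Z \<omega> \<partial>M) + 0" "\<integral>\<omega>. Z \<omega> * ?E \<omega> \<partial>M"] by simp
qed

text \<open>Testing the bound against functions of \<open>Y m\<close> that approximate the indicator of 0 gives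
  \<open>P \<le> 3 / 4 * P\<close> for the probability \<open>P\<close> of convergence to 0.\<close>

lemma prob_Yinf_0_null:
  assumes ba: "b \<le> a" and R: "\<And>n. 0 < R n"
    and tail: "\<And>n k. m0 \<le> n \<Longrightarrow> (\<Sum>j=n..<n+k. (g j)\<^sup>2) \<le> R n / 4"
    and hit: "\<And>m. m0 \<le> m \<Longrightarrow> prob {\<omega> \<in> space M. \<forall>k\<ge>m. Y k \<omega> < R k} = 0"
  shows "prob {\<omega> \<in> space M. Yinf \<omega> = 0} = 0"
proof -
  let ?E = "{\<omega> \<in> space M. Yinf \<omega> = 0}"
  have E: "indicator {0} (Yinf \<omega>) = (indicator ?E \<omega> :: real)" if "\<omega> \<in> space M" for \<omega>
    using that by (simp add: indicator_def)
  \<comment> \<open>Here \<open>m\<close> tends to infinity for a fixed \<open>e\<close>. The test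
    function equals 1 at 0, so the left side converges to the probability sought.\<close>
  have e: "prob ?E \<le> 3 / 4 * (\<integral>\<omega>. e / (e + Yinf \<omega>) \<partial>M)" if e: "0 < e" for e
  proof -
    let ?u = "\<lambda>y. e / (e + y)"
    have c: "continuous_on {0..1} ?u" by (intro continuous_intros) (use e in auto)
    have u: "0 \<le> ?u y" "?u y \<le> 1" if "0 \<le> y" for y using that e by auto
    have ub: "\<bar>?u y\<bar> \<le> 1" if "y \<in> {0..1}" for y
      using u[of y] that by (simp only: abs_of_nonneg atLeastAtMost_iff)
    have "(\<lambda>m. \<integral>\<omega>. indicator ?E \<omega> * ?u (Y m \<omega>) \<partial>M) \<longlonglongrightarrow> (\<integral>\<omega>. indicator ?E \<omega> * ?u (Yinf \<omega>) \<partial>M)"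
      by (rule limit_integral[of _ 1 _ 1]; (rule c | erule ub | measurable | simp add: indicator_def))
    moreover have "(\<integral>\<omega>. indicator ?E \<omega> * ?u (Yinf \<omega>) \<partial>M) = (\<integral>\<omega>. indicator ?E \<omega> \<partial>M)"
      by (rule Bochner_Integration.integral_cong[OF refl]) (use e in \<open>auto simp: indicator_def\<close>)
    moreover have "(\<lambda>m. \<integral>\<omega>. 1 * ?u (Y m \<omega>) \<partial>M) \<longlonglongrightarrow> (\<integral>\<omega>. 1 * ?u (Yinf \<omega>) \<partial>M)"
      by (rule limit_integral[of _ 1 _ 1]; (rule c | erule ub | measurable | simp))
    then have "(\<lambda>m. 3 / 4 * (\<integral>\<omega>. 1 * ?u (Y m \<omega>) \<partial>M)) \<longlonglongrightarrow> 3 / 4 * (\<integral>\<omega>. 1 * ?u (Yinf \<omega>) \<partial>M)"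
      by (rule tendsto_mult_left)
    moreover have "(\<integral>\<omega>. indicator ?E \<omega> * ?u (Y m \<omega>) \<partial>M) \<le> 3 / 4 * (\<integral>\<omega>. 1 * ?u (Y m \<omega>) \<partial>M)" if m: "m0 \<le> m" for m
    proof -
      have "(\<integral>\<omega>. ?u (Y m \<omega>) * indicator {0} (Yinf \<omega>) \<partial>M) \<le> 3 / 4 * (\<integral>\<omega>. ?u (Y m \<omega>) \<partial>M)"
      proof (rule prob_0_after_hitting[OF ba R _ _ _ hit[OF m]])
        show "(\<lambda>\<omega>. ?u (Y m \<omega>)) \<in> borel_measurable (F m)"
          using Y_adapted[of m] by measurable
      qed (use u tail m in auto)
      moreover have "(\<integral>\<omega>. ?u (Y m \<omega>) * indicator {0} (Yinf \<omega>) \<partial>M) = (\<integral>\<omega>. indicator ?E \<omega> * ?u (Y m \<omega>) \<partial>M)"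
        by (rule Bochner_Integration.integral_cong[OF refl]) (simp add: E)
      ultimately show ?thesis by simp
    qed
    ultimately have "(\<integral>\<omega>. indicator ?E \<omega> \<partial>M) \<le> 3 / 4 * (\<integral>\<omega>. 1 * ?u (Yinf \<omega>) \<partial>M)"
      by (intro LIMSEQ_le[of "\<lambda>m. \<integral>\<omega>. indicator ?E \<omega> * ?u (Y m \<omega>) \<partial>M" _
           "\<lambda>m. 3 / 4 * (\<integral>\<omega>. 1 * ?u (Y m \<omega>) \<partial>M)"]) auto
    then show ?thesis by simp
  qed
  \<comment> \<open>Now e = 1 / (i + 1) tends to 0, and the test functions tend to the indicator of
    0.\<close>
  have "(\<lambda>i. \<integral>\<omega>. inverse (real (Suc i)) / (inverse (real (Suc i)) + Yinf \<omega>) \<partial>M) \<longlonglongrightarrow> (\<integral>\<omega>. indicator ?E \<omega> \<partial>M)"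
  proof (rule integral_dominated_convergence[where w = "\<lambda>_. 1"])
    show "AE \<omega> in M. (\<lambda>i. inverse (real (Suc i)) / (inverse (real (Suc i)) + Yinf \<omega>)) \<longlonglongrightarrow> indicator ?E \<omega>"
      using Yinf_range AE_space
    proof eventually_elim
      case (elim \<omega>)
      show ?case
      proof (cases "Yinf \<omega> = 0")
        case True
        then show ?thesis using elim by simp
      next
        case False
        have "(\<lambda>i. inverse (real (Suc i)) / (inverse (real (Suc i)) + Yinf \<omega>)) \<longlonglongrightarrow> 0 / (0 + Yinf \<omega>)"
          by (intro tendsto_intros LIMSEQ_inverse_real_of_nat) (use False in auto)
        then show ?thesis using False by simp
      qed
    qed
    show "AE \<omega> in M. norm (inverse (real (Suc i)) / (inverse (real (Suc i)) + Yinf \<omega>)) \<le> 1" for i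
      using Yinf_range
    proof eventually_elim
      case (elim \<omega>)
      have "0 < inverse (real (Suc i))" by simp
      then show ?case using elim by (simp add: divide_le_eq_1 del: inverse_positive_iff_positive)
    qed
  qed auto
  then have "(\<lambda>i. 3 / 4 * (\<integral>\<omega>. inverse (real (Suc i)) / (inverse (real (Suc i)) + Yinf \<omega>) \<partial>M)) \<longlonglongrightarrow>
      3 / 4 * (\<integral>\<omega>. indicator ?E \<omega> \<partial>M)"
    by (rule tendsto_mult_left)
  then have "prob ?E \<le> 3 / 4 * (\<integral>\<omega>. indicator ?E \<omega> \<partial>M)"
    by (rule LIMSEQ_le_const) (use e in auto)
  then show ?thesis using measure_nonneg[of M ?E] by simp
qed

text \<open>Here the growth condition is turned into a threshold. \<open>R\<close> has to dominate
  four times every late tail of \<Sum>g^2, which suggests a tail integral of u exp (- b u). It must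
  also keep R + g of order S exp (- b S) at most, so that \<theta> / (R + g) is at least of order 1
  / S. The integral meets both demands, since beyond 1 / b its factor t / b + 1 / b^2 is at most 2 t
  / b.\<close>

lemma nonzero_limit:
  assumes b: "0 < b" and ba: "b \<le> a" and x: "0 < x"
    and O: "\<forall>\<^sub>F n in sequentially. g n \<le> C * ((\<Sum>k<Suc n. g k) * exp (- b * (\<Sum>k<Suc n. g k)))"
  shows "prob {\<omega> \<in> space M. Yinf \<omega> = 0} = 0"
proof -
  define S where "S n = (\<Sum>k<n. g k)" for n
  \<comment> \<open>\<open>G t\<close> is the integral of u exp (- b u) over all u \<ge> t. The
    maximum in \<open>c\<close> makes the constant positive, and the factor 4 in \<open>R\<close>
    matches the bound R / 4 required of the tails.\<close>
  define G where "G t = (t / b + 1 / b\<^sup>2) * exp (- b * t)" for t :: real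
  define c where "c = max C 1"
  define R where "R n = 4 * c * G (S n)" for n
  have c: "0 < c" by (simp add: c_def)
  have S_Suc: "S (Suc n) = S n + g n" for n by (simp add: S_def)
  have S0: "0 \<le> S n" for n unfolding S_def by (simp add: sum_nonneg)
  have Spos: "0 < S (Suc n)" for n using S0[of n] g_range(1)[of n] by (simp add: S_Suc)
  have S_lim: "filterlim S at_top sequentially"
  proof -
    have inc: "incseq S" by (intro incseq_SucI) (simp add: S_Suc)
    have "\<exists>n. r < S n" for r
    proof (rule ccontr)
      assume "\<nexists>n. r < S n"
      then have "summable g"
        by (intro summableI_nonneg_bounded[of g r]) (auto simp: S_def not_less)
      then show False using g_diverges by simp
    qed
    then show ?thesis
      unfolding filterlim_at_top eventually_sequentially
      by (meson inc incseqD less_imp_le order_trans)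
  qed
  \<comment> \<open>From 1 / b on u exp (- b u) decreases, as \<open>exp_tail_bound\<close>
    requires; 16 c / b^3 is the level of S from which R is at most 1/2.\<close>
  have ev: "\<forall>\<^sub>F n in sequentially. 1 / b \<le> S n \<and> g n \<le> c * (S (Suc n) * exp (- b * S (Suc n))) \<and> 16 * c / b ^ 3 \<le> S n"
    using O filterlim_at_top[THEN iffD1, OF S_lim, rule_format, of "1 / b"]
      filterlim_at_top[THEN iffD1, OF S_lim, rule_format, of "16 * c / b ^ 3"]
  proof eventually_elim
    case (elim n)
    have "C * (S (Suc n) * exp (- b * S (Suc n))) \<le> c * (S (Suc n) * exp (- b * S (Suc n)))"
      using S0[of "Suc n"] by (intro mult_right_mono) (auto simp: c_def)
    then show ?case using elim by (simp add: S_def)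
  qed
  then obtain N where N: "\<And>n. N \<le> n \<Longrightarrow> 1 / b \<le> S n"
    "\<And>n. N \<le> n \<Longrightarrow> g n \<le> c * (S (Suc n) * exp (- b * S (Suc n)))"
    "\<And>n. N \<le> n \<Longrightarrow> 16 * c / b ^ 3 \<le> S n"
    unfolding eventually_sequentially by blast
  have Gpos: "0 < G (S n)" for n
    unfolding G_def using S0[of n] b by (intro mult_pos_pos add_nonneg_pos) auto
  have Rpos: "0 < R n" for n unfolding R_def using c Gpos by simp
  have tail: "(\<Sum>j=n..<n+k. (g j)\<^sup>2) \<le> c * (G (S n) - G (S (n + k)))" if n: "N \<le> n" for n k
  proof (induction k)
    case (Suc k)
    have Nn: "N \<le> n + k" using n by simp
    have "(g (n + k))\<^sup>2 \<le> g (n + k) * (c * (S (Suc (n + k)) * exp (- b * S (Suc (n + k)))))"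
      unfolding power2_eq_square by (intro mult_left_mono N(2)[OF Nn]) simp
    also have "\<dots> = c * ((S (Suc (n + k)) - S (n + k)) * (S (Suc (n + k)) * exp (- b * S (Suc (n + k)))))"
      by (simp add: S_Suc)
    also have "\<dots> \<le> c * (G (S (n + k)) - G (S (Suc (n + k))))"
      unfolding G_def using c by (intro mult_left_mono exp_tail_bound b N(1)[OF Nn]) (auto simp: S_Suc)
    finally show ?case using Suc by (simp add: algebra_simps)
  qed simp
  have tailR: "(\<Sum>j=n..<n+k. (g j)\<^sup>2) \<le> R n / 4" if "N \<le> n" for n k
  proof -
    have "c * (G (S n) - G (S (n + k))) \<le> c * G (S n)"
      using c Gpos[of "n + k"] by (intro mult_left_mono) auto
    then show ?thesis using tail[OF that, of k] by (simp add: R_def)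
  qed
  have g2: "summable (\<lambda>n. (g n)\<^sup>2)"
  proof -
    have "summable (\<lambda>n. (g (n + N))\<^sup>2)"
    proof (rule summableI_nonneg_bounded)
      fix n
      have "(\<Sum>k<n. (g (k + N))\<^sup>2) = (\<Sum>j=N..<N+n. (g j)\<^sup>2)"
        using sum.shift_bounds_nat_ivl[of "\<lambda>k. (g k)\<^sup>2" 0 N n] by (simp add: lessThan_atLeast0 add.commute)
      then show "(\<Sum>k<n. (g (k + N))\<^sup>2) \<le> R N / 4" using tailR[of N n] by simp
    qed simp
    then show ?thesis by (subst (asm) summable_iff_shift)
  qed
  have g2': "summable (\<lambda>n. (g n)\<^sup>2 / (1 - g n))"
  proof (rule summable_comparison_test_ev)
    have "\<forall>\<^sub>F n in sequentially. (g n)\<^sup>2 < (1 / 2)\<^sup>2"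
      using summable_LIMSEQ_zero[OF g2] by (rule order_tendstoD) simp
    then show "\<forall>\<^sub>F n in sequentially. norm ((g n)\<^sup>2 / (1 - g n)) \<le> 2 * (g n)\<^sup>2"
    proof eventually_elim
      case (elim n)
      then have "g n < 1 / 2" by (rule power2_less_imp_less) simp
      then have "(g n)\<^sup>2 / (1 - g n) \<le> (g n)\<^sup>2 / (1 / 2)"
        using g_range(2)[of n] by (intro divide_left_mono mult_pos_pos) auto
      then show ?case using g_range(2)[of n] by simp
    qed
  qed (intro summable_mult g2)
  \<comment> \<open>\<open>K\<close> is the total excess of g / (1 - g) over g, finite because the
    squared steps are summable; so \<theta> agrees with exp (- b S) up to a constant factor.\<close>
  define K where "K = (\<Sum>n. (g n)\<^sup>2 / (1 - g n))"
  have K: "(\<Sum>k<n. (g k)\<^sup>2 / (1 - g k)) \<le> K" for n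
    unfolding K_def by (rule sum_le_suminf[OF g2']) auto
  define \<theta> where "\<theta> n = exp (- b * (\<Sum>k<n. g k / (1 - g k)))" for n
  have \<theta>: "exp (- b * K) * exp (- b * S n) \<le> \<theta> n" for n
  proof -
    have "g k / (1 - g k) = g k + (g k)\<^sup>2 / (1 - g k)" for k
      using g_range(2)[of k] by (simp add: field_simps power2_eq_square)
    then have "(\<Sum>k<n. g k / (1 - g k)) \<le> S n + K"
      using K[of n] by (simp add: sum.distrib S_def)
    then have "b * (\<Sum>k<n. g k / (1 - g k)) \<le> b * (S n + K)" using b by (intro mult_left_mono) auto
    then show ?thesis unfolding \<theta>_def by (simp add: exp_add[symmetric] algebra_simps)
  qed
  have R_half: "R n \<le> 1 / 2" if n: "N \<le> n" for n
  proof -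
    let ?t = "S n"
    have t: "0 < ?t" using N(1)[OF n] b by (smt (verit) divide_pos_pos)
    \<comment> \<open>The left side is (b t)^2 + b t, which lies below twice the quadratic Taylor
      polynomial of exp (b t); this gives G t \<le> 2 / (b^3 t).\<close>
    have "(?t / b + 1 / b\<^sup>2) * (b ^ 3 * ?t) \<le> 2 * (1 + b * ?t + (b * ?t)\<^sup>2 / 2)"
      using t b by (simp add: field_simps power2_eq_square power3_eq_cube)
    also have "\<dots> \<le> 2 * exp (b * ?t)"
      using t b by (intro mult_left_mono exp_lower_Taylor_quadratic) auto
    finally have e: "(?t / b + 1 / b\<^sup>2) * (b ^ 3 * ?t) \<le> 2 * exp (b * ?t)" .
    have "G ?t * (b ^ 3 * ?t) = (?t / b + 1 / b\<^sup>2) * (b ^ 3 * ?t) * exp (- b * ?t)"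
      by (simp only: G_def mult_ac)
    also have "\<dots> \<le> 2 * exp (b * ?t) * exp (- b * ?t)"
      by (rule mult_right_mono[OF e]) simp
    also have "\<dots> = 2" by (simp add: exp_minus)
    finally have "G ?t * (b ^ 3 * ?t) \<le> 2" .
    moreover have "16 * c \<le> b ^ 3 * ?t"
      using N(3)[OF n] b by (simp add: field_simps)
    then have "G ?t * (16 * c) \<le> G ?t * (b ^ 3 * ?t)"
      using Gpos[of n] by (intro mult_left_mono) auto
    moreover have "R n = G ?t * (16 * c) / 4" by (simp add: R_def)
    ultimately show ?thesis by linarith
  qed
  \<comment> \<open>In 8 c exp 1 / b, the 4 c comes from R, the 2 / b from t / b + 1 / b^2 \<le> 2 t
    / b, and exp 1 bounds the factor exp (b g) lost on passing from S n to S (Suc n). The last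
    \<open>c\<close> accounts for the step g itself.\<close>
  define c1 where "c1 = 8 * c * exp 1 / b + c"
  have c1: "0 < c1" unfolding c1_def using c b by (intro add_nonneg_pos) auto
  have Rg: "R n + g n \<le> c1 * (S (Suc n) * exp (- b * S (Suc n)))" if n: "N \<le> n" for n
  proof -
    let ?t = "S (Suc n)"
    have "1 / b \<le> ?t" using N(1)[OF n] g_range(1)[of n] by (simp only: S_Suc)
    then have "1 / b / b \<le> ?t / b" using b by (intro divide_right_mono) auto
    then have "1 / b\<^sup>2 \<le> ?t / b" by (simp add: power2_eq_square)
    moreover have "S n / b \<le> ?t / b" using b by (intro divide_right_mono) (auto simp: S_Suc)
    ultimately have 1: "S n / b + 1 / b\<^sup>2 \<le> 2 * ?t / b" by simp
    have "b * g n \<le> 1" using b_range by (intro mult_le_one) auto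
    then have 2: "exp (- b * S n) \<le> exp 1 * exp (- b * ?t)"
      by (simp add: S_Suc exp_add[symmetric] algebra_simps)
    have "G (S n) \<le> (2 * ?t / b) * (exp 1 * exp (- b * ?t))"
      unfolding G_def by (intro mult_mono 1 2) (use Spos[of n] b in auto)
    then have "4 * c * G (S n) \<le> 4 * c * ((2 * ?t / b) * (exp 1 * exp (- b * ?t)))"
      using c by (intro mult_left_mono) auto
    then show ?thesis using N(2)[OF n] by (simp add: R_def c1_def algebra_simps)
  qed
  show ?thesis
  proof (rule prob_Yinf_0_null[OF ba Rpos, of N])
    show "(\<Sum>j=n..<n+k. (g j)\<^sup>2) \<le> R n / 4" if "N \<le> n" for n k
      by (rule tailR[OF that])
    show "prob {\<omega> \<in> space M. \<forall>k\<ge>m. Y k \<omega> < R k} = 0" if m: "N \<le> m" for m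
    proof (rule not_below_forever[where \<delta> = "exp (- b * K) / c1" and \<theta> = \<theta>])
      fix n assume n: "m \<le> n"
      show "R n \<le> 1 / 2" using R_half n m by simp
      let ?t = "S (Suc n)"
      have "exp (- b * K) / c1 / ?t = (exp (- b * K) * exp (- b * ?t)) / (c1 * (?t * exp (- b * ?t)))"
        by simp
      also have "\<dots> \<le> \<theta> (Suc n) / (R n + g n)"
        using \<theta>[of "Suc n"] Rg[of n] Rpos[of n] g_range(1)[of n] n m
        by (intro frac_le) (auto simp: \<theta>_def intro: add_pos_pos)
      finally show "exp (- b * K) / c1 / (\<Sum>k<Suc n. g k) \<le> \<theta> (Suc n) / (R n + g n)"
        by (simp add: S_def)
    qed (use b ba x c1 in \<open>auto simp: \<theta>_def\<close>)
  qed
qed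

section \<open>Martingale properties and mirrored statements\<close>

lemma cond_exp_Y_Suc:
  "AE \<omega> in M. real_cond_exp M (F n) (Y (Suc n)) \<omega> = Y n \<omega> + (a - b) * g n * h (Y n \<omega>)"
proof -
  interpret S: finite_measure_subalgebra M "F n"
    by unfold_locales (rule F_subalgebra)
  show ?thesis
  proof (rule S.real_cond_exp_charact)
    show "integrable M (Y (Suc n))" using integrable_Y[of "\<lambda>y. y" 1] by auto
    show "integrable M (\<lambda>\<omega>. Y n \<omega> + (a - b) * g n * h (Y n \<omega>))"
      using integrable_Y[of "\<lambda>y. y" 1] integrable_h by auto
    show "(\<lambda>\<omega>. Y n \<omega> + (a - b) * g n * h (Y n \<omega>)) \<in> borel_measurable (F n)"
      using Y_adapted[of n] by measurable
    fix S assume S: "S \<in> sets (F n)"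
    have "(\<integral>\<omega>. indicator S \<omega> * Y (Suc n) \<omega> \<partial>M) = (\<integral>\<omega>. indicator S \<omega> * gen n (\<lambda>y. y) (Y n \<omega>) \<partial>M)"
      using S by (intro step[where k = 1 and l = 0 and c = 1]) (auto simp: indicator_def)
    then show "(\<integral>\<omega>\<in>S. Y (Suc n) \<omega> \<partial>M) = (\<integral>\<omega>\<in>S. (Y n \<omega> + (a - b) * g n * h (Y n \<omega>)) \<partial>M)"
      by (simp add: set_lebesgue_integral_def gen_id)
  qed
qed

lemma filtration_F: "filtration (space M) F"
  by unfold_locales (auto dest: F_mono_le)

lemma submartingale_Y: "b \<le> a \<Longrightarrow> submartingale M F Y"
  unfolding submartingale_def
proof (intro conjI allI)
  assume ba: "b \<le> a"
  fix n
  show "AE \<omega> in M. Y n \<omega> \<le> real_cond_exp M (F n) (Y (Suc n)) \<omega>"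
    using cond_exp_Y_Suc[of n]
  proof eventually_elim
    case (elim \<omega>)
    have "0 \<le> (a - b) * g n * h (Y n \<omega>)" using ba h_range[of "Y n \<omega>"] by simp
    then show ?case using elim by simp
  qed
  show "integrable M (Y n)" using integrable_Y[of "\<lambda>y. y" 1] by auto
qed (use filtration_F F_subalgebra Y_adapted in auto)

lemma martingale_Y: "a = b \<Longrightarrow> martingale M F Y"
  unfolding martingale_def
proof (intro conjI allI)
  assume ab: "a = b"
  fix n
  show "AE \<omega> in M. real_cond_exp M (F n) (Y (Suc n)) \<omega> = Y n \<omega>"
    using cond_exp_Y_Suc[of n] ab by simp
  show "integrable M (Y n)" using integrable_Y[of "\<lambda>y. y" 1] by auto
qed (use filtration_F F_subalgebra Y_adapted in auto)

text \<open>The threshold of \<open>nonzero_limit\<close> divides by b. For b = 0, almost every path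
  is nondecreasing and starts from x > 0.\<close>

lemma Yinf_0_null:
  assumes ba: "b \<le> a" and x: "0 < x"
    and O: "\<forall>\<^sub>F n in sequentially. g n \<le> C * ((\<Sum>k<Suc n. g k) * exp (- b * (\<Sum>k<Suc n. g k)))"
  shows "AE \<omega> in M. Yinf \<omega> \<noteq> 0"
proof (cases "b = 0")
  case True
  show ?thesis
    using no_down_incseq[OF True] converges
  proof eventually_elim
    case (elim \<omega>)
    then show ?case using incseq_le[of "\<lambda>n. Y n \<omega>" "Yinf \<omega>" 0] x by (simp add: Y_0)
  qed
next
  case False
  then have "prob {\<omega> \<in> space M. Yinf \<omega> = 0} = 0"
    using b_range by (intro nonzero_limit[OF _ ba x O]) simp
  then show ?thesis by (subst (asm) prob_Collect_eq_0) auto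
qed

text \<open>Stated almost everywhere because \<open>lim\<close> takes an unspecified value on
  divergent paths, where mirroring need not commute with it.\<close>

lemma Yinf_swap:
  "AE \<omega> in M. bandit_chain.Yinf (\<lambda>n \<omega>. 1 - Y n \<omega>) \<omega> = 1 - Yinf \<omega>"
proof -
  interpret sw: bandit_chain M F "\<lambda>n \<omega>. 1 - Y n \<omega>" "\<lambda>n. space M - D n" Q P b a g "1 - x"
    by (rule swap)
  show ?thesis
    using converges sw.converges
  proof eventually_elim
    case (elim \<omega>)
    have "(\<lambda>n. 1 - Y n \<omega>) \<longlonglongrightarrow> 1 - Yinf \<omega>" by (intro tendsto_intros elim)
    then show ?case using LIMSEQ_unique[OF elim(2)] by simp
  qed
qed

lemma Yinf_1_null:
  assumes ba: "a \<le> b" and x: "x < 1"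
    and O: "\<forall>\<^sub>F n in sequentially. g n \<le> C * ((\<Sum>k<Suc n. g k) * exp (- a * (\<Sum>k<Suc n. g k)))"
  shows "AE \<omega> in M. Yinf \<omega> \<noteq> 1"
proof -
  interpret sw: bandit_chain M F "\<lambda>n \<omega>. 1 - Y n \<omega>" "\<lambda>n. space M - D n" Q P b a g "1 - x"
    by (rule swap)
  have "AE \<omega> in M. sw.Yinf \<omega> \<noteq> 0" using sw.Yinf_0_null[OF ba _ O] x by simp
  then show ?thesis using Yinf_swap by eventually_elim auto
qed

text \<open>In the mirrored chain the downward moves are those of the first arm, so the summability
  condition involves \<open>a\<close>.\<close>

lemma prob_Yinf_1_pos:
  assumes sm: "summable (\<lambda>n. \<Prod>k<n. 1 - a * g k)" and x: "0 < x"
  shows "0 < prob {\<omega> \<in> space M. Yinf \<omega> = 1}"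
proof -
  interpret sw: bandit_chain M F "\<lambda>n \<omega>. 1 - Y n \<omega>" "\<lambda>n. space M - D n" Q P b a g "1 - x"
    by (rule swap)
  have "0 < prob {\<omega> \<in> space M. sw.Yinf \<omega> = 0}" using sw.prob_Yinf_0_pos[OF sm] x by simp
  also have "prob {\<omega> \<in> space M. sw.Yinf \<omega> = 0} = prob {\<omega> \<in> space M. Yinf \<omega> = 1}"
    by (rule finite_measure_eq_AE) (use Yinf_swap in \<open>eventually_elim, auto\<close>, measurable)
  finally show ?thesis .
qed

lemma fair_avoids_traps:
  assumes ab: "a = b" and x: "0 < x" "x < 1"
    and O: "\<forall>\<^sub>F n in sequentially. g n \<le> C * ((\<Sum>k<Suc n. g k) * exp (- b * (\<Sum>k<Suc n. g k)))"
  shows "AE \<omega> in M. Yinf \<omega> \<in> {0<..<1}"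
proof -
  have "AE \<omega> in M. Yinf \<omega> \<noteq> 0" by (rule Yinf_0_null[OF _ x(1) O]) (simp add: ab)
  moreover have "AE \<omega> in M. Yinf \<omega> \<noteq> 1" by (rule Yinf_1_null[OF _ x(2)]) (use ab O in simp_all)
  ultimately show ?thesis using Yinf_range by eventually_elim auto
qed

end

subsection \<open>Independence and the bandit algorithm\<close>

lemma (in prob_space) distr_Pair_indep:
  assumes [measurable]: "W \<in> measurable M S" "V \<in> measurable M T"
    and indep: "\<And>A B. A \<in> sets S \<Longrightarrow> B \<in> sets T \<Longrightarrow>
      prob ((W -` A \<inter> space M) \<inter> (V -` B \<inter> space M)) = prob (W -` A \<inter> space M) * prob (V -` B \<inter> space M)"
  shows "distr M (S \<Otimes>\<^sub>M T) (\<lambda>\<omega>. (W \<omega>, V \<omega>)) = distr M S W \<Otimes>\<^sub>M distr M T V"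
proof (rule pair_measure_eqI[symmetric])
  show "sigma_finite_measure (distr M S W)" "sigma_finite_measure (distr M T V)"
    by (auto intro!: prob_space_imp_sigma_finite prob_space_distr)
  show "sets (distr M S W \<Otimes>\<^sub>M distr M T V) = sets (distr M (S \<Otimes>\<^sub>M T) (\<lambda>\<omega>. (W \<omega>, V \<omega>)))" by simp
  fix A B assume "A \<in> sets (distr M S W)" "B \<in> sets (distr M T V)"
  then have [measurable]: "A \<in> sets S" "B \<in> sets T" by auto
  have "(\<lambda>\<omega>. (W \<omega>, V \<omega>)) -` (A \<times> B) \<inter> space M = (W -` A \<inter> space M) \<inter> (V -` B \<inter> space M)" by auto
  then show "emeasure (distr M S W) A * emeasure (distr M T V) B =
      emeasure (distr M (S \<Otimes>\<^sub>M T) (\<lambda>\<omega>. (W \<omega>, V \<omega>))) (A \<times> B)"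
    by (simp add: emeasure_distr emeasure_eq_measure indep ennreal_mult)
qed

lemma Int_stable_vimage: "Int_stable {f -` S \<inter> X | S. S \<in> sets borel}"
proof (rule Int_stableI)
  fix a b assume "a \<in> {f -` S \<inter> X | S. S \<in> sets borel}" "b \<in> {f -` S \<inter> X | S. S \<in> sets borel}"
  then obtain S T where "a = f -` S \<inter> X" "b = f -` T \<inter> X" "S \<in> sets borel" "T \<in> sets borel"
    by auto
  then have "a \<inter> b = f -` (S \<inter> T) \<inter> X" "S \<inter> T \<in> sets borel" by auto
  then show "a \<inter> b \<in> {f -` S \<inter> X | S. S \<in> sets borel}" by blast
qed

context two_armed_bandit
begin

text \<open>Both sources of randomness under one index, \<open>True\<close> for the uniform variable
  and \<open>False\<close> for the pair of indicators, so that independence of past and present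
  becomes independence of disjoint blocks of indices.\<close>

definition src :: "nat \<times> bool \<Rightarrow> 'a set set" where
  "src j = (if snd j then {U (fst j) -` S \<inter> space M | S. S \<in> sets borel}
     else {indicator_pair A B (fst j) -` S \<inter> space M | S. S \<in> sets borel})"

lemma U_measurable: "n \<ge> 1 \<Longrightarrow> U n \<in> borel_measurable M"
  using U_indep by (auto simp: indep_vars_def2)

lemma pair_measurable: "n \<ge> 1 \<Longrightarrow> indicator_pair A B n \<in> borel_measurable M"
  using AB_indep by (auto simp: indep_vars_def2)

lemma src_events: "1 \<le> fst j \<Longrightarrow> src j \<subseteq> events"
  using measurable_sets[OF U_measurable] measurable_sets[OF pair_measurable] by (auto simp: src_def)

lemma src_Pow: "src j \<subseteq> Pow (space M)"
  by (auto simp: src_def)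

lemma src_Int_stable: "Int_stable (src j)"
  by (simp add: src_def Int_stable_vimage)

lemma vimage_algebra_coordinate:
  fixes V :: "nat \<Rightarrow> 'a \<Rightarrow> 'c :: topological_space"
  assumes "1 \<le> n" "S \<in> sets borel"
  shows "V n -` S \<inter> space M \<in> sets (vimage_algebra (space M) (\<lambda>\<omega>. \<lambda>n\<in>{1..}. V n \<omega>) (\<Pi>\<^sub>M n\<in>{1..}. borel))"
proof -
  let ?f = "\<lambda>\<omega>. \<lambda>n\<in>{1..}. V n \<omega>" and ?N = "\<Pi>\<^sub>M n\<in>{1..}. borel :: 'c measure"
  let ?A = "{h \<in> space ?N. h n \<in> S}"
  have [measurable]: "n \<in> {1..}" "S \<in> sets borel" using assms by auto
  have "?A \<in> sets ?N" by measurable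
  moreover have "V n -` S \<inter> space M = ?f -` ?A \<inter> space M"
  proof -
    have "?f \<omega> \<in> space ?N" "?f \<omega> n = V n \<omega>" for \<omega>
      using assms(1) by (simp_all add: space_PiM)
    then show ?thesis by (simp add: vimage_def)
  qed
  ultimately show ?thesis by (simp only: in_vimage_algebra)
qed

text \<open>A finite intersection splits into a uniform part and an indicator part. These are
  independent of each other by \<open>U_AB_indep\<close>, and each of them factorises by the
  independence within its own sequence.\<close>

lemma src_indep: "indep_sets src ({1..} \<times> UNIV)"
proof (rule indep_setsI)
  show "src j \<subseteq> events" if "j \<in> {1..} \<times> UNIV" for j using that by (intro src_events) auto
  fix E J assume J: "J \<noteq> {}" "J \<subseteq> {1..} \<times> (UNIV :: bool set)" "finite J" and E: "\<forall>j\<in>J. E j \<in> src j"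
  define I where "I c = {n. (n, c) \<in> J}" for c
  have JI: "J = (\<lambda>n. (n, True)) ` I True \<union> (\<lambda>n. (n, False)) ` I False"
  proof -
    have "(n, c) \<in> J \<longleftrightarrow> (n, c) \<in> (\<lambda>n. (n, True)) ` I True \<union> (\<lambda>n. (n, False)) ` I False" for n c
      by (cases c) (auto simp: I_def)
    then show ?thesis by auto
  qed
  have fin: "finite (I c)" for c
    using finite_vimageI[OF J(3), of "\<lambda>n. (n, c)"] by (simp add: I_def vimage_def inj_on_def)
  have I1: "I c \<subseteq> {1..}" for c using J(2) by (auto simp: I_def)
  have EI: "E (n, c) \<in> src (n, c)" if "n \<in> I c" for n c using E that by (auto simp: I_def)
  \<comment> \<open>Intersecting with the whole space gives the right event when \<open>I c\<close>
    is empty, where the bare intersection would be \<open>UNIV\<close>.\<close>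
  define e where "e c = space M \<inter> (\<Inter>n\<in>I c. E (n, c))" for c
  have e_prod: "prob (e c) = (\<Prod>n\<in>I c. prob (E (n, c)))"
    if "indep_sets (\<lambda>n. src (n, c)) {1..}" for c
  proof (cases "I c = {}")
    case True
    then show ?thesis by (simp add: e_def prob_space)
  next
    case False
    then obtain n where n: "n \<in> I c" by blast
    have "(\<Inter>n\<in>I c. E (n, c)) \<subseteq> E (n, c)" using n by blast
    also have "E (n, c) \<subseteq> space M" using EI[OF n] src_Pow by blast
    finally have "(\<Inter>n\<in>I c. E (n, c)) \<subseteq> space M" .
    then have "e c = (\<Inter>n\<in>I c. E (n, c))" by (auto simp: e_def)
    then show ?thesis
      using indep_setsD[OF that I1 False fin, of "\<lambda>n. E (n, c)"] EI by simp
  qed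
  have ind: "indep_sets (\<lambda>n. src (n, c)) {1..}" for c
    using U_indep AB_indep by (cases c) (simp_all add: src_def indep_vars_def2)
  have "(\<Inter>j\<in>J. E j) = e True \<inter> e False"
  proof -
    obtain j where j: "j \<in> J" using J(1) by blast
    then have "(\<Inter>j\<in>J. E j) \<subseteq> E j" by blast
    also have "E j \<subseteq> space M" using E j src_Pow by blast
    finally have "(\<Inter>j\<in>J. E j) \<subseteq> space M" .
    moreover have "(\<Inter>j\<in>J. E j) = (\<Inter>n\<in>I True. E (n, True)) \<inter> (\<Inter>n\<in>I False. E (n, False))"
      by (subst JI) auto
    ultimately show ?thesis by (auto simp: e_def)
  qed
  moreover have "prob (e True \<inter> e False) = prob (e True) * prob (e False)"
  proof (rule indep_setD[OF U_AB_indep])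
    let ?G = "vimage_algebra (space M) (\<lambda>\<omega>. \<lambda>n\<in>{1..}. U n \<omega>) (\<Pi>\<^sub>M n\<in>{1..}. borel)"
    let ?H = "vimage_algebra (space M) (\<lambda>\<omega>. \<lambda>n\<in>{1..}. indicator_pair A B n \<omega>) (\<Pi>\<^sub>M n\<in>{1..}. borel)"
    have fi: "space N \<inter> (\<Inter>n\<in>I c. E (n, c)) \<in> sets N" if "\<And>n. n \<in> I c \<Longrightarrow> E (n, c) \<in> sets N" for N c
    proof (cases "I c = {}")
      case False
      then have "(\<Inter>n\<in>I c. E (n, c)) \<in> sets N" using that fin by (intro sets.finite_INT) auto
      then show ?thesis by (intro sets.Int) auto
    qed simp
    have "E (n, True) \<in> sets ?G" if n: "n \<in> I True" for n
    proof -
      obtain S where S: "S \<in> sets borel" "E (n, True) = U n -` S \<inter> space M"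
        using EI[OF n] by (auto simp: src_def)
      have "1 \<le> n" using I1[of True] n by auto
      then show ?thesis unfolding S(2) by (rule vimage_algebra_coordinate[OF _ S(1)])
    qed
    then show "e True \<in> sets ?G" using fi[of True ?G] by (simp add: e_def)
    have "E (n, False) \<in> sets ?H" if n: "n \<in> I False" for n
    proof -
      obtain S where S: "S \<in> sets borel" "E (n, False) = indicator_pair A B n -` S \<inter> space M"
        using EI[OF n] by (auto simp: src_def)
      have "1 \<le> n" using I1[of False] n by auto
      then show ?thesis unfolding S(2) by (rule vimage_algebra_coordinate[OF _ S(1)])
    qed
    then show "e False \<in> sets ?H" using fi[of False ?H] by (simp add: e_def)
  qed
  moreover have "(\<Prod>j\<in>J. prob (E j)) = (\<Prod>n\<in>I True. prob (E (n, True))) * (\<Prod>n\<in>I False. prob (E (n, False)))"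
    by (subst JI, subst prod.union_disjoint)
      (auto simp: fin prod.reindex inj_on_def)
  ultimately show "prob (\<Inter>j\<in>J. E j) = (\<Prod>j\<in>J. prob (E j))"
    using e_prod[OF ind, of True] e_prod[OF ind, of False] by simp
qed

section \<open>The filtration, and what is known before an arm answers\<close>

abbreviation F :: "nat \<Rightarrow> 'a measure" where "F \<equiv> bandit_filtration M U A B"

text \<open>The information of the first n steps together with the uniform variable of step n + 1:
  the arm to be played is decided, while its answer is still independent.\<close>

definition past :: "nat \<Rightarrow> 'a measure" where
  "past n = sigma (space M) (\<Union>j\<in>{1..n} \<times> UNIV \<union> {(Suc n, True)}. src j)"

lemma A_sub: "n \<ge> 1 \<Longrightarrow> A n \<subseteq> space M" and B_sub: "n \<ge> 1 \<Longrightarrow> B n \<subseteq> space M"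
  using A_event B_event sets.sets_into_space by blast+

lemma AB_src:
  assumes "n \<ge> 1"
  shows "A n \<in> src (n, False)" "B n \<in> src (n, False)"
proof -
  have c: "{1} \<times> UNIV \<in> sets (borel :: (real \<times> real) measure)" "UNIV \<times> {1} \<in> sets (borel :: (real \<times> real) measure)"
    by (auto intro!: borel_closed closed_Times)
  have "A n = indicator_pair A B n -` ({1} \<times> UNIV) \<inter> space M" "B n = indicator_pair A B n -` (UNIV \<times> {1}) \<inter> space M"
    using A_sub[OF assms] B_sub[OF assms] by (auto simp: indicator_pair_def indicator_def split: if_splits)
  then show "A n \<in> src (n, False)" "B n \<in> src (n, False)" using c by (auto simp: src_def)
qed

lemma F_gen_Pow: "(\<Union>k\<in>{1..n}. {U k -` S \<inter> space M | S. S \<in> sets borel} \<union> {A k, B k}) \<subseteq> Pow (space M)"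
  by (auto dest: A_sub[THEN subsetD, rotated] B_sub[THEN subsetD, rotated])

lemma space_F [simp]: "space (F n) = space M"
  unfolding bandit_filtration_def by (rule space_measure_of[OF F_gen_Pow])

lemma sets_F: "sets (F n) = sigma_sets (space M) (\<Union>k\<in>{1..n}. {U k -` S \<inter> space M | S. S \<in> sets borel} \<union> {A k, B k})"
  unfolding bandit_filtration_def by (rule sets_measure_of[OF F_gen_Pow])

lemma sets_past: "sets (past n) = sigma_sets (space M) (\<Union>j\<in>{1..n} \<times> UNIV \<union> {(Suc n, True)}. src j)"
  unfolding past_def using src_Pow by (intro sets_measure_of) blast

lemma space_past [simp]: "space (past n) = space M"
  unfolding past_def using src_Pow by (intro space_measure_of) blast

lemma sets_F_src: "sets (F n) \<subseteq> sigma_sets (space M) (\<Union>j\<in>{1..n} \<times> UNIV. src j)"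
  unfolding sets_F
proof (rule sigma_sets_mono, rule)
  fix E assume "E \<in> (\<Union>k\<in>{1..n}. {U k -` S \<inter> space M | S. S \<in> sets borel} \<union> {A k, B k})"
  then obtain k where k: "k \<in> {1..n}" "E \<in> {U k -` S \<inter> space M | S. S \<in> sets borel} \<union> {A k, B k}" by blast
  then have "E \<in> src (k, True) \<or> E \<in> src (k, False)"
    using AB_src[of k] by (auto simp: src_def)
  then show "E \<in> sigma_sets (space M) (\<Union>j\<in>{1..n} \<times> UNIV. src j)"
    using k(1) by (intro sigma_sets.Basic) blast
qed

lemma sets_F_events: "sets (F n) \<subseteq> events"
proof -
  have "(\<Union>j\<in>{1..n} \<times> UNIV. src j) \<subseteq> events" using src_events by fastforce
  then show ?thesis using sets_F_src[of n] sets.sigma_sets_subset by blast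
qed

lemma sets_F_Suc: "sets (F n) \<subseteq> sets (F (Suc n))"
  unfolding sets_F by (rule sigma_sets_mono', rule UN_mono) auto

lemma sets_F_past: "sets (F n) \<subseteq> sets (past n)"
proof -
  have "sigma_sets (space M) (\<Union>j\<in>{1..n} \<times> UNIV. src j) \<subseteq> sets (past n)"
    unfolding sets_past by (rule sigma_sets_mono') auto
  then show ?thesis using sets_F_src[of n] by blast
qed

lemma sets_past_events: "sets (past n) \<subseteq> events"
  unfolding sets_past using src_events by (intro sets.sigma_sets_subset) fastforce

lemma F_subalgebra: "subalgebra M (F n)"
  using sets_F_events by (simp add: subalgebra_def)

lemma AB_F: "k \<in> {1..n} \<Longrightarrow> A k \<in> sets (F n)" "k \<in> {1..n} \<Longrightarrow> B k \<in> sets (F n)"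
  unfolding sets_F by (auto intro!: sigma_sets.Basic)

lemma U_F: "k \<in> {1..n} \<Longrightarrow> U k \<in> borel_measurable (F n)"
  by (rule measurableI) (auto simp: sets_F intro!: sigma_sets.Basic)

lemma U_past: "U (Suc n) \<in> borel_measurable (past n)"
proof (rule measurableI)
  fix S :: "real set" assume "S \<in> sets borel"
  then have "U (Suc n) -` S \<inter> space M \<in> src (Suc n, True)" by (auto simp: src_def)
  then show "U (Suc n) -` S \<inter> space (past n) \<in> sets (past n)"
    unfolding sets_past space_past by (intro sigma_sets.Basic) auto
qed simp

lemma indep_past_AB:
  assumes "E \<in> sets (past n)" "C \<in> src (Suc n, False)"
  shows "prob (E \<inter> C) = prob E * prob C"
proof -
  let ?I = "\<lambda>c. if c then {1..n} \<times> UNIV \<union> {(Suc n, True)} else {(Suc n, False)}"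
  have "indep_sets (\<lambda>c. sigma_sets (space M) (\<Union>j\<in>?I c. src j)) UNIV"
    using src_Int_stable
    by (intro indep_sets_collect_sigma indep_sets_mono_index[OF _ src_indep])
      (auto simp: disjoint_family_on_def split: if_splits)
  then have "indep_set (sets (past n)) (sigma_sets (space M) (src (Suc n, False)))"
    unfolding indep_set_def sets_past
    by (rule indep_sets_cong[THEN iffD1, rotated 2]) (auto split: bool.split)
  then show ?thesis using assms by (auto intro: indep_setD)
qed

lemma indep_F_U:
  assumes "E \<in> sets (F n)" "C \<in> src (Suc n, True)"
  shows "prob (E \<inter> C) = prob E * prob C"
proof -
  let ?I = "\<lambda>c. if c then {1..n} \<times> UNIV else {(Suc n, True)}"
  have "indep_sets (\<lambda>c. sigma_sets (space M) (\<Union>j\<in>?I c. src j)) UNIV"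
    using src_Int_stable
    by (intro indep_sets_collect_sigma indep_sets_mono_index[OF _ src_indep])
      (auto simp: disjoint_family_on_def split: if_splits)
  then have "indep_set (sigma_sets (space M) (\<Union>j\<in>{1..n} \<times> UNIV. src j)) (sigma_sets (space M) (src (Suc n, True)))"
    unfolding indep_set_def
    by (rule indep_sets_cong[THEN iffD1, rotated 2]) (auto split: bool.split)
  then show ?thesis using assms sets_F_src[of n] by (auto intro: indep_setD)
qed

lemma integral_past_AB:
  assumes f: "f \<in> borel_measurable (past n)" "\<And>\<omega>. \<omega> \<in> space M \<Longrightarrow> \<bar>f \<omega>\<bar> \<le> c"
    and C: "C \<in> src (Suc n, False)"
  shows "(\<integral>\<omega>. f \<omega> * indicator C \<omega> \<partial>M) = prob C * (\<integral>\<omega>. f \<omega> \<partial>M)"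
proof -
  have CM [measurable]: "C \<in> events" using C src_events[of "(Suc n, False)"] by auto
  have fM [measurable]: "f \<in> borel_measurable M"
    by (rule measurable_from_subalg[OF _ f(1)]) (simp add: subalgebra_def sets_past_events)
  have "indep_set (sets (past n)) (sigma_sets (space M) {C})"
  proof -
    have "indep_set (sets (past n)) {C}"
      using indep_past_AB C CM sets_past_events by (intro indep_setI) auto
    then have "indep_set (sigma_sets (space M) (sets (past n))) (sigma_sets (space M) {C})"
      by (rule indep_set_sigma_sets) (auto intro!: Int_stableI sets.Int)
    then show ?thesis using sets.sigma_sets_eq[of "past n"] by simp
  qed
  then have "indep_var borel f borel (indicator C :: 'a \<Rightarrow> real)"
    unfolding indep_var_eq
  proof (intro conjI)
    assume i: "indep_set (sets (past n)) (sigma_sets (space M) {C})"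
    have "{f -` S \<inter> space M | S. S \<in> sets borel} \<subseteq> sets (past n)"
      using measurable_sets[OF f(1)] by auto
    then have 1: "sigma_sets (space M) {f -` S \<inter> space M | S. S \<in> sets borel} \<subseteq> sets (past n)"
      using sets.sigma_sets_subset[of _ "past n"] by simp
    have 2: "sigma_sets (space M) {(indicator C :: 'a \<Rightarrow> real) -` S \<inter> space M | S. S \<in> sets (borel :: real measure)} \<subseteq> sigma_sets (space M) {C}"
    proof (rule sigma_sets_mono, rule)
      fix E assume "E \<in> {(indicator C :: 'a \<Rightarrow> real) -` S \<inter> space M | S. S \<in> sets (borel :: real measure)}"
      then obtain S where E: "E = (indicator C :: 'a \<Rightarrow> real) -` S \<inter> space M" by auto
      have Cs: "C \<subseteq> space M" using sets.sets_into_space[OF CM] .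
      have "C \<in> sigma_sets (space M) {C}" "space M - C \<in> sigma_sets (space M) {C}"
        "space M \<in> sigma_sets (space M) {C}" "{} \<in> sigma_sets (space M) {C}"
        by (auto intro: sigma_sets.intros sigma_sets_top)
      moreover have "E = (if 1 \<in> S then (if 0 \<in> S then space M else C) else (if 0 \<in> S then space M - C else {}))"
      proof -
        have "((indicator C \<omega> :: real) \<in> S) = (if \<omega> \<in> C then 1 \<in> S else 0 \<in> S)" for \<omega>
          by simp
        then show ?thesis unfolding E using Cs by (auto split: if_splits)
      qed
      ultimately show "E \<in> sigma_sets (space M) {C}" by simp
    qed
    show "indep_set (sigma_sets (space M) {f -` S \<inter> space M | S. S \<in> sets borel})
        (sigma_sets (space M) {(indicator C :: 'a \<Rightarrow> real) -` S \<inter> space M | S. S \<in> sets (borel :: real measure)})"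
      using indep_setD[OF i] 1 2 sets_past_events CM
      by (intro indep_setI) (auto intro!: sets.sigma_sets_subset measurable_sets[OF fM])
  qed auto
  then have "(\<integral>\<omega>. f \<omega> * indicator C \<omega> \<partial>M) = (\<integral>\<omega>. f \<omega> \<partial>M) * (\<integral>\<omega>. indicator C \<omega> \<partial>M)"
  proof (rule indep_var_lebesgue_integral)
    show "integrable M f" by (rule integrable_bounded[OF fM f(2)])
    show "integrable M (indicator C :: 'a \<Rightarrow> real)"
      by (rule integrable_bounded[of _ 1]) (auto simp: indicator_def)
  qed
  then show ?thesis by simp
qed

lemma prob_U_le:
  assumes "n \<ge> 1" "0 \<le> y" "y \<le> 1"
  shows "measure (distr M borel (U n)) {..y} = y"
proof -
  have "{0..1} \<inter> {..y} = {0..y}" using assms by auto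
  then show ?thesis
    unfolding U_uniform[OF assms(1)] using assms by (subst measure_uniform_measure) auto
qed

text \<open>\<open>Z\<close> and \<open>V\<close> are kept together as one vector, since they may
  depend on each other. That vector is independent of \<open>U (Suc n)\<close>, so Fubini integrates
  the uniform variable first, and its distribution function is the identity on [0, 1].\<close>

lemma integral_draw:
  assumes Z: "Z \<in> borel_measurable (F n)" "\<And>\<omega>. \<omega> \<in> space M \<Longrightarrow> \<bar>Z \<omega>\<bar> \<le> (c::real)"
    and V: "V \<in> borel_measurable (F n)" "\<And>\<omega>. \<omega> \<in> space M \<Longrightarrow> 0 \<le> V \<omega> \<and> V \<omega> \<le> 1"
  shows "(\<integral>\<omega>. Z \<omega> * indicator {\<omega> \<in> space M. U (Suc n) \<omega> \<le> V \<omega>} \<omega> \<partial>M) = (\<integral>\<omega>. Z \<omega> * V \<omega> \<partial>M)"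
proof -
  let ?W = "\<lambda>\<omega>. (Z \<omega>, V \<omega>)" and ?U = "U (Suc n)"
  have [measurable]: "Z \<in> borel_measurable M" "V \<in> borel_measurable M" "?U \<in> borel_measurable M"
    using Z(1) V(1) measurable_from_subalg[OF F_subalgebra] U_measurable by auto
  have WF: "?W \<in> measurable (F n) (borel \<Otimes>\<^sub>M borel)" using Z(1) V(1) by measurable
  have W [measurable]: "?W \<in> measurable M (borel \<Otimes>\<^sub>M borel)" by measurable
  let ?PW = "distr M (borel \<Otimes>\<^sub>M borel) ?W" and ?PU = "distr M borel ?U"
  have joint: "distr M ((borel \<Otimes>\<^sub>M borel) \<Otimes>\<^sub>M borel) (\<lambda>\<omega>. (?W \<omega>, ?U \<omega>)) = ?PW \<Otimes>\<^sub>M ?PU"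
  proof (rule distr_Pair_indep)
    fix S :: "(real \<times> real) set" and T :: "real set" assume S: "S \<in> sets (borel \<Otimes>\<^sub>M borel)" and T: "T \<in> sets borel"
    show "prob ((?W -` S \<inter> space M) \<inter> (?U -` T \<inter> space M)) = prob (?W -` S \<inter> space M) * prob (?U -` T \<inter> space M)"
      using measurable_sets[OF WF S] T by (intro indep_F_U) (auto simp: src_def)
  qed measurable
  interpret PW: prob_space ?PW by (rule prob_space_distr) measurable
  interpret PU: prob_space ?PU by (rule prob_space_distr) measurable
  interpret PP: pair_sigma_finite ?PW ?PU ..
  define \<phi> where "\<phi> w = fst (fst w) * (if snd w \<le> snd (fst w) then 1 else 0)" for w :: "(real \<times> real) \<times> real"
  have \<phi> [measurable]: "\<phi> \<in> borel_measurable ((borel \<Otimes>\<^sub>M borel) \<Otimes>\<^sub>M borel)"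
    unfolding \<phi>_def by measurable
  have "(\<integral>\<omega>. Z \<omega> * indicator {\<omega> \<in> space M. ?U \<omega> \<le> V \<omega>} \<omega> \<partial>M) = (\<integral>\<omega>. \<phi> (?W \<omega>, ?U \<omega>) \<partial>M)"
    by (rule Bochner_Integration.integral_cong[OF refl]) (auto simp: \<phi>_def)
  also have "\<dots> = (\<integral>w. \<phi> w \<partial>(?PW \<Otimes>\<^sub>M ?PU))"
    unfolding joint[symmetric] by (subst integral_distr) auto
  also have "\<dots> = (\<integral>v. (\<integral>u. \<phi> (v, u) \<partial>?PU) \<partial>?PW)"
  proof (rule PP.integral_fst'[symmetric])
    have "integrable M (\<lambda>\<omega>. \<phi> (?W \<omega>, ?U \<omega>))"
      using Z(2) abs_ge_zero order_trans by (intro integrable_bounded[of _ c]) (auto simp: \<phi>_def intro: order_trans[OF abs_ge_zero])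
    then show "integrable (?PW \<Otimes>\<^sub>M ?PU) \<phi>"
      unfolding joint[symmetric] by (subst integrable_distr_eq) auto
  qed
  also have "\<dots> = (\<integral>v. fst v * measure ?PU {..snd v} \<partial>?PW)"
  proof (rule Bochner_Integration.integral_cong[OF refl])
    fix v :: "real \<times> real"
    have "(\<integral>u. \<phi> (v, u) \<partial>?PU) = (\<integral>u. fst v * indicator {..snd v} u \<partial>?PU)"
      by (rule Bochner_Integration.integral_cong[OF refl]) (auto simp: \<phi>_def)
    then show "(\<integral>u. \<phi> (v, u) \<partial>?PU) = fst v * measure ?PU {..snd v}" by simp
  qed
  also have "\<dots> = (\<integral>\<omega>. Z \<omega> * measure ?PU {..V \<omega>} \<partial>M)"
  proof -
    have "mono (\<lambda>y. measure ?PU {..y})"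
      by (intro monoI PU.finite_measure_mono) auto
    then have [measurable]: "(\<lambda>y. measure ?PU {..y}) \<in> borel_measurable borel"
      by (rule borel_measurable_mono)
    show ?thesis by (subst integral_distr) (auto)
  qed
  also have "\<dots> = (\<integral>\<omega>. Z \<omega> * V \<omega> \<partial>M)"
    by (rule Bochner_Integration.integral_cong[OF refl]) (use V(2) prob_U_le[of "Suc n"] in auto)
  finally show ?thesis .
qed

text \<open>Taken inside \<open>space M\<close>, unlike the sets in \<open>bandit\<close>, so that
  it is measurable and its complement in the space is the event of playing the other arm.\<close>

definition draw_A :: "real \<Rightarrow> nat \<Rightarrow> 'a set" where
  "draw_A x n = {\<omega> \<in> space M. U (Suc n) \<omega> \<le> bandit U A B \<gamma> x n \<omega>}"

lemma bandit_Suc_indicator: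
  "bandit U A B \<gamma> x (Suc n) \<omega> = bandit U A B \<gamma> x n \<omega> + \<gamma> (Suc n) *
    ((1 - bandit U A B \<gamma> x n \<omega>) * indicator (draw_A x n \<inter> A (Suc n)) \<omega>
     - bandit U A B \<gamma> x n \<omega> * indicator ((space M - draw_A x n) \<inter> B (Suc n)) \<omega>)"
proof -
  have "{\<omega>'. U (Suc n) \<omega>' \<le> bandit U A B \<gamma> x n \<omega>'} \<inter> A (Suc n) = draw_A x n \<inter> A (Suc n)"
    "{\<omega>'. U (Suc n) \<omega>' > bandit U A B \<gamma> x n \<omega>'} \<inter> B (Suc n) = (space M - draw_A x n) \<inter> B (Suc n)"
    using A_sub[of "Suc n"] B_sub[of "Suc n"] by (auto simp: draw_A_def)
  then show ?thesis by simp
qed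

lemma bandit_range:
  assumes "0 \<le> x" "x \<le> 1"
  shows "0 \<le> bandit U A B \<gamma> x n \<omega> \<and> bandit U A B \<gamma> x n \<omega> \<le> 1"
proof (induction n)
  case (Suc n)
  then show ?case
    unfolding bandit_Suc_indicator using step_range[of "Suc n"]
      bounded_update[of "bandit U A B \<gamma> x n \<omega>" "\<gamma> (Suc n)" "\<omega> \<in> draw_A x n \<inter> A (Suc n)"
        "\<omega> \<in> (space M - draw_A x n) \<inter> B (Suc n)"]
    by (simp add: indicator_def)
qed (use assms in simp)

lemma bandit_adapted_step:
  assumes X: "bandit U A B \<gamma> x n \<in> borel_measurable (F n)"
  shows "draw_A x n \<in> sets (F (Suc n))" "bandit U A B \<gamma> x (Suc n) \<in> borel_measurable (F (Suc n))"
proof -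
  have [measurable]: "bandit U A B \<gamma> x n \<in> borel_measurable (F (Suc n))"
    by (rule measurable_from_subalg[OF _ X]) (simp add: subalgebra_def sets_F_Suc)
  have [measurable]: "U (Suc n) \<in> borel_measurable (F (Suc n))" by (rule U_F) simp
  have [measurable]: "A (Suc n) \<in> sets (F (Suc n))" "B (Suc n) \<in> sets (F (Suc n))"
    by (rule AB_F, simp)+
  have "{\<omega> \<in> space (F (Suc n)). U (Suc n) \<omega> \<le> bandit U A B \<gamma> x n \<omega>} \<in> sets (F (Suc n))"
    by measurable
  then show D [measurable]: "draw_A x n \<in> sets (F (Suc n))" by (simp add: draw_A_def)
  have [measurable]: "space M - draw_A x n \<in> sets (F (Suc n))"
    using sets.compl_sets[OF D] by simp
  show "bandit U A B \<gamma> x (Suc n) \<in> borel_measurable (F (Suc n))"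
    unfolding bandit_Suc_indicator by measurable
qed

lemma bandit_adapted: "bandit U A B \<gamma> x n \<in> borel_measurable (F n)"
  by (induction n) (use bandit_adapted_step in auto)

lemma prob_AB_Suc: "prob (A (Suc n)) = p\<^sub>A" "prob (B (Suc n)) = p\<^sub>B"
proof -
  let ?P = "indicator_pair A B"
  have c: "{1} \<times> UNIV \<in> sets (borel :: (real \<times> real) measure)" "UNIV \<times> {1} \<in> sets (borel :: (real \<times> real) measure)"
    by (auto intro!: borel_closed closed_Times)
  have e: "A k = ?P k -` ({1} \<times> UNIV) \<inter> space M" "B k = ?P k -` (UNIV \<times> {1}) \<inter> space M" if "1 \<le> k" for k
    using A_sub[OF that] B_sub[OF that] by (auto simp: indicator_pair_def indicator_def split: if_splits)
  have "prob (?P (Suc n) -` S \<inter> space M) = prob (?P 1 -` S \<inter> space M)" if "S \<in> sets borel" for S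
    using arg_cong[OF AB_ident[of "Suc n"], of "\<lambda>N. measure N S"] that pair_measurable
    by (simp add: measure_distr)
  then show "prob (A (Suc n)) = p\<^sub>A" "prob (B (Suc n)) = p\<^sub>B"
    unfolding prob_A[symmetric] prob_B[symmetric] using c e[of "Suc n"] e[of 1] by simp_all
qed

lemma steps_not_summable: "\<not> summable (\<lambda>n. \<gamma> (Suc n))"
proof
  assume "summable (\<lambda>n. \<gamma> (Suc n))"
  then have "(\<lambda>n. \<Sum>k<n. \<gamma> (Suc k)) \<longlonglongrightarrow> (\<Sum>n. \<gamma> (Suc n))" by (rule summable_LIMSEQ)
  moreover have "cumulative_step \<gamma> = (\<lambda>n. \<Sum>k<n. \<gamma> (Suc k))"
    by (simp add: cumulative_step_def sum.atLeast1_atMost_eq fun_eq_iff)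
  ultimately show False
    using step_diverges not_tendsto_and_filterlim_at_infinity[of sequentially]
      filterlim_at_top_imp_at_infinity by (metis trivial_limit_sequentially)
qed

text \<open>Two layers of independence per step: \<open>U (Suc n)\<close> is independent of
  \<open>F n\<close>, which gives the conditional probability X n of playing the first arm; the
  answer of the arm played is independent of \<open>past n\<close>, which contributes the factor
  \<open>p\<^sub>A\<close> or \<open>p\<^sub>B\<close>. The chain counts steps from 0, hence the
  shift to \<gamma> (Suc n).\<close>

lemma chain:
  assumes x: "0 \<le> x" "x \<le> 1"
  shows "bandit_chain M F (bandit U A B \<gamma> x) (draw_A x) (\<lambda>n. draw_A x n \<inter> A (Suc n))
    (\<lambda>n. (space M - draw_A x n) \<inter> B (Suc n)) p\<^sub>A p\<^sub>B (\<lambda>n. \<gamma> (Suc n)) x"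
proof -
  let ?X = "bandit U A B \<gamma> x"
  have AB: "A (Suc n) \<in> sets (F (Suc n))" "B (Suc n) \<in> sets (F (Suc n))" for n
    by (rule AB_F, simp)+
  have D: "draw_A x n \<in> sets (F (Suc n))" for n by (rule bandit_adapted_step[OF bandit_adapted])
  have Dc: "space M - draw_A x n \<in> sets (F (Suc n))" for n
    using sets.compl_sets[OF D[of n]] by simp
  have draw: "(\<integral>\<omega>. Z \<omega> * indicator (draw_A x n) \<omega> \<partial>M) = (\<integral>\<omega>. Z \<omega> * ?X n \<omega> \<partial>M)"
    if "Z \<in> borel_measurable (F n)" "\<And>\<omega>. \<omega> \<in> space M \<Longrightarrow> \<bar>Z \<omega>\<bar> \<le> c" for n Z and c :: real
    unfolding draw_A_def using that bandit_adapted bandit_range[OF x] by (intro integral_draw) auto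
  have dp [measurable]: "draw_A x n \<in> sets (past n)" for n
  proof -
    have [measurable]: "?X n \<in> borel_measurable (past n)"
      by (rule measurable_from_subalg[OF _ bandit_adapted]) (simp add: subalgebra_def sets_F_past)
    note [measurable] = U_past[of n]
    have "{\<omega> \<in> space (past n). U (Suc n) \<omega> \<le> ?X n \<omega>} \<in> sets (past n)" by measurable
    then show ?thesis by (simp add: draw_A_def)
  qed
  have cp [measurable]: "space M - draw_A x n \<in> sets (past n)" for n
    using sets.compl_sets[OF dp[of n]] by simp
  have past: "(\<integral>\<omega>. Z \<omega> * indicator (S \<inter> C) \<omega> \<partial>M) = prob C * (\<integral>\<omega>. Z \<omega> * indicator S \<omega> \<partial>M)"
    if Z: "Z \<in> borel_measurable (F n)" "\<And>\<omega>. \<omega> \<in> space M \<Longrightarrow> \<bar>Z \<omega>\<bar> \<le> c"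
      and [measurable]: "S \<in> sets (past n)" and C: "C \<in> src (Suc n, False)" for n Z S C and c :: real
  proof -
    have [measurable]: "Z \<in> borel_measurable (past n)"
      by (rule measurable_from_subalg[OF _ Z(1)]) (simp add: subalgebra_def sets_F_past)
    have "(\<integral>\<omega>. (Z \<omega> * indicator S \<omega>) * indicator C \<omega> \<partial>M) = prob C * (\<integral>\<omega>. Z \<omega> * indicator S \<omega> \<partial>M)"
      using Z(2) C by (intro integral_past_AB[of _ n c]) (auto simp: indicator_def intro: order_trans[OF abs_ge_zero])
    then show ?thesis by (simp add: indicator_inter_arith mult.assoc)
  qed
  have p: "0 \<le> p\<^sub>A" "p\<^sub>A \<le> 1" "0 \<le> p\<^sub>B" "p\<^sub>B \<le> 1"
    unfolding prob_A[symmetric] prob_B[symmetric] by auto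
  have g: "0 < \<gamma> (Suc n)" "\<gamma> (Suc n) < 1" for n using step_range[of "Suc n"] by auto
  show ?thesis
  proof (unfold_locales)
    fix n
    show "subalgebra M (F n)" by (rule F_subalgebra)
    show "sets (F n) \<subseteq> sets (F (Suc n))" by (rule sets_F_Suc)
    show "?X n \<in> borel_measurable (F n)" by (rule bandit_adapted)
    show "draw_A x n \<in> sets (F (Suc n))" by (rule D)
    show "draw_A x n \<inter> A (Suc n) \<in> sets (F (Suc n))" "(space M - draw_A x n) \<inter> B (Suc n) \<in> sets (F (Suc n))"
      using D Dc AB by auto
    fix Z and c :: real assume Z: "Z \<in> borel_measurable (F n)" "\<And>\<omega>. \<omega> \<in> space M \<Longrightarrow> \<bar>Z \<omega>\<bar> \<le> c"
    show "(\<integral>\<omega>. Z \<omega> * indicator (draw_A x n) \<omega> \<partial>M) = (\<integral>\<omega>. Z \<omega> * ?X n \<omega> \<partial>M)"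
      by (rule draw[OF Z])
    show "(\<integral>\<omega>. Z \<omega> * indicator (draw_A x n \<inter> A (Suc n)) \<omega> \<partial>M) = p\<^sub>A * (\<integral>\<omega>. Z \<omega> * ?X n \<omega> \<partial>M)"
      using past[OF Z dp AB_src(1)] by (simp add: draw[OF Z] prob_AB_Suc)
    have ZM [measurable]: "Z \<in> borel_measurable M" by (rule measurable_from_subalg[OF F_subalgebra Z(1)])
    have XM [measurable]: "?X n \<in> borel_measurable M" by (rule measurable_from_subalg[OF F_subalgebra bandit_adapted])
    have DM [measurable]: "draw_A x n \<in> events" using D[of n] sets_F_events by blast
    have i: "integrable M Z" by (rule integrable_bounded[OF ZM Z(2)])
    have i1: "integrable M (\<lambda>\<omega>. Z \<omega> * indicator (draw_A x n) \<omega>)"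
      using i by (intro integrable_real_mult_indicator) auto
    have i2: "integrable M (\<lambda>\<omega>. Z \<omega> * ?X n \<omega>)"
      by (rule integrable_bounded[of _ c]) (auto intro!: abs_mult_le_left Z(2) simp: bandit_range[OF x])
    have "(\<integral>\<omega>. Z \<omega> * indicator (space M - draw_A x n) \<omega> \<partial>M) = (\<integral>\<omega>. Z \<omega> - Z \<omega> * indicator (draw_A x n) \<omega> \<partial>M)"
      by (rule Bochner_Integration.integral_cong[OF refl]) (auto simp: indicator_def)
    also have "\<dots> = (\<integral>\<omega>. Z \<omega> - Z \<omega> * ?X n \<omega> \<partial>M)" using i i1 i2 draw[OF Z] by simp
    finally show "(\<integral>\<omega>. Z \<omega> * indicator ((space M - draw_A x n) \<inter> B (Suc n)) \<omega> \<partial>M)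
        = p\<^sub>B * (\<integral>\<omega>. Z \<omega> * (1 - ?X n \<omega>) \<partial>M)"
      using past[OF Z cp AB_src(2)] by (simp add: prob_AB_Suc right_diff_distrib)
  qed (use x p g steps_not_summable bandit_Suc_indicator in \<open>auto simp del: bandit.simps(2)\<close>)
qed

end

theorem theorem1:
  fixes M :: "'a measure" and U :: "nat \<Rightarrow> 'a \<Rightarrow> real" and A B :: "nat \<Rightarrow> 'a set"
    and p\<^sub>A p\<^sub>B :: real and \<gamma> \<Gamma> :: "nat \<Rightarrow> real" and h :: "real \<Rightarrow> real"
    and X :: "real \<Rightarrow> nat \<Rightarrow> 'a \<Rightarrow> real" and Xinf :: "real \<Rightarrow> 'a \<Rightarrow> real"
    and F :: "nat \<Rightarrow> 'a measure"
  defines "\<Gamma> \<equiv> cumulative_step \<gamma>"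
    and "h \<equiv> \<lambda>y. y * (1 - y)"
    and "X \<equiv> bandit U A B \<gamma>"
    and "Xinf \<equiv> bandit_limit U A B \<gamma>"
    and "F \<equiv> bandit_filtration M U A B"
  assumes bandit: "two_armed_bandit M U A B p\<^sub>A p\<^sub>B \<gamma>"
  shows
    \<comment> \<open>existence of the limit\<close>
    "(\<forall>x\<in>{0..1}.
        (\<forall>n. \<forall>\<omega>\<in>space M. X x n \<omega> \<in> {0..1}) \<and>
        Xinf x \<in> borel_measurable M \<and>
        (AE \<omega> in M. (\<lambda>n. X x n \<omega>) \<longlonglongrightarrow> Xinf x \<omega>))
     \<and>
     \<comment> \<open>(a) (i)\<close>
     (0 < p\<^sub>B \<and> p\<^sub>B < p\<^sub>A \<and> p\<^sub>A \<le> 1 \<longrightarrow> (\<forall>x\<in>{0<..<1}.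
        submartingale M F (X x) \<and>
        (AE \<omega> in M. Xinf x \<omega> \<in> {0, 1}) \<and>
        summable (\<lambda>n. \<gamma> (Suc n) * (\<integral>\<omega>. h (X x n \<omega>) \<partial>M)) \<and>
        measure M {\<omega>\<in>space M. Xinf x \<omega> = 1}
          = x + (p\<^sub>A - p\<^sub>B) * (\<Sum>n. \<gamma> (Suc n) * (\<integral>\<omega>. h (X x n \<omega>) \<partial>M)) \<and>
        x + (p\<^sub>A - p\<^sub>B) * (\<Sum>n. \<gamma> (Suc n) * (\<integral>\<omega>. h (X x n \<omega>) \<partial>M))
          > x + (p\<^sub>A - p\<^sub>B) * \<gamma> 1 * x * (1 - x) \<and>
        x + (p\<^sub>A - p\<^sub>B) * \<gamma> 1 * x * (1 - x) > x))
     \<and>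
     (p\<^sub>B = 0 \<and> 0 < p\<^sub>A \<longrightarrow> (\<forall>x\<in>{0<..<1}.
        AE \<omega> in M. incseq (\<lambda>n. X x n \<omega>) \<and> (\<lambda>n. X x n \<omega>) \<longlonglongrightarrow> 1))
     \<and>
     \<comment> \<open>(a) (ii)\<close>
     (0 < p\<^sub>B \<and> p\<^sub>B = p\<^sub>A \<and> p\<^sub>A \<le> 1 \<longrightarrow> (\<forall>x\<in>{0<..<1}.
        martingale M F (X x) \<and>
        (\<not> summable (\<lambda>n. (\<gamma> (Suc n))\<^sup>2) \<longrightarrow>
           (AE \<omega> in M. Xinf x \<omega> \<in> {0, 1}) \<and>
           distr M borel (Xinf x) = distr (measure_pmf (bernoulli_pmf x)) borel of_bool)))
     \<and>
     (p\<^sub>B = 0 \<and> p\<^sub>A = 0 \<longrightarrow> (\<forall>x\<in>{0..1}. AE \<omega> in M. \<forall>n. X x n \<omega> = x))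
     \<and>
     \<comment> \<open>(a) (iii)\<close>
     (\<forall>x\<in>{0, 1}. AE \<omega> in M. \<forall>n. X x n \<omega> = x)
     \<and>
     \<comment> \<open>(b)\<close>
     (summable (\<lambda>n. \<Prod>k=1..n. 1 - p\<^sub>B * \<gamma> k) \<longrightarrow>
        (\<forall>x\<in>{0..<1}. measure M {\<omega>\<in>space M. Xinf x \<omega> = 0} > 0) \<and>
        (0 < p\<^sub>B \<and> p\<^sub>B < p\<^sub>A \<and> p\<^sub>A \<le> 1 \<longrightarrow> (\<forall>x\<in>{0<..<1}.
           measure M {\<omega>\<in>space M. (\<lambda>n. X x n \<omega>) \<longlonglongrightarrow> 0} > 0)) \<and>
        (0 < p\<^sub>B \<and> p\<^sub>B = p\<^sub>A \<and> p\<^sub>A \<le> 1 \<and> summable (\<lambda>n. (\<gamma> (Suc n))\<^sup>2) \<longrightarrow> (\<forall>x\<in>{0<..<1}.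
           measure M {\<omega>\<in>space M. Xinf x \<omega> = 0} > 0 \<and>
           measure M {\<omega>\<in>space M. Xinf x \<omega> = 1} > 0 \<and>
           measure M {\<omega>\<in>space M. Xinf x \<omega> \<in> {0<..<1}} > 0)))
     \<and>
     \<comment> \<open>(c)\<close>
     (0 \<le> p\<^sub>B \<and> p\<^sub>B \<le> p\<^sub>A \<and> p\<^sub>A \<le> 1 \<and> \<gamma> \<in> O(\<lambda>n. \<Gamma> n * exp (- p\<^sub>B * \<Gamma> n)) \<longrightarrow>
        (\<forall>x\<in>{0<..1}. measure M {\<omega>\<in>space M. Xinf x \<omega> = 0} = 0) \<and>
        (p\<^sub>B < p\<^sub>A \<longrightarrow> (\<forall>x\<in>{0<..1}. AE \<omega> in M. Xinf x \<omega> = 1)) \<and>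
        (p\<^sub>B = p\<^sub>A \<longrightarrow> (\<forall>x\<in>{0<..<1}. AE \<omega> in M. Xinf x \<omega> \<in> {0<..<1})))"
proof -
  interpret tb: two_armed_bandit M U A B p\<^sub>A p\<^sub>B \<gamma> by (rule bandit)
  note defs = X_def Xinf_def F_def
  have p: "0 \<le> p\<^sub>A" "p\<^sub>A \<le> 1" "0 \<le> p\<^sub>B" "p\<^sub>B \<le> 1"
    unfolding tb.prob_A[symmetric] tb.prob_B[symmetric] by auto
  have chain: "bandit_chain M F (X x) (tb.draw_A x) (\<lambda>n. tb.draw_A x n \<inter> A (Suc n))
      (\<lambda>n. (space M - tb.draw_A x n) \<inter> B (Suc n)) p\<^sub>A p\<^sub>B (\<lambda>n. \<gamma> (Suc n)) x"
    if "x \<in> {0..1}" for x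
    unfolding defs using that by (intro tb.chain) auto
  have Xinf: "bandit_chain.Yinf (X x) = Xinf x" if "x \<in> {0..1}" for x
    using bandit_chain.Yinf_def[OF chain[OF that]]
    by (simp add: fun_eq_iff Xinf_def X_def bandit_limit_def)
  have h: "bandit_chain.h = h"
    using bandit_chain.h_def[OF chain[of 0]] by (simp add: fun_eq_iff h_def)
  have ic: "x \<in> {0..1}" if "x \<in> {0<..<1}" for x :: real using that by auto
  have existence: "(\<forall>n. \<forall>\<omega>\<in>space M. X x n \<omega> \<in> {0..1}) \<and> Xinf x \<in> borel_measurable M \<and>
      (AE \<omega> in M. (\<lambda>n. X x n \<omega>) \<longlonglongrightarrow> Xinf x \<omega>)" if x: "x \<in> {0..1}" for x
    using bandit_chain.Y_range[OF chain[OF x]] bandit_chain.Yinf_measurable[OF chain[OF x]]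
      bandit_chain.converges[OF chain[OF x]] by (simp add: Xinf[OF x])
  have biased: "submartingale M F (X x) \<and>
        (AE \<omega> in M. Xinf x \<omega> \<in> {0, 1}) \<and>
        summable (\<lambda>n. \<gamma> (Suc n) * (\<integral>\<omega>. h (X x n \<omega>) \<partial>M)) \<and>
        measure M {\<omega>\<in>space M. Xinf x \<omega> = 1}
          = x + (p\<^sub>A - p\<^sub>B) * (\<Sum>n. \<gamma> (Suc n) * (\<integral>\<omega>. h (X x n \<omega>) \<partial>M)) \<and>
        x + (p\<^sub>A - p\<^sub>B) * (\<Sum>n. \<gamma> (Suc n) * (\<integral>\<omega>. h (X x n \<omega>) \<partial>M))
          > x + (p\<^sub>A - p\<^sub>B) * \<gamma> 1 * x * (1 - x) \<and>
        x + (p\<^sub>A - p\<^sub>B) * \<gamma> 1 * x * (1 - x) > x"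
    if ab: "p\<^sub>B < p\<^sub>A" and x: "x \<in> {0<..<1}" for x
  proof -
    interpret c: bandit_chain M F "X x" "tb.draw_A x" "\<lambda>n. tb.draw_A x n \<inter> A (Suc n)"
      "\<lambda>n. (space M - tb.draw_A x n) \<inter> B (Suc n)" p\<^sub>A p\<^sub>B "\<lambda>n. \<gamma> (Suc n)" x
      by (rule chain[OF ic[OF x]])
    have ne: "p\<^sub>A \<noteq> p\<^sub>B" using ab by simp
    have "\<gamma> 1 * h x < (\<Sum>n. \<gamma> (Suc n) * (\<integral>\<omega>. h (X x n \<omega>) \<partial>M))"
      using c.biased_increase[OF ab] x by (simp add: h)
    then have "(p\<^sub>A - p\<^sub>B) * (\<gamma> 1 * h x) < (p\<^sub>A - p\<^sub>B) * (\<Sum>n. \<gamma> (Suc n) * (\<integral>\<omega>. h (X x n \<omega>) \<partial>M))"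
      using ab by (intro mult_strict_left_mono) auto
    moreover have "0 < (p\<^sub>A - p\<^sub>B) * \<gamma> 1 * x * (1 - x)"
      using ab x c.g_range(1)[of 0] by (intro mult_pos_pos) auto
    ultimately show ?thesis
      using c.submartingale_Y ab c.biased_binary[OF ne] c.biased_summable[OF ne] c.biased_prob[OF ne]
      by (simp add: Xinf[OF ic[OF x]] h) (simp add: h_def mult.assoc)
  qed
  have pure_birth: "AE \<omega> in M. incseq (\<lambda>n. X x n \<omega>) \<and> (\<lambda>n. X x n \<omega>) \<longlonglongrightarrow> 1"
    if "p\<^sub>B = 0" "0 < p\<^sub>A" and x: "x \<in> {0<..<1}" for x
    using that by (intro bandit_chain.no_down_limit[OF chain[OF ic[OF x]]]) auto
  have fair: "martingale M F (X x) \<and>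
        (\<not> summable (\<lambda>n. (\<gamma> (Suc n))\<^sup>2) \<longrightarrow>
           (AE \<omega> in M. Xinf x \<omega> \<in> {0, 1}) \<and>
           distr M borel (Xinf x) = distr (measure_pmf (bernoulli_pmf x)) borel of_bool)"
    if "0 < p\<^sub>B" "p\<^sub>B = p\<^sub>A" and x: "x \<in> {0<..<1}" for x
  proof -
    note c = chain[OF ic[OF x]]
    have ab: "p\<^sub>A = p\<^sub>B" "0 < p\<^sub>A" using that by auto
    show ?thesis
      using bandit_chain.martingale_Y[OF c ab(1)] bandit_chain.fair_binary[OF c ab]
        bandit_chain.fair_distribution[OF c ab(1)]
      by (simp add: Xinf[OF ic[OF x]])
  qed
  have frozen: "AE \<omega> in M. \<forall>n. X x n \<omega> = x" if "x = 0 \<or> x = 1 \<or> p\<^sub>A = 0 \<and> p\<^sub>B = 0" "x \<in> {0..1}" for x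
    using that(1) by (rule bandit_chain.frozen[OF chain[OF that(2)]])
  have prods: "(\<lambda>n. \<Prod>k=1..n. 1 - p\<^sub>B * \<gamma> k) = (\<lambda>n. \<Prod>k<n. 1 - p\<^sub>B * \<gamma> (Suc k))"
    by (simp add: prod.atLeast1_atMost_eq)
  have trapped: "0 < measure M {\<omega>\<in>space M. Xinf x \<omega> = 0}"
    if "summable (\<lambda>n. \<Prod>k=1..n. 1 - p\<^sub>B * \<gamma> k)" and x: "x \<in> {0..<1}" for x
  proof -
    have x1: "x \<in> {0..1}" using x by auto
    show ?thesis
      using bandit_chain.prob_Yinf_0_pos[OF chain[OF x1] that(1)[unfolded prods]] x by (simp add: Xinf[OF x1])
  qed
  have fallible: "0 < measure M {\<omega>\<in>space M. (\<lambda>n. X x n \<omega>) \<longlonglongrightarrow> 0}"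
    if "summable (\<lambda>n. \<Prod>k=1..n. 1 - p\<^sub>B * \<gamma> k)" and x: "x \<in> {0<..<1}" for x
  proof -
    have [measurable]: "Xinf x \<in> borel_measurable M" "X x n \<in> borel_measurable M" for n
      using existence[OF ic[OF x]] bandit_chain.Y_measurable[OF chain[OF ic[OF x]]] by auto
    \<comment> \<open>\<open>Xinf\<close> also has a value on divergent paths, so the two events are
      compared only almost everywhere.\<close>
    have "measure M {\<omega>\<in>space M. Xinf x \<omega> = 0} \<le> measure M {\<omega>\<in>space M. (\<lambda>n. X x n \<omega>) \<longlonglongrightarrow> 0}"
    proof (rule tb.finite_measure_mono_AE)
      show "AE \<omega> in M. \<omega> \<in> {\<omega>\<in>space M. Xinf x \<omega> = 0} \<longrightarrow> \<omega> \<in> {\<omega>\<in>space M. (\<lambda>n. X x n \<omega>) \<longlonglongrightarrow> 0}"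
        using existence[OF ic[OF x]] by auto
    qed measurable
    then show ?thesis using trapped[OF that(1), of x] x by auto
  qed
  have three: "0 < measure M {\<omega>\<in>space M. Xinf x \<omega> = 0} \<and> 0 < measure M {\<omega>\<in>space M. Xinf x \<omega> = 1} \<and>
      0 < measure M {\<omega>\<in>space M. Xinf x \<omega> \<in> {0<..<1}}"
    if sm: "summable (\<lambda>n. \<Prod>k=1..n. 1 - p\<^sub>B * \<gamma> k)" and "p\<^sub>B = p\<^sub>A" "summable (\<lambda>n. (\<gamma> (Suc n))\<^sup>2)"
      and x: "x \<in> {0<..<1}" for x
  proof -
    note c = chain[OF ic[OF x]]
    \<comment> \<open>With equal success probabilities the given summability condition is also the
      one required of the mirrored chain.\<close>
    have "0 < measure M {\<omega>\<in>space M. Xinf x \<omega> = 1}"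
      using bandit_chain.prob_Yinf_1_pos[OF c sm[unfolded prods, unfolded that(2)]] x by (simp add: Xinf[OF ic[OF x]])
    moreover have "0 < measure M {\<omega>\<in>space M. Xinf x \<omega> \<in> {0<..<1}}"
      using bandit_chain.fair_interior[OF c _ that(3)] that(2) x by (simp add: Xinf[OF ic[OF x]])
    ultimately show ?thesis using trapped[OF sm, of x] x by auto
  qed
  have avoided: "measure M {\<omega>\<in>space M. Xinf x \<omega> = 0} = 0" "p\<^sub>B < p\<^sub>A \<Longrightarrow> AE \<omega> in M. Xinf x \<omega> = 1"
    "p\<^sub>B = p\<^sub>A \<Longrightarrow> x < 1 \<Longrightarrow> AE \<omega> in M. Xinf x \<omega> \<in> {0<..<1}"
    if ba: "p\<^sub>B \<le> p\<^sub>A" and O: "\<gamma> \<in> O(\<lambda>n. \<Gamma> n * exp (- p\<^sub>B * \<Gamma> n))" and x: "x \<in> {0<..1}" for x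
  proof -
    have x1: "x \<in> {0..1}" using x by auto
    note c = chain[OF x1]
    have \<Gamma>: "\<Gamma> n = (\<Sum>k<n. \<gamma> (Suc k))" for n
      by (simp add: \<Gamma>_def cumulative_step_def sum.atLeast1_atMost_eq)
    obtain C where C: "\<forall>\<^sub>F n in sequentially. norm (\<gamma> n) \<le> C * norm (\<Gamma> n * exp (- p\<^sub>B * \<Gamma> n))"
      using O by (elim landau_o.bigE)
    \<comment> \<open>After the shift by one, step n of the chain is compared with the partial sum
      that already includes this step.\<close>
    then have "\<forall>\<^sub>F n in sequentially. norm (\<gamma> (Suc n)) \<le> C * norm (\<Gamma> (Suc n) * exp (- p\<^sub>B * \<Gamma> (Suc n)))"
      by (subst eventually_sequentially_Suc)
    then have ev: "\<forall>\<^sub>F n in sequentially. \<gamma> (Suc n) \<le>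
        C * ((\<Sum>k<Suc n. \<gamma> (Suc k)) * exp (- p\<^sub>B * (\<Sum>k<Suc n. \<gamma> (Suc k))))"
    proof eventually_elim
      case (elim n)
      have "0 \<le> \<gamma> (Suc k)" for k using tb.step_range[of "Suc k"] by simp
      then have "0 \<le> (\<Sum>k<Suc n. \<gamma> (Suc k))" "0 \<le> \<gamma> (Suc n)" by (blast intro: sum_nonneg)+
      then show ?case using elim by (simp only: \<Gamma> real_norm_def abs_mult abs_of_nonneg abs_exp_cancel)
    qed
    have m [measurable]: "Xinf x \<in> borel_measurable M" using existence[OF x1] by auto
    have nz: "AE \<omega> in M. Xinf x \<omega> \<noteq> 0"
      using bandit_chain.Yinf_0_null[OF c ba _ ev] x by (simp add: Xinf[OF x1])
    then show "measure M {\<omega>\<in>space M. Xinf x \<omega> = 0} = 0"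
      by (subst tb.prob_Collect_eq_0) auto
    show "AE \<omega> in M. Xinf x \<omega> = 1" if "p\<^sub>B < p\<^sub>A"
    proof -
      have "AE \<omega> in M. Xinf x \<omega> \<in> {0, 1}"
        using bandit_chain.biased_binary[OF c] that by (simp add: Xinf[OF x1])
      with nz show ?thesis by eventually_elim auto
    qed
    show "AE \<omega> in M. Xinf x \<omega> \<in> {0<..<1}" if "p\<^sub>B = p\<^sub>A" "x < 1"
      using bandit_chain.fair_avoids_traps[OF c _ _ _ ev] that x by (simp add: Xinf[OF x1])
  qed
  show ?thesis
    using existence biased pure_birth fair frozen trapped fallible three avoided
    by (intro conjI impI ballI) auto
qed

end
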